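(* Let $E$ and $F$ be row-finite directed graphs with no sinks. Let $\{s_e,p_v\}$ be the (universal) generating Cuntz-Krieger $E$-family for $C^*(E)$ and $\{t_e,q_v\}$ the (universal) generating Cuntz-Krieger $F$-family for $C^*(F)$. If $\psi:X_F\to X_E$ is a $1$-block conjugacy with a bounded inverse $\phi:X_E\to X_F$, and if $\Phi:B_n(X_E)\to F^1$ is the $n$-block map associated to $\phi$ (so that $\phi(x)_i=\Phi(x_i\ldots x_{i+n-1})$ for all $x\in E^\infty$ and $i\in\mathbb{N}$), then there exists a $*$-isomorphism $\pi:C^*(E)\to C^*(F)$ with $$\pi(s_e)=\sum_{\substack{g\in F^1\\ \exists\,\alpha\in r(e)E^{n-1}:\ \Phi(e\alpha)=g}}t_g\quad(e\in E^1)\qquad\text{and}\qquad \pi(p_v)=\sum_{\substack{g\in F^1\\ \exists\,\beta\in vE^n:\ \Phi(\beta)=g}}t_gt_g^*\quad(v\in E^0).$$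
   Context: Graphs. A directed graph $E=(E^0,E^1,r,s)$ consists of countable sets $E^0$ (vertices), $E^1$ (edges) and range and source maps $r,s:E^1\to E^0$. A vertex $v$ is a sink if $s^{-1}(v)=\emptyset$; $E$ is row-finite if $s^{-1}(v)$ is finite for every $v$. $E^n$ is the set of paths $e_1\ldots e_n$ of length $n$ ($r(e_i)=s(e_{i+1})$), with vertices being paths of length $0$ (with $s(v)=v$); $E^\infty$ is the set of infinite paths. $vE^n:=\{\alpha\in E^n:s(\alpha)=v\}$; concatenating an edge $e$ with the vertex $r(e)$ gives $e$. Edge shifts. For a set $\mathcal{A}$, let $\mathcal{A}^0=\{\vec{0}\}$ ($\vec{0}$ the empty sequence). If $\mathcal{A}$ is infinite, $\Sigma_{\mathcal{A}}:=\mathcal{A}^{\mathbb{N}}\sqcup\bigcup_{k\ge0}\mathcal{A}^k$ with the quotient topology from the map $Q:\mathcal{A}_\infty\times\mathcal{A}_\infty\times\cdots\to\Sigma_{\mathcal{A}}$ that truncates a sequence just before the first occurrence of $\infty$, where $\mathcal{A}_\infty=\mathcal{A}\cup\{\infty\}$ is the one-point compactification of the discrete space $\mathcal{A}$. If $\mathcal{A}$ is finite, $\Sigma_{\mathcal{A}}:=\mathcal{A}^{\mathbb{N}}$ with the product topology. $l(x)$ is the length of $x$; the shift map $\sigma$ deletes the first entry, with $\sigma(x)=\vec0$ when $l(x)\le1$. For a graph $E$ with no sinks, the edge shift $X_E$ is the closure of $E^\infty$ in $\Sigma_{E^1}$; for row-finite $E$ it equals $E^\infty$ if $E^1$ is finite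 and $E^\infty\cup\{\vec 0\}$ if $E^1$ is infinite. $B_n(X_E)$ is the set of blocks of length $n$ occurring in elements of $X_E$; it equals the set of consecutive $n$-edge strings of infinite paths. A conjugacy $X\to Y$ between shift spaces is a continuous bijection commuting with $\sigma$ and preserving length. For row-finite edge shifts, a map $\phi:X_E\to X_F$ is an $n$-block code, with $n$-block map $\Phi:B_n(X_E)\to F^1$, if (a) $x^k\to\vec 0$ in $X_E$ implies $\phi(x^k)\to\vec 0$ in $X_F$ and (b) $\phi(x)_i=\Phi(x_i\ldots x_{i+n-1})$ for all $i\in\mathbb{N}$, $x\in E^\infty$. A conjugacy is $1$-block if it is a $1$-block code, and bounded if it is an $n$-block code for some $n\in\mathbb{N}$. Graph $C^*$-algebras. For row-finite $E$, a Cuntz-Krieger $E$-family in a $C^*$-algebra consists of mutually orthogonal projections $\{P_v:v\in E^0\}$ and partial isometries $\{S_e:e\in E^1\}$ with (CK1) $S_e^*S_e=P_{r(e)}$ for all $e\in E^1$ and (CK2) $P_v=\sum_{s(e)=v}S_eS_e^*$ whenever $v$ is not a sink. $C^*(E)$ is the universal $C^*$-algebra generated by a Cuntz-Krieger $E$-family. *)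

theory Defs
  imports "HOL-Analysis.Analysis" "HOL-Algebra.Module" "Graph_Theory.Digraph" "Graph_Theory.Arc_Walk"
begin

section \<open>Graphs\<close>

text \<open>The source and range maps are \<^const>\<open>tail\<close> and \<^const>\<open>head\<close>.\<close>

locale directed_graph = wf_digraph G for G :: "('v, 'e) pre_digraph" (structure) +
  assumes countable_verts: "countable (verts G)"
    and countable_arcs: "countable (arcs G)"

definition row_finite :: "('v, 'e) pre_digraph \<Rightarrow> bool" where
  "row_finite G \<longleftrightarrow> (\<forall>v\<in>verts G. finite (out_arcs G v))"

definition sink :: "('v, 'e) pre_digraph \<Rightarrow> 'v \<Rightarrow> bool" where
  "sink G v \<longleftrightarrow> v \<in> verts G \<and> out_arcs G v = {}"

text \<open>The set \<open>v E\<^sup>n\<close>. For \<open>n = 0\<close> it is \<open>{[]}\<close>: the empty edge list stands for the vertex \<open>v\<close>,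
  so that prefixing an edge with range \<open>v\<close> to it returns that edge.\<close>

definition paths_from :: "('v, 'e) pre_digraph \<Rightarrow> 'v \<Rightarrow> nat \<Rightarrow> 'e list set" where
  "paths_from G v n = {p. length p = n \<and> (\<exists>w. pre_digraph.awalk G v p w)}"

definition infinite_paths :: "('v, 'e) pre_digraph \<Rightarrow> (nat \<Rightarrow> 'e) set" where
  "infinite_paths G = {x. \<forall>i. x i \<in> arcs G \<and> head G (x i) = tail G (x (Suc i))}"


section \<open>Shift spaces over possibly infinite alphabets\<close>

text \<open>A finite or infinite sequence is a function \<open>x :: nat \<Rightarrow> 'a option\<close>, indexed from \<open>0\<close>, such
  that \<open>x j = None\<close> whenever \<open>x i = None\<close> and \<open>i \<le> j\<close>. In the one-point compactification, whose
  underlying type is also \<open>'a option\<close>, \<^const>\<open>None\<close> is the point at infinity.\<close>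

definition empty_seq :: "nat \<Rightarrow> 'a option" where
  "empty_seq = (\<lambda>_. None)"

definition inf_seq :: "(nat \<Rightarrow> 'a) \<Rightarrow> nat \<Rightarrow> 'a option" where
  "inf_seq x = (\<lambda>i. Some (x i))"

definition seq_length :: "(nat \<Rightarrow> 'a option) \<Rightarrow> enat" where
  "seq_length x = (if \<forall>i. x i \<noteq> None then \<infinity> else enat (LEAST i. x i = None))"

definition shift :: "(nat \<Rightarrow> 'a option) \<Rightarrow> nat \<Rightarrow> 'a option" where
  "shift x = (\<lambda>i. x (Suc i))"

definition truncate :: "(nat \<Rightarrow> 'a option) \<Rightarrow> nat \<Rightarrow> 'a option" where
  "truncate x = (\<lambda>i. if \<exists>j\<le>i. x j = None then None else x i)"

definition quotient_topology :: "'a topology \<Rightarrow> ('a \<Rightarrow> 'b) \<Rightarrow> 'b topology" where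
  "quotient_topology X f =
     topology (\<lambda>U. U \<subseteq> f ` topspace X \<and> openin X {x \<in> topspace X. f x \<in> U})"

lemma openin_quotient_topology:
  "openin (quotient_topology X f) U \<longleftrightarrow>
     U \<subseteq> f ` topspace X \<and> openin X {x \<in> topspace X. f x \<in> U}"
proof -
  let ?O = "\<lambda>U. U \<subseteq> f ` topspace X \<and> openin X {x \<in> topspace X. f x \<in> U}"
  have "istopology ?O"
    unfolding istopology_def
  proof (intro conjI allI impI)
    fix S T assume ST: "?O S" "?O T"
    then show "S \<inter> T \<subseteq> f ` topspace X" by blast
    have "{x \<in> topspace X. f x \<in> S \<inter> T} = {x \<in> topspace X. f x \<in> S} \<inter> {x \<in> topspace X. f x \<in> T}"
      by auto
    with ST show "openin X {x \<in> topspace X. f x \<in> S \<inter> T}" by auto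
  next
    fix \<K> assume K: "\<forall>K\<in>\<K>. ?O K"
    then show "\<Union>\<K> \<subseteq> f ` topspace X" by blast
    have "{x \<in> topspace X. f x \<in> \<Union>\<K>} = (\<Union>K\<in>\<K>. {x \<in> topspace X. f x \<in> K})"
      by auto
    with K show "openin X {x \<in> topspace X. f x \<in> \<Union>\<K>}" by auto
  qed
  then show ?thesis
    by (simp add: quotient_topology_def topology_inverse')
qed

lemma quotient_map_quotient_topology: "quotient_map X (quotient_topology X f) f"
proof -
  have "openin (quotient_topology X f) (f ` topspace X)"
    by (simp add: openin_quotient_topology)
      (metis (no_types, lifting) Collect_cong Collect_mem_eq imageI openin_topspace)
  then have "topspace (quotient_topology X f) = f ` topspace X"
    by (meson openin_quotient_topology openin_subset openin_topspace subset_antisym)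
  then show ?thesis
    by (auto simp: quotient_map_def openin_quotient_topology)
qed

definition full_shift :: "'a set \<Rightarrow> (nat \<Rightarrow> 'a option) topology" where
  "full_shift \<A> =
     (if finite \<A> then product_topology (\<lambda>_. discrete_topology (Some ` \<A>)) UNIV
      else quotient_topology
             (product_topology (\<lambda>_. Alexandroff_compactification (discrete_topology \<A>)) UNIV) truncate)"

definition edge_shift :: "('v, 'e) pre_digraph \<Rightarrow> (nat \<Rightarrow> 'e option) set" where
  "edge_shift G = full_shift (arcs G) closure_of (inf_seq ` infinite_paths G)"

definition edge_shift_topology :: "('v, 'e) pre_digraph \<Rightarrow> (nat \<Rightarrow> 'e option) topology" where
  "edge_shift_topology G = subtopology (full_shift (arcs G)) (edge_shift G)"

definition blocks :: "nat \<Rightarrow> (nat \<Rightarrow> 'a option) set \<Rightarrow> 'a list set" where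
  "blocks n X = {b. length b = n \<and> (\<exists>x\<in>X. \<exists>i. map x [i..<i+n] = map Some b)}"

definition conjugacy ::
    "('v, 'e) pre_digraph \<Rightarrow> ('w, 'f) pre_digraph \<Rightarrow> ((nat \<Rightarrow> 'e option) \<Rightarrow> (nat \<Rightarrow> 'f option)) \<Rightarrow> bool" where
  "conjugacy E F \<phi> \<longleftrightarrow>
     continuous_map (edge_shift_topology E) (edge_shift_topology F) \<phi> \<and>
     bij_betw \<phi> (edge_shift E) (edge_shift F) \<and>
     (\<forall>x\<in>edge_shift E. \<phi> (shift x) = shift (\<phi> x)) \<and>
     (\<forall>x\<in>edge_shift E. seq_length (\<phi> x) = seq_length x)"

text \<open>In clause (a), \<^const>\<open>limitin\<close> requires the limit to lie in the space; the clause is therefore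
  vacuous when \<open>E\<close> has finitely many edges and \<^const>\<open>empty_seq\<close> is not a point of its edge shift.\<close>

definition block_code ::
    "('v, 'e) pre_digraph \<Rightarrow> ('w, 'f) pre_digraph \<Rightarrow> nat \<Rightarrow> ('e list \<Rightarrow> 'f) \<Rightarrow>
     ((nat \<Rightarrow> 'e option) \<Rightarrow> (nat \<Rightarrow> 'f option)) \<Rightarrow> bool" where
  "block_code E F n \<Phi> \<phi> \<longleftrightarrow>
     \<phi> \<in> edge_shift E \<rightarrow> edge_shift F \<and>
     \<Phi> \<in> blocks n (edge_shift E) \<rightarrow> arcs F \<and>
     (\<forall>x. (\<forall>k. x k \<in> edge_shift E) \<and> limitin (edge_shift_topology E) x empty_seq sequentially \<longrightarrow>
        limitin (edge_shift_topology F) (\<lambda>k. \<phi> (x k)) empty_seq sequentially) \<and>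
     (\<forall>x\<in>infinite_paths E. \<forall>i. \<phi> (inf_seq x) i = Some (\<Phi> (map x [i..<i+n])))"


section \<open>C*-algebras\<close>

text \<open>The algebras are not assumed to be unital; the inherited record field \<^const>\<open>one\<close> plays no role.\<close>

record 'a cstar = "(complex, 'a) module" +
  adj :: "'a \<Rightarrow> 'a"
  cnorm :: "'a \<Rightarrow> real"

locale cstar_algebra = abelian_group A for A :: "'a cstar" (structure) +
  assumes smult_closed: "x \<in> carrier A \<Longrightarrow> a \<odot> x \<in> carrier A"
    and smult_l_distr: "x \<in> carrier A \<Longrightarrow> (a + b) \<odot> x = a \<odot> x \<oplus> b \<odot> x"
    and smult_r_distr: "\<lbrakk>x \<in> carrier A; y \<in> carrier A\<rbrakk> \<Longrightarrow> a \<odot> (x \<oplus> y) = a \<odot> x \<oplus> a \<odot> y"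
    and smult_assoc1: "x \<in> carrier A \<Longrightarrow> (a * b) \<odot> x = a \<odot> (b \<odot> x)"
    and smult_one: "x \<in> carrier A \<Longrightarrow> 1 \<odot> x = x"
    and mult_closed: "\<lbrakk>x \<in> carrier A; y \<in> carrier A\<rbrakk> \<Longrightarrow> x \<otimes> y \<in> carrier A"
    and mult_assoc: "\<lbrakk>x \<in> carrier A; y \<in> carrier A; z \<in> carrier A\<rbrakk> \<Longrightarrow> (x \<otimes> y) \<otimes> z = x \<otimes> (y \<otimes> z)"
    and mult_l_distr: "\<lbrakk>x \<in> carrier A; y \<in> carrier A; z \<in> carrier A\<rbrakk> \<Longrightarrow> (x \<oplus> y) \<otimes> z = x \<otimes> z \<oplus> y \<otimes> z"
    and mult_r_distr: "\<lbrakk>x \<in> carrier A; y \<in> carrier A; z \<in> carrier A\<rbrakk> \<Longrightarrow> z \<otimes> (x \<oplus> y) = z \<otimes> x \<oplus> z \<otimes> y"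
    and smult_mult_l: "\<lbrakk>x \<in> carrier A; y \<in> carrier A\<rbrakk> \<Longrightarrow> (a \<odot> x) \<otimes> y = a \<odot> (x \<otimes> y)"
    and smult_mult_r: "\<lbrakk>x \<in> carrier A; y \<in> carrier A\<rbrakk> \<Longrightarrow> x \<otimes> (a \<odot> y) = a \<odot> (x \<otimes> y)"
    and adj_closed: "x \<in> carrier A \<Longrightarrow> adj A x \<in> carrier A"
    and adj_adj: "x \<in> carrier A \<Longrightarrow> adj A (adj A x) = x"
    and adj_add: "\<lbrakk>x \<in> carrier A; y \<in> carrier A\<rbrakk> \<Longrightarrow> adj A (x \<oplus> y) = adj A x \<oplus> adj A y"
    and adj_smult: "x \<in> carrier A \<Longrightarrow> adj A (a \<odot> x) = cnj a \<odot> adj A x"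
    and adj_mult: "\<lbrakk>x \<in> carrier A; y \<in> carrier A\<rbrakk> \<Longrightarrow> adj A (x \<otimes> y) = adj A y \<otimes> adj A x"
    and cnorm_nonneg: "x \<in> carrier A \<Longrightarrow> 0 \<le> cnorm A x"
    and cnorm_eq_0_iff: "x \<in> carrier A \<Longrightarrow> cnorm A x = 0 \<longleftrightarrow> x = \<zero>"
    and cnorm_triangle: "\<lbrakk>x \<in> carrier A; y \<in> carrier A\<rbrakk> \<Longrightarrow> cnorm A (x \<oplus> y) \<le> cnorm A x + cnorm A y"
    and cnorm_smult: "x \<in> carrier A \<Longrightarrow> cnorm A (a \<odot> x) = cmod a * cnorm A x"
    and cnorm_mult: "\<lbrakk>x \<in> carrier A; y \<in> carrier A\<rbrakk> \<Longrightarrow> cnorm A (x \<otimes> y) \<le> cnorm A x * cnorm A y"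
    and cnorm_adj_mult: "x \<in> carrier A \<Longrightarrow> cnorm A (adj A x \<otimes> x) = (cnorm A x)\<^sup>2"
    and complete: "\<lbrakk>\<And>n::nat. u n \<in> carrier A;
        \<And>\<epsilon>. \<epsilon> > 0 \<Longrightarrow> \<exists>N. \<forall>m\<ge>N. \<forall>n\<ge>N. cnorm A (u m \<ominus> u n) < \<epsilon>\<rbrakk>
        \<Longrightarrow> \<exists>l\<in>carrier A. (\<lambda>n. cnorm A (u n \<ominus> l)) \<longlonglongrightarrow> 0"

definition star_hom :: "'a cstar \<Rightarrow> 'b cstar \<Rightarrow> ('a \<Rightarrow> 'b) \<Rightarrow> bool" where
  "star_hom A B \<pi> \<longleftrightarrow>
     \<pi> \<in> carrier A \<rightarrow> carrier B \<and>
     (\<forall>x\<in>carrier A. \<forall>y\<in>carrier A. \<pi> (x \<oplus>\<^bsub>A\<^esub> y) = \<pi> x \<oplus>\<^bsub>B\<^esub> \<pi> y) \<and>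
     (\<forall>x\<in>carrier A. \<forall>y\<in>carrier A. \<pi> (x \<otimes>\<^bsub>A\<^esub> y) = \<pi> x \<otimes>\<^bsub>B\<^esub> \<pi> y) \<and>
     (\<forall>a. \<forall>x\<in>carrier A. \<pi> (a \<odot>\<^bsub>A\<^esub> x) = a \<odot>\<^bsub>B\<^esub> \<pi> x) \<and>
     (\<forall>x\<in>carrier A. \<pi> (adj A x) = adj B (\<pi> x))"

definition star_iso :: "'a cstar \<Rightarrow> 'b cstar \<Rightarrow> ('a \<Rightarrow> 'b) \<Rightarrow> bool" where
  "star_iso A B \<pi> \<longleftrightarrow> star_hom A B \<pi> \<and> bij_betw \<pi> (carrier A) (carrier B)"

definition cstar_subalgebra :: "'a cstar \<Rightarrow> 'a set \<Rightarrow> bool" where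
  "cstar_subalgebra A C \<longleftrightarrow>
     C \<subseteq> carrier A \<and> \<zero>\<^bsub>A\<^esub> \<in> C \<and>
     (\<forall>x\<in>C. \<forall>y\<in>C. x \<oplus>\<^bsub>A\<^esub> y \<in> C) \<and>
     (\<forall>x\<in>C. \<forall>y\<in>C. x \<otimes>\<^bsub>A\<^esub> y \<in> C) \<and>
     (\<forall>a. \<forall>x\<in>C. a \<odot>\<^bsub>A\<^esub> x \<in> C) \<and>
     (\<forall>x\<in>C. adj A x \<in> C) \<and>
     (\<forall>x. \<forall>l\<in>carrier A. (\<forall>n::nat. x n \<in> C) \<and> (\<lambda>n. cnorm A (x n \<ominus>\<^bsub>A\<^esub> l)) \<longlonglongrightarrow> 0 \<longrightarrow> l \<in> C)"

definition generates :: "'a cstar \<Rightarrow> 'a set \<Rightarrow> bool" where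
  "generates A X \<longleftrightarrow>
     X \<subseteq> carrier A \<and> (\<forall>C. cstar_subalgebra A C \<and> X \<subseteq> C \<longrightarrow> C = carrier A)"

definition projection :: "'a cstar \<Rightarrow> 'a \<Rightarrow> bool" where
  "projection A p \<longleftrightarrow> p \<in> carrier A \<and> adj A p = p \<and> p \<otimes>\<^bsub>A\<^esub> p = p"

definition partial_isometry :: "'a cstar \<Rightarrow> 'a \<Rightarrow> bool" where
  "partial_isometry A s \<longleftrightarrow> s \<in> carrier A \<and> s \<otimes>\<^bsub>A\<^esub> adj A s \<otimes>\<^bsub>A\<^esub> s = s"


section \<open>Graph C*-algebras\<close>

definition CK_family :: "('v, 'e) pre_digraph \<Rightarrow> 'a cstar \<Rightarrow> ('e \<Rightarrow> 'a) \<Rightarrow> ('v \<Rightarrow> 'a) \<Rightarrow> bool" where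
  "CK_family G A S P \<longleftrightarrow>
     (\<forall>v\<in>verts G. projection A (P v)) \<and>
     (\<forall>v\<in>verts G. \<forall>w\<in>verts G. v \<noteq> w \<longrightarrow> P v \<otimes>\<^bsub>A\<^esub> P w = \<zero>\<^bsub>A\<^esub>) \<and>
     (\<forall>e\<in>arcs G. partial_isometry A (S e)) \<and>
     (\<forall>e\<in>arcs G. adj A (S e) \<otimes>\<^bsub>A\<^esub> S e = P (head G e)) \<and>
     (\<forall>v\<in>verts G. \<not> sink G v \<longrightarrow>
        P v = (\<Oplus>\<^bsub>A\<^esub>e\<in>out_arcs G v. S e \<otimes>\<^bsub>A\<^esub> adj A (S e)))"

text \<open>\<open>A\<close>, together with the generating family \<open>s, p\<close>, is the universal C*-algebra of the graph. HOL
  cannot quantify over the carrier types of all C*-algebras \<open>B\<close> inside a formula, so the carriers range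
  over the subsets of the type \<open>nat \<Rightarrow> nat\<close>. This loses nothing: the graph is countable, so a
  Cuntz-Krieger family in any C*-algebra generates a separable C*-subalgebra; the latter has at most
  continuum many elements and hence an isomorphic copy among the algebras \<open>B\<close>. The theorem
  \<open>graph_cstar_algebra_universal\<close> below derives the universal property for C*-algebras on any type.\<close>

definition graph_cstar_algebra ::
    "('v, 'e) pre_digraph \<Rightarrow> 'a cstar \<Rightarrow> ('e \<Rightarrow> 'a) \<Rightarrow> ('v \<Rightarrow> 'a) \<Rightarrow> bool" where
  "graph_cstar_algebra G A s p \<longleftrightarrow>
     cstar_algebra A \<and> CK_family G A s p \<and> generates A (s ` arcs G \<union> p ` verts G) \<and>
     (\<forall>(B :: (nat \<Rightarrow> nat) cstar) S P. cstar_algebra B \<and> CK_family G B S P \<longrightarrow>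
        (\<exists>\<pi>. star_hom A B \<pi> \<and> (\<forall>e\<in>arcs G. \<pi> (s e) = S e) \<and> (\<forall>v\<in>verts G. \<pi> (p v) = P v)))"

section \<open>The universal property for C*-algebras on arbitrary types\<close>

context cstar_algebra
begin

definition converges :: "(nat \<Rightarrow> 'a) \<Rightarrow> 'a \<Rightarrow> bool" where
  "converges u l \<longleftrightarrow> (\<lambda>n. cnorm A (u n \<ominus> l)) \<longlonglongrightarrow> 0"

lemma zero_smult: "x \<in> carrier A \<Longrightarrow> 0 \<odot> x = \<zero>"
  using smult_l_distr[of x 0 0] smult_closed[of x 0] by (simp add: local.add.l_cancel_one')

lemma smult_zero: "a \<odot> \<zero> = \<zero>"
  using smult_r_distr[of \<zero> \<zero> a] smult_closed[of \<zero> a] by (simp add: local.add.l_cancel_one')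

lemma minus_smult: assumes "x \<in> carrier A" shows "\<ominus> x = (- 1) \<odot> x"
proof -
  have "(- 1) \<odot> x \<oplus> x = \<zero>"
    using smult_l_distr[OF assms, of "-1" 1] assms by (simp add: zero_smult smult_one)
  then show ?thesis
    using assms minus_equality smult_closed by auto
qed

lemma diff_closed: "\<lbrakk>x \<in> carrier A; y \<in> carrier A\<rbrakk> \<Longrightarrow> x \<ominus> y \<in> carrier A"
  by (simp add: a_minus_def)

lemma cnorm_zero: "cnorm A \<zero> = 0"
  by (simp add: cnorm_eq_0_iff)

lemma cnorm_minus_commute:
  assumes "x \<in> carrier A" "y \<in> carrier A" shows "cnorm A (x \<ominus> y) = cnorm A (y \<ominus> x)"
proof -
  have "y \<ominus> x = (- 1) \<odot> (x \<ominus> y)"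
    using assms by (simp add: minus_smult[symmetric] diff_closed a_minus_def minus_add a_comm)
  then show ?thesis
    using cnorm_smult[OF diff_closed[OF assms], of "-1"] by simp
qed

lemma diff_diff_eq: "\<lbrakk>x \<in> carrier A; y \<in> carrier A; z \<in> carrier A\<rbrakk> \<Longrightarrow> x \<ominus> z = (x \<ominus> y) \<oplus> (y \<ominus> z)"
  by (simp add: a_minus_def a_assoc r_neg1 diff_closed)

lemma cnorm_triangle_diff:
  "\<lbrakk>x \<in> carrier A; y \<in> carrier A; z \<in> carrier A\<rbrakk> \<Longrightarrow> cnorm A (x \<ominus> z) \<le> cnorm A (x \<ominus> y) + cnorm A (y \<ominus> z)"
  using diff_diff_eq[of x y z] cnorm_triangle[of "x \<ominus> y" "y \<ominus> z"] by (simp add: diff_closed)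

lemma cnorm_adj: assumes "x \<in> carrier A" shows "cnorm A (adj A x) = cnorm A x"
proof -
  have le: "cnorm A y \<le> cnorm A (adj A y)" if y: "y \<in> carrier A" for y
  proof (cases "cnorm A y = 0")
    case False
    then have "0 < cnorm A y" using cnorm_nonneg[OF y] by simp
    moreover have "cnorm A y * cnorm A y \<le> cnorm A (adj A y) * cnorm A y"
      using cnorm_adj_mult[OF y] cnorm_mult[OF adj_closed[OF y] y] by (simp add: power2_eq_square)
    ultimately show ?thesis by simp
  qed (simp add: cnorm_nonneg adj_closed y)
  show ?thesis
    using le[OF assms] le[OF adj_closed[OF assms]] adj_adj[OF assms] by simp
qed

lemma smult_diff: "\<lbrakk>x \<in> carrier A; y \<in> carrier A\<rbrakk> \<Longrightarrow> a \<odot> (x \<ominus> y) = a \<odot> x \<ominus> a \<odot> y"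
  by (simp add: a_minus_def minus_smult smult_r_distr smult_closed flip: smult_assoc1)

lemma smult_diff_left: "x \<in> carrier A \<Longrightarrow> (a - b) \<odot> x = a \<odot> x \<ominus> b \<odot> x"
  using smult_l_distr[of x a "-b"] by (simp add: a_minus_def minus_smult smult_closed flip: smult_assoc1)

lemma adj_diff: "\<lbrakk>x \<in> carrier A; y \<in> carrier A\<rbrakk> \<Longrightarrow> adj A (x \<ominus> y) = adj A x \<ominus> adj A y"
  by (simp add: a_minus_def minus_smult smult_closed adj_add adj_smult adj_closed)

lemma mult_diff_l: "\<lbrakk>x \<in> carrier A; y \<in> carrier A; z \<in> carrier A\<rbrakk> \<Longrightarrow> (x \<ominus> y) \<otimes> z = x \<otimes> z \<ominus> y \<otimes> z"
  by (simp add: a_minus_def minus_smult smult_closed mult_l_distr smult_mult_l mult_closed)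

lemma mult_diff_r: "\<lbrakk>x \<in> carrier A; y \<in> carrier A; z \<in> carrier A\<rbrakk> \<Longrightarrow> z \<otimes> (x \<ominus> y) = z \<otimes> x \<ominus> z \<otimes> y"
  by (simp add: a_minus_def minus_smult smult_closed mult_r_distr smult_mult_r mult_closed)

lemma add_diff_add:
  "\<lbrakk>x \<in> carrier A; y \<in> carrier A; x' \<in> carrier A; y' \<in> carrier A\<rbrakk> \<Longrightarrow>
    (x \<oplus> y) \<ominus> (x' \<oplus> y') = (x \<ominus> x') \<oplus> (y \<ominus> y')"
  by (simp add: a_minus_def minus_add a_ac)

lemma converges_unique:
  assumes "\<And>n. u n \<in> carrier A" "l \<in> carrier A" "m \<in> carrier A" "converges u l" "converges u m"
  shows "l = m"
proof -
  have "(\<lambda>n. cnorm A (u n \<ominus> l) + cnorm A (u n \<ominus> m)) \<longlonglongrightarrow> 0 + 0"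
    using assms(4,5) unfolding converges_def by (intro tendsto_add)
  moreover have "cnorm A (l \<ominus> m) \<le> cnorm A (u n \<ominus> l) + cnorm A (u n \<ominus> m)" for n
    using cnorm_triangle_diff[of l "u n" m] cnorm_minus_commute[of l "u n"] assms(1-3) by simp
  ultimately have "cnorm A (l \<ominus> m) \<le> 0"
    by (intro LIMSEQ_le_const) auto
  then have "l \<ominus> m = \<zero>"
    using cnorm_nonneg[of "l \<ominus> m"] cnorm_eq_0_iff[of "l \<ominus> m"] assms(2,3) diff_closed by auto
  then show ?thesis
    using diff_diff_eq[of l m \<zero>] assms(2,3) by (simp add: a_minus_def)
qed

lemma converges_iff: "(\<And>n. u n \<in> carrier A) \<Longrightarrow> l \<in> carrier A \<Longrightarrow>
    converges u l \<longleftrightarrow> (\<forall>e>0. \<forall>\<^sub>F n in sequentially. cnorm A (u n \<ominus> l) < e)"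
  unfolding converges_def tendsto_iff by (simp add: dist_real_def cnorm_nonneg diff_closed)

definition closure_set :: "'a set \<Rightarrow> 'a set" where
  "closure_set X = {l \<in> carrier A. \<forall>e>0. \<exists>d\<in>X. cnorm A (d \<ominus> l) < e}"

lemma rational_close: "\<exists>p q::rat. cmod (Complex (of_rat p) (of_rat q) - a) < e" if "e > 0"
proof -
  have "Re a < Re a + e/2" "Im a < Im a + e/2" using that by auto
  then obtain p q :: rat where "Re a < of_rat p" "of_rat p < Re a + e/2" "Im a < of_rat q" "of_rat q < Im a + e/2"
    using of_rat_dense by meson
  then have "cmod (Complex (of_rat p) (of_rat q) - a) < e"
    using cmod_le[of "Complex (of_rat p) (of_rat q) - a"] by auto
  then show ?thesis by blast
qed

lemma cstar_subalgebra_closure_set: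
  assumes X: "X \<subseteq> carrier A" and zero: "\<zero> \<in> X"
    and add: "\<And>x y. x \<in> X \<Longrightarrow> y \<in> X \<Longrightarrow> x \<oplus> y \<in> X"
    and mult: "\<And>x y. x \<in> X \<Longrightarrow> y \<in> X \<Longrightarrow> x \<otimes> y \<in> X"
    and smult: "\<And>p q x. x \<in> X \<Longrightarrow> Complex (of_rat p) (of_rat q) \<odot> x \<in> X"
    and adj: "\<And>x. x \<in> X \<Longrightarrow> adj A x \<in> X"
  shows "cstar_subalgebra A (closure_set X)" and "X \<subseteq> closure_set X"
proof -
  let ?C = "closure_set X"
  have CD: "l \<in> carrier A" "e > 0 \<Longrightarrow> \<exists>d\<in>X. d \<in> carrier A \<and> cnorm A (d \<ominus> l) < e" if "l \<in> ?C" for l e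
    using that X unfolding closure_set_def by blast+
  show sub: "X \<subseteq> ?C"
    using X cnorm_zero by (auto simp: closure_set_def r_neg a_minus_def intro!: bexI)
  have 1: "x \<oplus> y \<in> ?C" if x: "x \<in> ?C" and y: "y \<in> ?C" for x y
    unfolding closure_set_def
  proof (intro CollectI conjI allI impI)
    fix e :: real assume "e > 0"
    then obtain d d' where d: "d \<in> X" "d \<in> carrier A" "cnorm A (d \<ominus> x) < e/2"
      and d': "d' \<in> X" "d' \<in> carrier A" "cnorm A (d' \<ominus> y) < e/2"
      using CD(2)[OF x, of "e/2"] CD(2)[OF y, of "e/2"] by auto
    have "cnorm A ((d \<oplus> d') \<ominus> (x \<oplus> y)) < e"
      using add_diff_add[of d d' x y] cnorm_triangle[of "d \<ominus> x" "d' \<ominus> y"] d d' CD(1)[OF x] CD(1)[OF y]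
      by (simp add: diff_closed)
    then show "\<exists>d\<in>X. cnorm A (d \<ominus> (x \<oplus> y)) < e" using add d d' by blast
  qed (simp add: CD(1) x y)
  have 2: "x \<otimes> y \<in> ?C" if x: "x \<in> ?C" and y: "y \<in> ?C" for x y
    unfolding closure_set_def
  proof (intro CollectI conjI allI impI)
    fix e :: real assume e: "e > 0"
    note xy = CD(1)[OF x] CD(1)[OF y]
    define K where "K = cnorm A x + cnorm A y + 1"
    define e' where "e' = min 1 (e / (2 * K))"
    have K: "K > 0" "cnorm A x \<ge> 0" "cnorm A y \<ge> 0"
      using cnorm_nonneg xy by (auto simp: K_def add_nonneg_pos)
    then have e': "e' > 0" "e' \<le> 1" "e' * K \<le> e / 2"
      using e by (auto simp: e'_def min_def field_simps)
    then obtain d d' where d: "d \<in> X" "d \<in> carrier A" "cnorm A (d \<ominus> x) < e'"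
      and d': "d' \<in> X" "d' \<in> carrier A" "cnorm A (d' \<ominus> y) < e'"
      using CD(2)[OF x, of e'] CD(2)[OF y, of e'] by auto
    have eq: "d \<otimes> d' \<ominus> x \<otimes> y = (d \<ominus> x) \<otimes> d' \<oplus> x \<otimes> (d' \<ominus> y)"
      using d d' xy diff_diff_eq[of "d \<otimes> d'" "x \<otimes> d'" "x \<otimes> y"]
      by (simp add: mult_diff_l mult_diff_r mult_closed)
    have d'y: "d' = (d' \<ominus> y) \<oplus> y"
      using d' xy by (simp add: a_minus_def a_assoc l_neg)
    have nd': "cnorm A d' \<le> cnorm A y + 1"
      using cnorm_triangle[of "d' \<ominus> y" y] d'y d' xy e' by (simp add: diff_closed)
    have "cnorm A (d \<otimes> d' \<ominus> x \<otimes> y) \<le> cnorm A ((d \<ominus> x) \<otimes> d') + cnorm A (x \<otimes> (d' \<ominus> y))"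
      unfolding eq using d d' xy by (intro cnorm_triangle) (auto simp: mult_closed diff_closed)
    also have "\<dots> \<le> cnorm A (d \<ominus> x) * cnorm A d' + cnorm A x * cnorm A (d' \<ominus> y)"
      using d d' xy by (intro add_mono cnorm_mult) (auto simp: diff_closed)
    also have "\<dots> \<le> e' * (cnorm A y + 1) + cnorm A x * e'"
      using d d' nd' e' K cnorm_nonneg by (intro add_mono mult_mono) (auto simp: diff_closed xy)
    also have "\<dots> = e' * K" by (simp add: K_def algebra_simps)
    also have "\<dots> < e" using e' e by simp
    finally show "\<exists>d\<in>X. cnorm A (d \<ominus> x \<otimes> y) < e" using mult d d' by blast
  qed (simp add: CD(1) x y mult_closed)
  have 3: "a \<odot> x \<in> ?C" if x: "x \<in> ?C" for a x
    unfolding closure_set_def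
  proof (intro CollectI conjI allI impI)
    fix e :: real assume e: "e > 0"
    note xx = CD(1)[OF x]
    define K where "K = cnorm A x + cmod a + 1"
    define e' where "e' = min 1 (e / (2 * K))"
    have K: "K > 0" "cnorm A x \<ge> 0"
      using cnorm_nonneg xx by (auto simp: K_def add_nonneg_pos)
    then have e': "e' > 0" "e' \<le> 1" "e' * K \<le> e / 2"
      using e by (auto simp: e'_def min_def field_simps)
    then obtain d where d: "d \<in> X" "d \<in> carrier A" "cnorm A (d \<ominus> x) < e'"
      using CD(2)[OF x, of e'] by auto
    obtain p q :: rat where "cmod (Complex (of_rat p) (of_rat q) - a) < e'"
      using rational_close[OF e'(1)] by blast
    then obtain b where b: "cmod (b - a) < e'" "b \<odot> d \<in> X"
      using smult[OF d(1)] by blast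
    have nb: "cmod b \<le> cmod a + 1"
      using b e' norm_triangle_ineq[of "b - a" a] by simp
    have eq: "b \<odot> d \<ominus> a \<odot> x = b \<odot> (d \<ominus> x) \<oplus> (b - a) \<odot> x"
      using d xx diff_diff_eq[of "b \<odot> d" "b \<odot> x" "a \<odot> x"]
      by (simp add: smult_diff smult_diff_left smult_closed)
    have "cnorm A (b \<odot> d \<ominus> a \<odot> x) \<le> cnorm A (b \<odot> (d \<ominus> x)) + cnorm A ((b - a) \<odot> x)"
      unfolding eq using d xx by (intro cnorm_triangle) (auto simp: smult_closed diff_closed)
    also have "\<dots> = cmod b * cnorm A (d \<ominus> x) + cmod (b - a) * cnorm A x"
      using d xx by (simp add: cnorm_smult diff_closed)
    also have "\<dots> \<le> (cmod a + 1) * e' + e' * cnorm A x"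
      using d b nb e' K xx by (intro add_mono mult_mono) (auto simp: cnorm_nonneg diff_closed)
    also have "\<dots> = e' * K" by (simp add: K_def algebra_simps)
    also have "\<dots> < e" using e' e by simp
    finally show "\<exists>d\<in>X. cnorm A (d \<ominus> a \<odot> x) < e" using b by blast
  qed (simp add: CD(1) x smult_closed)
  have 4: "adj A x \<in> ?C" if x: "x \<in> ?C" for x
    unfolding closure_set_def
  proof (intro CollectI conjI allI impI)
    fix e :: real assume "e > 0"
    then obtain d where d: "d \<in> X" "d \<in> carrier A" "cnorm A (d \<ominus> x) < e"
      using CD(2)[OF x] by blast
    then have "cnorm A (adj A d \<ominus> adj A x) < e"
      using CD(1)[OF x] by (simp add: cnorm_adj diff_closed flip: adj_diff)
    then show "\<exists>d\<in>X. cnorm A (d \<ominus> adj A x) < e" using adj d by blast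
  qed (simp add: CD(1) x adj_closed)
  have 5: "l \<in> ?C" if l: "l \<in> carrier A" and u: "\<And>n. u n \<in> ?C" and lim: "converges u l" for u l
    unfolding closure_set_def
  proof (intro CollectI conjI allI impI)
    fix e :: real assume e: "e > 0"
    then have "\<forall>\<^sub>F n in sequentially. cnorm A (u n \<ominus> l) < e/2"
      using lim converges_iff[of u l] CD(1)[OF u] l half_gt_zero by blast
    then obtain n where n: "cnorm A (u n \<ominus> l) < e/2"
      using eventually_happens by force
    obtain d where d: "d \<in> X" "d \<in> carrier A" "cnorm A (d \<ominus> u n) < e/2"
      using CD(2)[OF u, of "e/2" n] e by auto
    then have "cnorm A (d \<ominus> l) < e"
      using cnorm_triangle_diff[of d "u n" l] CD(1)[OF u] l n by simp
    then show "\<exists>d\<in>X. cnorm A (d \<ominus> l) < e" using d by blast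
  qed (rule l)
  have "?C \<subseteq> carrier A" using CD(1) by blast
  moreover have "\<zero> \<in> ?C" using sub zero by blast
  ultimately show "cstar_subalgebra A ?C"
    unfolding cstar_subalgebra_def converges_def[symmetric]
    by (intro conjI ballI allI impI) (auto intro: 1 2 3 4 5[rule_format])
qed

lemma closure_set_inj:
  assumes "X \<subseteq> carrier A" and "countable X"
  shows "\<exists>f :: 'a \<Rightarrow> nat \<Rightarrow> nat. inj_on f (closure_set X)"
proof -
  define k where "k l n = (SOME i. from_nat_into X i \<in> X \<and> cnorm A (from_nat_into X i \<ominus> l) < inverse (real (Suc n)))"
    for l n
  have k: "from_nat_into X (k l n) \<in> X \<and> cnorm A (from_nat_into X (k l n) \<ominus> l) < inverse (real (Suc n))"
    if l: "l \<in> closure_set X" for l n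
  proof -
    obtain d where "d \<in> X" "cnorm A (d \<ominus> l) < inverse (real (Suc n))"
      using l unfolding closure_set_def by (auto dest!: spec[of _ "inverse (real (Suc n))"])
    then have "\<exists>i. from_nat_into X i \<in> X \<and> cnorm A (from_nat_into X i \<ominus> l) < inverse (real (Suc n))"
      using from_nat_into_surj[OF assms(2)] by metis
    then show ?thesis unfolding k_def by (rule someI_ex)
  qed
  have conv: "converges (\<lambda>n. from_nat_into X (k l n)) l" if l: "l \<in> closure_set X" for l
    unfolding converges_def
  proof (rule tendsto_sandwich[OF _ _ tendsto_const LIMSEQ_inverse_real_of_nat])
    show "\<forall>\<^sub>F n in sequentially. 0 \<le> cnorm A (from_nat_into X (k l n) \<ominus> l)"
      using k[OF l] assms(1) l by (intro always_eventually allI cnorm_nonneg diff_closed) (auto simp: closure_set_def)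
    show "\<forall>\<^sub>F n in sequentially. cnorm A (from_nat_into X (k l n) \<ominus> l) \<le> inverse (real (Suc n))"
      using k[OF l] by (intro always_eventually allI less_imp_le) auto
  qed
  have "l = m" if l: "l \<in> closure_set X" and m: "m \<in> closure_set X" and eq: "k l = k m" for l m
  proof (rule converges_unique)
    show "from_nat_into X (k l n) \<in> carrier A" for n using k[OF l] assms(1) by blast
    show "converges (\<lambda>n. from_nat_into X (k l n)) l" by (rule conv[OF l])
    show "converges (\<lambda>n. from_nat_into X (k l n)) m" using conv[OF m] eq by simp
  qed (use l m in \<open>auto simp: closure_set_def\<close>)
  then have "inj_on k (closure_set X)" by (auto intro: inj_onI)
  then show ?thesis by blast
qed

end

text \<open>Polynomials over the Gaussian rationals in countably many generators and their adjoints, used to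
  exhibit a countable dense subset of the C*-subalgebra generated by a countable set.\<close>
datatype star_poly = GenP nat | ZeroP | AddP star_poly star_poly | MultP star_poly star_poly
  | SmultP rat rat star_poly | AdjP star_poly

instance star_poly :: countable by countable_datatype

primrec star_poly_value :: "'a cstar \<Rightarrow> (nat \<Rightarrow> 'a) \<Rightarrow> star_poly \<Rightarrow> 'a" where
  "star_poly_value A g (GenP i) = g i"
| "star_poly_value A g ZeroP = \<zero>\<^bsub>A\<^esub>"
| "star_poly_value A g (AddP x y) = star_poly_value A g x \<oplus>\<^bsub>A\<^esub> star_poly_value A g y"
| "star_poly_value A g (MultP x y) = star_poly_value A g x \<otimes>\<^bsub>A\<^esub> star_poly_value A g y"
| "star_poly_value A g (SmultP p q x) = Complex (of_rat p) (of_rat q) \<odot>\<^bsub>A\<^esub> star_poly_value A g x"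
| "star_poly_value A g (AdjP x) = adj A (star_poly_value A g x)"

lemma (in cstar_algebra) small_subalgebra:
  assumes "X \<subseteq> carrier A" and "countable X"
  shows "\<exists>C (f :: 'a \<Rightarrow> nat \<Rightarrow> nat). cstar_subalgebra A C \<and> X \<subseteq> C \<and> inj_on f C"
proof -
  define g where "g = from_nat_into (insert \<zero> X)"
  have g: "range g = insert \<zero> X"
    unfolding g_def using assms(2) by (intro range_from_nat_into) auto
  define Y where "Y = range (star_poly_value A g)"
  have "star_poly_value A g t \<in> carrier A" for t
  proof (induction t)
    case (GenP i)
    have "g i \<in> insert \<zero> X" using g by blast
    then show ?case using assms(1) by auto
  qed (auto simp: mult_closed smult_closed adj_closed)
  then have Y: "Y \<subseteq> carrier A" by (auto simp: Y_def)
  have XY: "X \<subseteq> Y"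
  proof
    fix x assume "x \<in> X"
    then obtain i where "x = g i" using g by blast
    then have "x = star_poly_value A g (GenP i)" by simp
    then show "x \<in> Y" unfolding Y_def by blast
  qed
  have val: "star_poly_value A g t \<in> Y" for t by (simp add: Y_def)
  have "\<zero> \<in> Y" using val[of ZeroP] by simp
  moreover have "x \<oplus> y \<in> Y" "x \<otimes> y \<in> Y" if "x \<in> Y" "y \<in> Y" for x y
    using that val[of "AddP _ _"] val[of "MultP _ _"] by (auto simp: Y_def)
  moreover have "Complex (of_rat p) (of_rat q) \<odot> x \<in> Y" "adj A x \<in> Y" if "x \<in> Y" for p q x
    using that val[of "SmultP _ _ _"] val[of "AdjP _"] by (auto simp: Y_def)
  ultimately have "cstar_subalgebra A (closure_set Y)" "Y \<subseteq> closure_set Y"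
    using cstar_subalgebra_closure_set[OF Y] by blast+
  moreover have "countable Y" by (simp add: Y_def)
  ultimately show ?thesis
    using closure_set_inj[OF Y] XY by blast
qed

definition transport :: "'a cstar \<Rightarrow> 'a set \<Rightarrow> ('a \<Rightarrow> 'b) \<Rightarrow> 'b cstar" where
  "transport A C f =
     \<lparr>carrier = f ` C,
      mult = (\<lambda>x y. f (inv_into C f x \<otimes>\<^bsub>A\<^esub> inv_into C f y)),
      one = undefined,
      zero = f \<zero>\<^bsub>A\<^esub>,
      add = (\<lambda>x y. f (inv_into C f x \<oplus>\<^bsub>A\<^esub> inv_into C f y)),
      smult = (\<lambda>a x. f (a \<odot>\<^bsub>A\<^esub> inv_into C f x)),
      adj = (\<lambda>x. f (adj A (inv_into C f x))),
      cnorm = (\<lambda>x. cnorm A (inv_into C f x))\<rparr>"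

locale transported = cstar_algebra A for A :: "'a cstar" (structure) +
  fixes C :: "'a set" and f :: "'a \<Rightarrow> 'b"
  assumes subalgebra: "cstar_subalgebra A C" and inj: "inj_on f C"
begin

abbreviation "B \<equiv> transport A C f"

lemma C_closed:
  "x \<in> C \<Longrightarrow> x \<in> carrier A" "\<zero> \<in> C" "x \<in> C \<Longrightarrow> y \<in> C \<Longrightarrow> x \<oplus> y \<in> C"
  "x \<in> C \<Longrightarrow> y \<in> C \<Longrightarrow> x \<otimes> y \<in> C" "x \<in> C \<Longrightarrow> a \<odot> x \<in> C" "x \<in> C \<Longrightarrow> adj A x \<in> C"
  using subalgebra by (auto simp: cstar_subalgebra_def)

lemma C_minus: "x \<in> C \<Longrightarrow> \<ominus> x \<in> C" "x \<in> C \<Longrightarrow> y \<in> C \<Longrightarrow> x \<ominus> y \<in> C"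
  by (auto simp: minus_smult C_closed a_minus_def)

lemma transport_simps:
  "carrier B = f ` C" "\<zero>\<^bsub>B\<^esub> = f \<zero>"
  "x \<in> C \<Longrightarrow> y \<in> C \<Longrightarrow> f x \<oplus>\<^bsub>B\<^esub> f y = f (x \<oplus> y)"
  "x \<in> C \<Longrightarrow> y \<in> C \<Longrightarrow> f x \<otimes>\<^bsub>B\<^esub> f y = f (x \<otimes> y)"
  "x \<in> C \<Longrightarrow> a \<odot>\<^bsub>B\<^esub> f x = f (a \<odot> x)"
  "x \<in> C \<Longrightarrow> adj B (f x) = f (adj A x)"
  "x \<in> C \<Longrightarrow> cnorm B (f x) = cnorm A x"
  using inj by (auto simp: transport_def)

lemma f_eq_iff: "x \<in> C \<Longrightarrow> y \<in> C \<Longrightarrow> f x = f y \<longleftrightarrow> x = y"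
  using inj by (auto simp: inj_on_def)

lemma B_abelian_group: "abelian_group B"
proof (rule abelian_groupI; (unfold transport_simps)?)
  show "\<exists>y\<in>f ` C. y \<oplus>\<^bsub>B\<^esub> x = f \<zero>" if x: "x \<in> f ` C" for x
  proof -
    obtain a where a: "a \<in> C" "x = f a" using x by blast
    then have "f (\<ominus> a) \<oplus>\<^bsub>B\<^esub> x = f \<zero>"
      by (simp add: transport_simps C_minus C_closed l_neg)
    with a show ?thesis using C_minus by blast
  qed
  show "x \<oplus>\<^bsub>B\<^esub> y = y \<oplus>\<^bsub>B\<^esub> x" if "x \<in> f ` C" "y \<in> f ` C" for x y
    using that by (auto simp: transport_simps C_closed intro!: arg_cong[of _ _ f] a_comm)
qed (auto simp: transport_simps C_closed a_assoc)

lemma B_minus: assumes "x \<in> C" "y \<in> C" shows "f x \<ominus>\<^bsub>B\<^esub> f y = f (x \<ominus> y)"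
proof -
  interpret B: abelian_group B by (rule B_abelian_group)
  have "f (\<ominus> y) \<oplus>\<^bsub>B\<^esub> f y = \<zero>\<^bsub>B\<^esub>"
    using assms by (simp add: transport_simps C_minus C_closed l_neg)
  then have "\<ominus>\<^bsub>B\<^esub> f y = f (\<ominus> y)"
    using assms by (intro B.minus_equality) (auto simp: transport_simps C_minus)
  then show ?thesis
    using assms by (simp add: a_minus_def transport_simps C_minus)
qed

lemma B_cstar_algebra: "cstar_algebra B"
proof -
  have complete': "\<exists>l\<in>carrier B. (\<lambda>n. cnorm B (u n \<ominus>\<^bsub>B\<^esub> l)) \<longlonglongrightarrow> 0"
    if u: "\<And>n::nat. u n \<in> carrier B"
      and cauchy: "\<And>\<epsilon>. \<epsilon> > 0 \<Longrightarrow> \<exists>N. \<forall>m\<ge>N. \<forall>n\<ge>N. cnorm B (u m \<ominus>\<^bsub>B\<^esub> u n) < \<epsilon>" for u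
  proof -
    define v where "v n = inv_into C f (u n)" for n
    have v: "v n \<in> C" "u n = f (v n)" for n
      using u[of n] by (auto simp: v_def transport_simps inv_into_into f_inv_into_f)
    obtain l where l: "l \<in> carrier A" "(\<lambda>n. cnorm A (v n \<ominus> l)) \<longlonglongrightarrow> 0"
      using complete[of v] cauchy v by (auto simp: C_closed B_minus transport_simps C_minus)
    then have "l \<in> C"
      using subalgebra v(1) unfolding cstar_subalgebra_def by blast
    then show ?thesis
      using l v by (intro bexI[of _ "f l"]) (auto simp: B_minus transport_simps C_minus)
  qed
  show ?thesis
    by (intro cstar_algebra.intro B_abelian_group cstar_algebra_axioms.intro complete')
      (auto simp: transport_simps C_closed f_eq_iff smult_l_distr smult_r_distr smult_assoc1 smult_one
        mult_assoc mult_l_distr mult_r_distr smult_mult_l smult_mult_r adj_adj adj_add adj_smult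
        adj_mult cnorm_nonneg cnorm_eq_0_iff cnorm_triangle cnorm_smult cnorm_mult cnorm_adj_mult)
qed

lemma B_finsum:
  assumes "\<And>i. i \<in> I \<Longrightarrow> h i \<in> C"
  shows "finsum B (\<lambda>i. f (h i)) I = f (finsum A h I) \<and> finsum A h I \<in> C"
proof -
  interpret B: abelian_group B by (rule B_abelian_group)
  show ?thesis
    using assms
  proof (induction I rule: infinite_finite_induct)
    case (insert i I)
    then have "h \<in> I \<rightarrow> carrier A" "(\<lambda>i. f (h i)) \<in> I \<rightarrow> carrier B"
      by (auto simp: C_closed transport_simps)
    with insert show ?case
      by (simp add: transport_simps C_closed)
  qed (auto simp: transport_simps C_closed finsum_infinite B.finsum_infinite)
qed

lemma B_CK_family:
  assumes CK: "CK_family G A S P" and "directed_graph G"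
    and SC: "\<And>e. e \<in> arcs G \<Longrightarrow> S e \<in> C" and PC: "\<And>v. v \<in> verts G \<Longrightarrow> P v \<in> C"
  shows "CK_family G B (\<lambda>e. f (S e)) (\<lambda>v. f (P v))"
proof -
  interpret directed_graph G by fact
  have "(\<Oplus>\<^bsub>B\<^esub>e\<in>out_arcs G v. f (S e) \<otimes>\<^bsub>B\<^esub> adj B (f (S e))) = f (P v)"
    if v: "v \<in> verts G" "\<not> sink G v" for v
  proof -
    interpret B: abelian_group B by (rule B_abelian_group)
    have C: "S e \<otimes> adj A (S e) \<in> C" if "e \<in> out_arcs G v" for e
      using that SC by (simp add: C_closed)
    have "(\<Oplus>\<^bsub>B\<^esub>e\<in>out_arcs G v. f (S e) \<otimes>\<^bsub>B\<^esub> adj B (f (S e)))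
        = (\<Oplus>\<^bsub>B\<^esub>e\<in>out_arcs G v. f (S e \<otimes> adj A (S e)))"
      using C by (intro B.finsum_cong') (auto simp: transport_simps SC C_closed)
    also have "\<dots> = f (\<Oplus>e\<in>out_arcs G v. S e \<otimes> adj A (S e))"
      using B_finsum[of "out_arcs G v" "\<lambda>e. S e \<otimes> adj A (S e)"] C by simp
    finally show ?thesis using CK v by (simp add: CK_family_def)
  qed
  then show ?thesis
    using CK by (auto simp: CK_family_def projection_def partial_isometry_def transport_simps
        SC PC C_closed f_eq_iff)
qed

lemma star_hom_inv_into: "star_hom B A (inv_into C f)"
  unfolding star_hom_def using inj by (auto simp: transport_simps C_closed)

end

lemma star_hom_comp: "star_hom A B \<pi> \<Longrightarrow> star_hom B D \<rho> \<Longrightarrow> star_hom A D (\<rho> \<circ> \<pi>)"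
  unfolding star_hom_def by (auto simp: Pi_iff)

theorem graph_cstar_algebra_universal:
  fixes B :: "'b cstar"
  assumes "directed_graph G" and A: "graph_cstar_algebra G A s p"
    and B: "cstar_algebra B" and CK: "CK_family G B S P"
  shows "\<exists>\<pi>. star_hom A B \<pi> \<and> (\<forall>e\<in>arcs G. \<pi> (s e) = S e) \<and> (\<forall>v\<in>verts G. \<pi> (p v) = P v)"
proof -
  interpret directed_graph G by fact
  interpret B: cstar_algebra B by fact
  let ?X = "S ` arcs G \<union> P ` verts G"
  have X: "?X \<subseteq> carrier B" "countable ?X"
    using CK countable_arcs countable_verts by (auto simp: CK_family_def projection_def partial_isometry_def)
  obtain C and f :: "'b \<Rightarrow> nat \<Rightarrow> nat" where C: "cstar_subalgebra B C" "?X \<subseteq> C" "inj_on f C"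
    using B.small_subalgebra[OF X] by blast
  interpret transported B C f by unfold_locales (use C in auto)
  have "CK_family G (transport B C f) (\<lambda>e. f (S e)) (\<lambda>v. f (P v))"
    using CK C(2) assms(1) by (intro B_CK_family) auto
  then obtain \<pi> where "star_hom A (transport B C f) \<pi>"
    "\<forall>e\<in>arcs G. \<pi> (s e) = f (S e)" "\<forall>v\<in>verts G. \<pi> (p v) = f (P v)"
    using A B_cstar_algebra unfolding graph_cstar_algebra_def by blast
  then show ?thesis
    using C star_hom_comp[OF _ star_hom_inv_into]
    by (intro exI[of _ "inv_into C f \<circ> \<pi>"]) (auto simp: image_subset_iff)
qed

end

theory Submission
  imports Defs
begin

text \<open>A 1-block conjugacy \<open>\<psi>\<close> comes from an edge map \<open>\<Psi> : F\<^sup>1 \<rightarrow> E\<^sup>1\<close>, and bijectivity of \<open>\<psi>\<close> says that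
  \<open>\<Psi>\<close> lifts edges uniquely backwards: an edge \<open>e\<close> followed by \<open>\<Psi>(h)\<close> has exactly one lift \<open>g\<close> followed
  by \<open>h\<close>. Hence the sums of the \<open>t\<^sub>g\<close> over the fibers of \<open>\<Psi>\<close> form a Cuntz-Krieger \<open>E\<close>-family in
  \<open>C*(F)\<close>. Conversely, with \<open>e = \<Psi>(g)\<close>, the elements
  \<open>s\<^sub>e \<Sum> {s\<^sub>\<alpha> s\<^sub>\<alpha>* | \<alpha> \<in> r(e)E\<^bsup>n-1\<^esup>, \<Phi>(e\<alpha>) = g}\<close> form a Cuntz-Krieger \<open>F\<close>-family in \<open>C*(E)\<close>. The two
  homomorphisms given by the universal properties are inverse to each other on generators, so neither
  the gauge action nor a uniqueness theorem is needed.

  Two facts about C*-algebras enter: *-homomorphisms are continuous, and projections whose sum is a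
  projection are mutually orthogonal. Both have proofs that avoid spectral theory.\<close>

section \<open>Algebra in C*-algebras\<close>

text \<open>The delicate half is to recover t_g from the images of the s_e. It rests on writing t_g
  t_g* as the sum of the range projections that the image family assigns to the blocks \<beta> with
  \<Phi>(\<beta>) = g. A block whose projection meets t_g t_g* lifts through \<Psi> to a path of F
  that begins with g, and \<Phi> reads this g back from the block. An off-by-one shapes the inverse
  family. The element for g sums over tails of n - 1 edges, but \<Phi> needs n edges to tell where
  an image path starts, so the projection of a vertex of F is a sum over whole n-blocks. Refining
  tails by one edge reconciles the two. The fact about projections enters because the Cuntz-Krieger
  relations do not list the orthogonality of range projections. Continuity enters because agreement
  on generators reaches the whole algebra only through norm limits. As there may be no unit, every
  argument that would use 1 is multiplied back into the algebra or carried out in a corner.\<close>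

context cstar_algebra
begin

lemmas cstar_closed = mult_closed smult_closed adj_closed

lemma zero_mult: "x \<in> carrier A \<Longrightarrow> \<zero> \<otimes> x = \<zero>"
  using smult_mult_l[of x x 0] by (simp add: zero_smult mult_closed)

lemma mult_zero: "x \<in> carrier A \<Longrightarrow> x \<otimes> \<zero> = \<zero>"
  using smult_mult_r[of x x 0] by (simp add: zero_smult mult_closed)

lemma adj_zero: "adj A \<zero> = \<zero>"
  using adj_smult[of \<zero> 0] by (simp add: zero_smult adj_closed)

lemma diff_self: "x \<in> carrier A \<Longrightarrow> x \<ominus> x = \<zero>"
  by (simp add: a_minus_def r_neg)

lemma diff_eq_zero_iff: "x \<in> carrier A \<Longrightarrow> y \<in> carrier A \<Longrightarrow> x \<ominus> y = \<zero> \<longleftrightarrow> x = y"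
  by (metis a_minus_def add.inv_equality add.inv_inv add.inv_closed r_neg)

lemma diff_add_cancel: "x \<in> carrier A \<Longrightarrow> y \<in> carrier A \<Longrightarrow> (x \<ominus> y) \<oplus> y = x"
  by (simp add: a_minus_def a_assoc l_neg)

lemma diff_zero: "x \<in> carrier A \<Longrightarrow> x \<ominus> \<zero> = x"
  using diff_add_cancel[of x \<zero>] by simp

lemma eq_zero_if_adj_mult:
  "x \<in> carrier A \<Longrightarrow> adj A x \<otimes> x = \<zero> \<Longrightarrow> x = \<zero>"
  using cnorm_adj_mult[of x] cnorm_eq_0_iff by (simp add: cnorm_zero)

text \<open>The C*-identity does the work: with \<open>q = adj A x \<otimes> x\<close>, the
  difference \<open>d = x \<otimes> q \<ominus> x\<close> satisfies
  \<open>adj A d \<otimes> d = \<zero>\<close>, hence \<open>d = \<zero>\<close>.\<close>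

lemma partial_isometryI:
  assumes x: "x \<in> carrier A" and p: "projection A (adj A x \<otimes> x)"
  shows "partial_isometry A x"
proof -
  define q where "q = adj A x \<otimes> x"
  have q: "q \<in> carrier A" "adj A q = q" "q \<otimes> q = q" "adj A x \<otimes> x = q"
    using p by (auto simp: projection_def q_def)
  have r: "adj A x \<otimes> (x \<otimes> q) = q"
    using x q by (simp add: adj_closed flip: mult_assoc)
  have "adj A (x \<otimes> q \<ominus> x) \<otimes> (x \<otimes> q \<ominus> x) = \<zero>"
    using x q(1-3) by (simp add: adj_diff adj_mult mult_diff_l mult_diff_r cstar_closed mult_assoc r q(4) diff_self)
  then have "x \<otimes> q \<ominus> x = \<zero>"
    by (rule eq_zero_if_adj_mult[rotated]) (simp add: x q(1) mult_closed)
  then have "x \<otimes> q = x"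
    using x q by (simp add: diff_eq_zero_iff mult_closed)
  then show ?thesis
    using x by (simp add: partial_isometry_def q_def mult_assoc adj_closed)
qed

lemma cnorm_projection_le: assumes "projection A p" shows "cnorm A p \<le> 1"
proof -
  have "cnorm A p * cnorm A p = cnorm A p"
    using assms cnorm_adj_mult[of p] by (simp add: projection_def power2_eq_square)
  then show ?thesis by auto
qed

section \<open>Finite sums, products and orthogonality\<close>

lemma finsum_mult_right:
  "finite I \<Longrightarrow> (\<And>i. i \<in> I \<Longrightarrow> f i \<in> carrier A) \<Longrightarrow> x \<in> carrier A \<Longrightarrow>
    (\<Oplus>i\<in>I. f i) \<otimes> x = (\<Oplus>i\<in>I. f i \<otimes> x)"
proof (induction rule: finite_induct)
  case (insert i I)
  then have "f \<in> I \<rightarrow> carrier A" "(\<lambda>i. f i \<otimes> x) \<in> I \<rightarrow> carrier A" by (auto simp: mult_closed)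
  with insert show ?case by (simp add: mult_l_distr mult_closed)
qed (simp add: zero_mult)

lemma finsum_mult_left:
  "finite I \<Longrightarrow> (\<And>i. i \<in> I \<Longrightarrow> f i \<in> carrier A) \<Longrightarrow> x \<in> carrier A \<Longrightarrow>
    x \<otimes> (\<Oplus>i\<in>I. f i) = (\<Oplus>i\<in>I. x \<otimes> f i)"
proof (induction rule: finite_induct)
  case (insert i I)
  then have "f \<in> I \<rightarrow> carrier A" "(\<lambda>i. x \<otimes> f i) \<in> I \<rightarrow> carrier A" by (auto simp: mult_closed)
  with insert show ?case by (simp add: mult_r_distr mult_closed)
qed (simp add: mult_zero)

lemma adj_finsum:
  "finite I \<Longrightarrow> (\<And>i. i \<in> I \<Longrightarrow> f i \<in> carrier A) \<Longrightarrow>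
    adj A (\<Oplus>i\<in>I. f i) = (\<Oplus>i\<in>I. adj A (f i))"
proof (induction rule: finite_induct)
  case (insert i I)
  then have "f \<in> I \<rightarrow> carrier A" "(\<lambda>i. adj A (f i)) \<in> I \<rightarrow> carrier A" by (auto simp: adj_closed)
  with insert show ?case by (simp add: adj_add adj_closed)
qed (simp add: adj_zero)

lemma finsum_UN_disjoint:
  assumes "finite I" "\<And>i. i \<in> I \<Longrightarrow> finite (X i)"
    and "\<And>i j. i \<in> I \<Longrightarrow> j \<in> I \<Longrightarrow> i \<noteq> j \<Longrightarrow> X i \<inter> X j = {}"
    and "\<And>i x. i \<in> I \<Longrightarrow> x \<in> X i \<Longrightarrow> f x \<in> carrier A"
  shows "(\<Oplus>i\<in>I. \<Oplus>x\<in>X i. f x) = (\<Oplus>x\<in>(\<Union>i\<in>I. X i). f x)"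
  using add.finprod_UN_disjoint[of I X f] assms by (auto simp: pairwise_def disjnt_def)

lemma finsum_filter:
  assumes "finite I" "J \<subseteq> I" "\<And>i. i \<in> J \<Longrightarrow> f i \<in> carrier A" "\<And>i. i \<in> I - J \<Longrightarrow> f i = \<zero>"
  shows "(\<Oplus>i\<in>I. f i) = (\<Oplus>i\<in>J. f i)"
  using assms by (intro add.finprod_mono_neutral_cong_right) (auto, metis DiffI zero_closed)

lemma finsum_single:
  assumes "finite I" "i \<in> I" "f i \<in> carrier A" "\<And>j. j \<in> I \<Longrightarrow> j \<noteq> i \<Longrightarrow> f j = \<zero>"
  shows "(\<Oplus>j\<in>I. f j) = f i"
proof -
  have "(\<Oplus>j\<in>I. f j) = (\<Oplus>j\<in>{i}. f j)"
    using assms by (intro finsum_filter) auto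
  then show ?thesis using assms(3) by simp
qed

text \<open>Both sums are indexed by one type so that a single statement serves two purposes: for
  \<open>I = J\<close> it computes squares, and for disjoint \<open>I\<close> and \<open>J\<close>
  it gives orthogonality, the sum on the right being empty.\<close>

lemma finsum_mult_finsum:
  assumes fin: "finite I" "finite J"
    and cl: "\<And>i. i \<in> I \<Longrightarrow> f i \<in> carrier A" "\<And>j. j \<in> J \<Longrightarrow> g j \<in> carrier A"
    and orth: "\<And>i j. i \<in> I \<Longrightarrow> j \<in> J \<Longrightarrow> i \<noteq> j \<Longrightarrow> f i \<otimes> g j = \<zero>"
  shows "(\<Oplus>i\<in>I. f i) \<otimes> (\<Oplus>j\<in>J. g j) = (\<Oplus>i\<in>I \<inter> J. f i \<otimes> g i)"
proof -
  have 1: "f i \<otimes> (\<Oplus>j\<in>J. g j) = (\<Oplus>j\<in>J. f i \<otimes> g j)" if "i \<in> I" for i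
    using that fin cl by (intro finsum_mult_left) auto
  have 2: "f i \<otimes> (\<Oplus>j\<in>J. g j) = f i \<otimes> g i" if i: "i \<in> I \<inter> J" for i
    using i cl orth fin by (subst 1) (auto intro!: finsum_single mult_closed)
  have 3: "f i \<otimes> (\<Oplus>j\<in>J. g j) = \<zero>" if i: "i \<in> I - J" for i
    using i cl orth fin by (subst 1) (auto intro!: add.finprod_one_eqI)
  have sum: "(\<Oplus>j\<in>J. g j) \<in> carrier A" using cl by (auto intro!: finsum_closed)
  have "(\<Oplus>i\<in>I. f i) \<otimes> (\<Oplus>j\<in>J. g j) = (\<Oplus>i\<in>I. f i \<otimes> (\<Oplus>j\<in>J. g j))"
    using fin cl sum by (intro finsum_mult_right) auto
  also have "\<dots> = (\<Oplus>i\<in>I \<inter> J. f i \<otimes> (\<Oplus>j\<in>J. g j))"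
    using fin cl sum 3 by (intro finsum_filter) (auto intro: mult_closed)
  also have "\<dots> = (\<Oplus>i\<in>I \<inter> J. f i \<otimes> g i)"
    using 2 cl by (intro finsum_cong') (auto intro: mult_closed)
  finally show ?thesis .
qed

lemma projection_finsum:
  assumes "finite I" "\<And>i. i \<in> I \<Longrightarrow> projection A (f i)"
    and "\<And>i j. i \<in> I \<Longrightarrow> j \<in> I \<Longrightarrow> i \<noteq> j \<Longrightarrow> f i \<otimes> f j = \<zero>"
  shows "projection A (\<Oplus>i\<in>I. f i)"
proof -
  have f: "f i \<in> carrier A" "adj A (f i) = f i" "f i \<otimes> f i = f i" if "i \<in> I" for i
    using assms(2)[OF that] by (auto simp: projection_def)
  have "adj A (\<Oplus>i\<in>I. f i) = (\<Oplus>i\<in>I. f i)"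
    using assms(1) f by (subst adj_finsum) (auto intro!: finsum_cong')
  moreover have "(\<Oplus>i\<in>I. f i) \<otimes> (\<Oplus>i\<in>I. f i) = (\<Oplus>i\<in>I. f i)"
    using assms f by (subst finsum_mult_finsum) (auto intro!: finsum_cong')
  moreover have "(\<Oplus>i\<in>I. f i) \<in> carrier A"
    using f by (auto intro!: finsum_closed)
  ultimately show ?thesis by (simp add: projection_def)
qed

end

section \<open>Continuity of *-homomorphisms\<close>

context cstar_algebra
begin

section \<open>Limits in norm\<close>

lemma converges_const: "l \<in> carrier A \<Longrightarrow> converges (\<lambda>_. l) l"
  by (simp add: converges_def diff_self cnorm_zero)

lemma converges_le:
  assumes "\<And>n. u n \<in> carrier A" "l \<in> carrier A" "\<And>n. cnorm A (u n \<ominus> l) \<le> f n" "f \<longlonglongrightarrow> 0"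
  shows "converges u l"
  unfolding converges_def
  by (rule tendsto_sandwich[OF _ _ tendsto_const assms(4)])
    (use assms in \<open>auto intro!: always_eventually cnorm_nonneg simp: diff_closed\<close>)

lemma converges_add:
  assumes u: "\<And>n. u n \<in> carrier A" "l \<in> carrier A" "converges u l"
    and v: "\<And>n. v n \<in> carrier A" "m \<in> carrier A" "converges v m"
  shows "converges (\<lambda>n. u n \<oplus> v n) (l \<oplus> m)"
proof (rule converges_le)
  show "(\<lambda>n. cnorm A (u n \<ominus> l) + cnorm A (v n \<ominus> m)) \<longlonglongrightarrow> 0"
    using tendsto_add[OF u(3)[unfolded converges_def] v(3)[unfolded converges_def]] by simp
  show "cnorm A ((u n \<oplus> v n) \<ominus> (l \<oplus> m)) \<le> cnorm A (u n \<ominus> l) + cnorm A (v n \<ominus> m)" for n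
    using u v by (simp add: add_diff_add cnorm_triangle diff_closed)
qed (use u v in auto)

lemma converges_smult:
  assumes u: "\<And>n. u n \<in> carrier A" "l \<in> carrier A" "converges u l"
  shows "converges (\<lambda>n. a \<odot> u n) (a \<odot> l)"
proof (rule converges_le)
  show "(\<lambda>n. cmod a * cnorm A (u n \<ominus> l)) \<longlonglongrightarrow> 0"
    using tendsto_mult_left[OF u(3)[unfolded converges_def], of "cmod a"] by simp
  show "cnorm A (a \<odot> u n \<ominus> a \<odot> l) \<le> cmod a * cnorm A (u n \<ominus> l)" for n
    using u by (simp add: cnorm_smult diff_closed flip: smult_diff)
qed (use u in \<open>auto simp: smult_closed\<close>)

lemma converges_adj:
  assumes u: "\<And>n. u n \<in> carrier A" "l \<in> carrier A" "converges u l"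
  shows "converges (\<lambda>n. adj A (u n)) (adj A l)"
  using u unfolding converges_def by (simp add: cnorm_adj diff_closed flip: adj_diff)

lemma converges_mult:
  assumes u: "\<And>n. u n \<in> carrier A" "l \<in> carrier A" "converges u l"
    and v: "\<And>n. v n \<in> carrier A" "m \<in> carrier A" "converges v m"
  shows "converges (\<lambda>n. u n \<otimes> v n) (l \<otimes> m)"
proof (rule converges_le)
  let ?d = "\<lambda>n. cnorm A (u n \<ominus> l)" and ?e = "\<lambda>n. cnorm A (v n \<ominus> m)"
  show "(\<lambda>n. ?d n * (?e n + cnorm A m) + cnorm A l * ?e n) \<longlonglongrightarrow> 0"
    using u(3) v(3) unfolding converges_def by (auto intro!: tendsto_eq_intros)
  show "cnorm A (u n \<otimes> v n \<ominus> l \<otimes> m) \<le> ?d n * (?e n + cnorm A m) + cnorm A l * ?e n" for n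
  proof -
    have "u n \<otimes> v n \<ominus> l \<otimes> m = (u n \<ominus> l) \<otimes> v n \<oplus> l \<otimes> (v n \<ominus> m)"
      using u v diff_diff_eq[of "u n \<otimes> v n" "l \<otimes> v n" "l \<otimes> m"]
      by (simp add: mult_diff_l mult_diff_r mult_closed)
    moreover have "cnorm A ((u n \<ominus> l) \<otimes> v n) \<le> ?d n * cnorm A (v n)"
      "cnorm A (l \<otimes> (v n \<ominus> m)) \<le> cnorm A l * ?e n"
      using u v by (auto intro!: cnorm_mult diff_closed)
    moreover have "cnorm A (v n) \<le> ?e n + cnorm A m"
      using cnorm_triangle[of "v n \<ominus> m" m] v by (simp add: diff_closed diff_add_cancel)
    then have "?d n * cnorm A (v n) \<le> ?d n * (?e n + cnorm A m)"
      using u by (intro mult_left_mono) (auto simp: cnorm_nonneg diff_closed)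
    moreover have "cnorm A ((u n \<ominus> l) \<otimes> v n \<oplus> l \<otimes> (v n \<ominus> m))
        \<le> cnorm A ((u n \<ominus> l) \<otimes> v n) + cnorm A (l \<otimes> (v n \<ominus> m))"
      using u v by (intro cnorm_triangle) (auto simp: cstar_closed)
    ultimately show ?thesis by simp
  qed
qed (use u v in \<open>auto simp: mult_closed\<close>)

lemma converges_Suc: "converges u l \<Longrightarrow> converges (\<lambda>n. u (Suc n)) l"
  unfolding converges_def by (rule LIMSEQ_Suc)

lemma geometric_converges:
  assumes u: "\<And>n. u n \<in> carrier A" and step: "\<And>n. cnorm A (u (Suc n) \<ominus> u n) \<le> (1/2) ^ n"
  shows "\<exists>l\<in>carrier A. converges u l"
proof -
  \<comment> \<open>The exact geometric tail: since
    \<open>2 * (1/2) ^ m - (1/2) ^ m = 2 * (1/2) ^ Suc m\<close>, the induction closes without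
    loss.\<close>
  have *: "cnorm A (u (n + k) \<ominus> u n) \<le> 2 * (1/2) ^ n - 2 * (1/2) ^ (n + k)" for n k
  proof (induction k)
    case (Suc k)
    have "cnorm A (u (n + Suc k) \<ominus> u n)
        \<le> cnorm A (u (Suc (n + k)) \<ominus> u (n + k)) + cnorm A (u (n + k) \<ominus> u n)"
      using cnorm_triangle_diff[OF u u u, of "Suc (n + k)" n "n + k"] by simp
    also have "\<dots> \<le> (1/2) ^ (n + k) + (2 * (1/2) ^ n - 2 * (1/2) ^ (n + k))"
      using step Suc by (intro add_mono) auto
    finally show ?case by simp
  qed (simp add: diff_self u cnorm_zero)
  have **: "cnorm A (u m \<ominus> u n) \<le> 2 * (1/2) ^ N" if "N \<le> m" "N \<le> n" for N m n
  proof -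
    have "cnorm A (u m \<ominus> u n) \<le> 2 * (1/2) ^ min m n"
      using *[of n "m - n"] *[of m "n - m"] cnorm_minus_commute[OF u u, of m n]
      by (cases "n \<le> m") (auto simp: min_def, (smt (verit) zero_le_power divide_nonneg_nonneg)+)
    also have "\<dots> \<le> 2 * (1/2) ^ N"
      using that by (intro mult_left_mono power_decreasing) auto
    finally show ?thesis .
  qed
  have "\<exists>N. \<forall>m\<ge>N. \<forall>n\<ge>N. cnorm A (u m \<ominus> u n) < e" if e: "e > 0" for e
  proof -
    obtain N where "(1/2::real) ^ N < e / 2"
      using real_arch_pow_inv[of "e/2" "1/2"] e by auto
    then show ?thesis using ** by (intro exI[of _ N]) (smt (verit) field_sum_of_halves)
  qed
  then show ?thesis
    using complete[OF u] by (auto simp: converges_def)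
qed

text \<open>Here \<open>b = 1 - \<surd>(1 - a\<^sup>2)\<close>, obtained as a fixed point of \<open>b \<mapsto> (a\<^sup>2 + b\<^sup>2) / 2\<close>;
  no unit is needed.\<close>

lemma sqrt_one_minus_square:
  assumes a: "a \<in> carrier A" "adj A a = a" "cnorm A a \<le> 1/2"
  shows "\<exists>b\<in>carrier A. adj A b = b \<and> a \<otimes> b = b \<otimes> a \<and> b = (1/2) \<odot> (a \<otimes> a \<oplus> b \<otimes> b)"
proof -
  \<comment> \<open>Picard iteration from \<open>\<zero>\<close>. All iterates are built from
    \<open>a\<close> by sums, products and real scalars, so they are self-adjoint and commute with
    \<open>a\<close>, and the limit inherits both.\<close>
  define u where "u = rec_nat \<zero> (\<lambda>_ b. (1/2) \<odot> (a \<otimes> a \<oplus> b \<otimes> b))"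
  have u0: "u 0 = \<zero>" and uS: "u (Suc n) = (1/2) \<odot> (a \<otimes> a \<oplus> u n \<otimes> u n)" for n
    by (simp_all add: u_def)
  have cl[simp]: "u n \<in> carrier A" for n
    by (induction n) (simp_all add: u0 uS cstar_closed a)
  have saj: "adj A (u n) = u n" for n
    by (induction n) (simp_all add: u0 uS cstar_closed a adj_zero adj_smult adj_add adj_mult)
  have comm: "a \<otimes> u n = u n \<otimes> a" for n
  proof (induction n)
    case (Suc n)
    have "a \<otimes> (u n \<otimes> u n) = u n \<otimes> u n \<otimes> a"
      using Suc a by (metis cl mult_assoc)
    then show ?case
      using a by (simp add: uS cstar_closed smult_mult_l smult_mult_r mult_l_distr mult_r_distr mult_assoc)
  qed (simp add: u0 a zero_mult mult_zero)
  have aa: "cnorm A (a \<otimes> a) \<le> 1/4"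
    using cnorm_mult[OF a(1) a(1)] mult_mono[OF a(3) a(3)] cnorm_nonneg[OF a(1)] by simp
  \<comment> \<open>The ball of radius 1/4 is invariant because
    \<open>(1/4 + 1/16) / 2 \<le> 1/4\<close>. On it the map contracts by the factor
    \<open>(1/4 + 1/4) / 2 = 1/4\<close>, more than the rate 1/2 asked for below.\<close>
  have bd: "cnorm A (u n) \<le> 1/4" for n
  proof (induction n)
    case (Suc n)
    have "cnorm A (u n \<otimes> u n) \<le> cnorm A (u n) * cnorm A (u n)" by (simp add: cnorm_mult)
    also have "\<dots> \<le> 1/4 * (1/4)" using Suc by (intro mult_mono) (auto simp: cnorm_nonneg)
    finally have "cnorm A (a \<otimes> a \<oplus> u n \<otimes> u n) \<le> 1/2"
      using cnorm_triangle[of "a \<otimes> a" "u n \<otimes> u n"] aa a by (simp add: mult_closed)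
    then show ?case using a by (simp add: uS cnorm_smult cstar_closed)
  qed (simp add: u0 cnorm_zero)
  have step: "cnorm A (u (Suc n) \<ominus> u n) \<le> (1/2) ^ n" for n
  proof (induction n)
    case 0
    then show ?case using bd[of 1] by (simp add: u0 diff_zero)
  next
    case (Suc n)
    let ?x = "u (Suc n)" and ?y = "u n"
    have "u (Suc (Suc n)) \<ominus> u (Suc n) = (1/2) \<odot> (?x \<otimes> ?x \<ominus> ?y \<otimes> ?y)"
      by (subst arg_cong2[OF uS uS, of "\<lambda>x y. x \<ominus> y"])
        (simp add: a cstar_closed diff_self add_diff_add flip: smult_diff)
    moreover have "?x \<otimes> ?x \<ominus> ?y \<otimes> ?y = ?x \<otimes> (?x \<ominus> ?y) \<oplus> (?x \<ominus> ?y) \<otimes> ?y"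
      using diff_diff_eq[of "?x \<otimes> ?x" "?x \<otimes> ?y" "?y \<otimes> ?y"] by (simp add: mult_diff_l mult_diff_r mult_closed)
    moreover have "cnorm A (?x \<otimes> (?x \<ominus> ?y)) \<le> 1/4 * (1/2) ^ n"
      by (rule order_trans[OF cnorm_mult mult_mono]) (use bd Suc in \<open>auto simp: cnorm_nonneg diff_closed\<close>)
    moreover have "cnorm A ((?x \<ominus> ?y) \<otimes> ?y) \<le> (1/2) ^ n * (1/4)"
      by (rule order_trans[OF cnorm_mult mult_mono]) (use bd Suc in \<open>auto simp: cnorm_nonneg diff_closed\<close>)
    moreover have "cnorm A (?x \<otimes> (?x \<ominus> ?y) \<oplus> (?x \<ominus> ?y) \<otimes> ?y)
        \<le> cnorm A (?x \<otimes> (?x \<ominus> ?y)) + cnorm A ((?x \<ominus> ?y) \<otimes> ?y)"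
      by (intro cnorm_triangle) (auto simp: cstar_closed)
    ultimately have "cnorm A (u (Suc (Suc n)) \<ominus> u (Suc n)) \<le> 1/2 * (1/4 * (1/2) ^ n + (1/2) ^ n * (1/4))"
      by (simp add: cnorm_smult cstar_closed)
    also have "\<dots> \<le> (1/2) ^ Suc n" by simp
    finally show ?case .
  qed
  obtain b where b: "b \<in> carrier A" "converges u b"
    using geometric_converges[OF cl step] by blast
  have "converges (\<lambda>n. u (Suc n)) ((1/2) \<odot> (a \<otimes> a \<oplus> b \<otimes> b))"
    unfolding uS using a b
    by (intro converges_smult converges_add converges_mult converges_const) (auto simp: mult_closed)
  then have 1: "b = (1/2) \<odot> (a \<otimes> a \<oplus> b \<otimes> b)"
    using converges_Suc[OF b(2)] a b
    by (intro converges_unique[of "\<lambda>n. u (Suc n)"]) (auto simp: cstar_closed)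
  have 2: "adj A b = b"
    using converges_adj[OF cl b] b saj by (intro converges_unique[of u]) (auto simp: cstar_closed)
  have 3: "a \<otimes> b = b \<otimes> a"
    using converges_mult[OF _ a(1) converges_const[OF a(1)] cl b] converges_mult[OF cl b _ a(1) converges_const[OF a(1)]] comm
    by (intro converges_unique[of "\<lambda>n. a \<otimes> u n"]) (auto simp: cstar_closed a b)
  show ?thesis using 1 2 3 b(1) by blast
qed


text \<open>The hypotheses on \<open>z\<close> are purely algebraic, so *-homomorphisms preserve
  them; this is how a norm bound travels from one algebra to another. In the unitization, y is the
  average of the unitaries y + i (1 - z) and y - i (1 - z). Multiplied by y they lie in the algebra,
  have the norm of y, and add up to 2 y^2; hence the square of the norm of y is at most the norm of
  y.\<close>

lemma cnorm_le_one_if_sqrt: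
  assumes y: "y \<in> carrier A" "adj A y = y" and z: "z \<in> carrier A" "adj A z = z"
    and comm: "y \<otimes> z = z \<otimes> y" and eq: "z = (1/2) \<odot> (y \<otimes> y \<oplus> z \<otimes> z)"
  shows "cnorm A y \<le> 1"
proof -
  define m where "m = y \<ominus> z \<otimes> y"
  have m: "m \<in> carrier A" "adj A m = m"
    using y z comm by (simp_all add: m_def cstar_closed adj_diff adj_mult)
  \<comment> \<open>This is \<open>(1 - z)^2 = 1 - y^2\<close> with the unit cancelled.\<close>
  have two: "z \<oplus> z = y \<otimes> y \<oplus> z \<otimes> z"
  proof -
    have "z \<oplus> z = 2 \<odot> z"
      using smult_l_distr[OF z(1), of 1 1] z by (simp add: smult_one)
    also have "\<dots> = 2 \<odot> ((1/2) \<odot> (y \<otimes> y \<oplus> z \<otimes> z))"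
      using eq by simp
    finally show ?thesis
      using y z by (simp add: cstar_closed smult_one flip: smult_assoc1)
  qed
  have my: "y \<otimes> y \<otimes> m = m \<otimes> (y \<otimes> y)"
    using y z comm by (simp add: m_def cstar_closed mult_diff_l mult_diff_r mult_assoc)
      (metis mult_assoc mult_closed)
  text \<open>This is \<open>(y\<^sup>2 + (1 - z)\<^sup>2) y\<^sup>2 = y\<^sup>2\<close>: \<open>y \<plusminus> i (1 - z)\<close> is a unitary of the unitization.\<close>
  have key: "(y \<otimes> y) \<otimes> (y \<otimes> y) \<oplus> m \<otimes> m = y \<otimes> y"
  proof -
    have "m \<otimes> m = y \<otimes> y \<ominus> (z \<oplus> z) \<otimes> (y \<otimes> y) \<oplus> (z \<otimes> z) \<otimes> (y \<otimes> y)"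
    proof -
      have "y \<otimes> (z \<otimes> y) = z \<otimes> (y \<otimes> y)" "z \<otimes> (y \<otimes> (z \<otimes> y)) = z \<otimes> (z \<otimes> (y \<otimes> y))"
        using y z comm by (metis mult_assoc mult_closed)+
      then have "m \<otimes> m = (y \<otimes> y \<ominus> z \<otimes> (y \<otimes> y)) \<ominus> (z \<otimes> (y \<otimes> y) \<ominus> z \<otimes> (z \<otimes> (y \<otimes> y)))"
        using y z by (simp add: m_def cstar_closed mult_diff_l mult_diff_r mult_assoc)
      then show ?thesis
        using y z by (simp add: cstar_closed mult_assoc mult_l_distr a_minus_def minus_add a_ac)
    qed
    also have "\<dots> = y \<otimes> y \<ominus> (y \<otimes> y) \<otimes> (y \<otimes> y)"
      using y z unfolding two by (simp add: cstar_closed mult_l_distr a_minus_def minus_add a_assoc l_neg)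
    finally show ?thesis
      using y by (simp only:) (subst a_comm, simp_all add: cstar_closed diff_add_cancel)
  qed
  \<comment> \<open>In the C*-identity the cross terms cancel because \<open>c\<close> is imaginary
    and \<open>m\<close> commutes with \<open>y \<otimes> y\<close>; what is left is
    \<open>key\<close>.\<close>
  have "cnorm A (y \<otimes> y \<oplus> c \<odot> m) = cnorm A y" if c: "c = \<i> \<or> c = - \<i>" for c
  proof -
    have "adj A (y \<otimes> y \<oplus> c \<odot> m) \<otimes> (y \<otimes> y \<oplus> c \<odot> m)
        = ((y \<otimes> y) \<otimes> (y \<otimes> y) \<oplus> c \<odot> (m \<otimes> (y \<otimes> y))) \<oplus> (cnj c \<odot> (m \<otimes> (y \<otimes> y)) \<oplus> m \<otimes> m)"
      using y m c by (auto simp: cstar_closed adj_add adj_mult adj_smult mult_l_distr mult_r_distr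
          smult_mult_l smult_mult_r smult_r_distr my smult_one a_ac simp flip: smult_assoc1)
    also have "\<dots> = (y \<otimes> y) \<otimes> (y \<otimes> y) \<oplus> (c \<odot> (m \<otimes> (y \<otimes> y)) \<oplus> cnj c \<odot> (m \<otimes> (y \<otimes> y))) \<oplus> m \<otimes> m"
      using y m by (simp add: cstar_closed a_assoc)
    also have "c \<odot> (m \<otimes> (y \<otimes> y)) \<oplus> cnj c \<odot> (m \<otimes> (y \<otimes> y)) = \<zero>"
      using y m c by (auto simp: cstar_closed zero_smult simp flip: smult_l_distr)
    finally have "adj A (y \<otimes> y \<oplus> c \<odot> m) \<otimes> (y \<otimes> y \<oplus> c \<odot> m) = adj A y \<otimes> y"
      using y m key by (simp add: cstar_closed)
    then have "(cnorm A (y \<otimes> y \<oplus> c \<odot> m))\<^sup>2 = (cnorm A y)\<^sup>2"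
      using y m cnorm_adj_mult[of y] cnorm_adj_mult[of "y \<otimes> y \<oplus> c \<odot> m"] by (simp add: cstar_closed)
    then show ?thesis
      using y m by (simp add: cnorm_nonneg cstar_closed)
  qed
  moreover have "(y \<otimes> y \<oplus> \<i> \<odot> m) \<oplus> (y \<otimes> y \<oplus> (-\<i>) \<odot> m) = 2 \<odot> (y \<otimes> y)"
  proof -
    have "(y \<otimes> y \<oplus> \<i> \<odot> m) \<oplus> (y \<otimes> y \<oplus> (-\<i>) \<odot> m) = (y \<otimes> y \<oplus> y \<otimes> y) \<oplus> (\<i> \<odot> m \<oplus> (-\<i>) \<odot> m)"
      using y m by (simp add: cstar_closed a_ac)
    also have "\<i> \<odot> m \<oplus> (-\<i>) \<odot> m = \<zero>"
      using m by (simp add: zero_smult flip: smult_l_distr)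
    also have "y \<otimes> y \<oplus> y \<otimes> y = 2 \<odot> (y \<otimes> y)"
      using smult_l_distr[of "y \<otimes> y" 1 1] y by (simp add: smult_one cstar_closed)
    finally show ?thesis using y by (simp add: cstar_closed)
  qed
  ultimately have "cnorm A (2 \<odot> (y \<otimes> y)) \<le> cnorm A y + cnorm A y"
    using cnorm_triangle[of "y \<otimes> y \<oplus> \<i> \<odot> m" "y \<otimes> y \<oplus> (-\<i>) \<odot> m"] y m by (simp add: cstar_closed)
  then have "cnorm A y * cnorm A y \<le> cnorm A y"
    using y cnorm_adj_mult[of y] by (simp add: cnorm_smult cstar_closed power2_eq_square)
  then show ?thesis
    using cnorm_nonneg[OF y(1)] by (cases "cnorm A y = 0") auto
qed

end

section \<open>Boundedness of *-homomorphisms\<close>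

lemma star_hom_simps:
  assumes "star_hom A B \<pi>" "x \<in> carrier A"
  shows "\<pi> x \<in> carrier B" "y \<in> carrier A \<Longrightarrow> \<pi> (x \<oplus>\<^bsub>A\<^esub> y) = \<pi> x \<oplus>\<^bsub>B\<^esub> \<pi> y"
    "y \<in> carrier A \<Longrightarrow> \<pi> (x \<otimes>\<^bsub>A\<^esub> y) = \<pi> x \<otimes>\<^bsub>B\<^esub> \<pi> y"
    "\<pi> (a \<odot>\<^bsub>A\<^esub> x) = a \<odot>\<^bsub>B\<^esub> \<pi> x" "\<pi> (adj A x) = adj B (\<pi> x)"
  using assms by (auto simp: star_hom_def)

locale cstar_hom = A: cstar_algebra A + B: cstar_algebra B
  for A :: "'a cstar" and B :: "'b cstar" +
  fixes \<pi> :: "'a \<Rightarrow> 'b"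
  assumes star_hom: "star_hom A B \<pi>"
begin

lemmas hom_simps = star_hom_simps[OF star_hom]

lemma hom_zero: "\<pi> \<zero>\<^bsub>A\<^esub> = \<zero>\<^bsub>B\<^esub>"
  using hom_simps(4)[of "\<zero>\<^bsub>A\<^esub>" 0] hom_simps(1)[of "\<zero>\<^bsub>A\<^esub>"] by (simp add: A.zero_smult B.zero_smult)

lemma hom_diff: "x \<in> carrier A \<Longrightarrow> y \<in> carrier A \<Longrightarrow> \<pi> (x \<ominus>\<^bsub>A\<^esub> y) = \<pi> x \<ominus>\<^bsub>B\<^esub> \<pi> y"
  by (simp add: a_minus_def A.minus_smult B.minus_smult hom_simps A.smult_closed)

lemma hom_finsum:
  "(\<And>i. i \<in> I \<Longrightarrow> f i \<in> carrier A) \<Longrightarrow> \<pi> (\<Oplus>\<^bsub>A\<^esub>i\<in>I. f i) = (\<Oplus>\<^bsub>B\<^esub>i\<in>I. \<pi> (f i))"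
proof (induction I rule: infinite_finite_induct)
  case (insert i I)
  then have "f \<in> I \<rightarrow> carrier A" "(\<lambda>i. \<pi> (f i)) \<in> I \<rightarrow> carrier B" by (auto simp: hom_simps)
  with insert show ?case by (simp add: hom_simps)
qed (simp_all add: hom_zero A.finsum_infinite B.finsum_infinite)

text \<open>Dividing \<open>adj A x \<otimes> x\<close> by twice the squared norm of
  \<open>x\<close> gives a self-adjoint element of norm 1/2, as the square root iteration requires.
  Its image has norm at most 1, which yields the factor \<open>sqrt 2\<close>, rounded up to 2:
  continuity needs only some constant.\<close>

lemma hom_bounded:
  assumes x: "x \<in> carrier A" shows "cnorm B (\<pi> x) \<le> 2 * cnorm A x"
proof -
  have small: "cnorm B (\<pi> a) \<le> 1" if a: "a \<in> carrier A" "adj A a = a" "cnorm A a \<le> 1/2" for a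
  proof -
    obtain b where b: "b \<in> carrier A" "adj A b = b" "a \<otimes>\<^bsub>A\<^esub> b = b \<otimes>\<^bsub>A\<^esub> a"
      "b = (1/2) \<odot>\<^bsub>A\<^esub> (a \<otimes>\<^bsub>A\<^esub> a \<oplus>\<^bsub>A\<^esub> b \<otimes>\<^bsub>A\<^esub> b)"
      using A.sqrt_one_minus_square[OF a] by blast
    show ?thesis
    proof (rule B.cnorm_le_one_if_sqrt)
      show "adj B (\<pi> a) = \<pi> a" "adj B (\<pi> b) = \<pi> b"
        using a b by (simp_all flip: hom_simps(5))
      show "\<pi> a \<otimes>\<^bsub>B\<^esub> \<pi> b = \<pi> b \<otimes>\<^bsub>B\<^esub> \<pi> a"
        using a b by (simp flip: hom_simps(3))
      have "\<pi> b = \<pi> ((1/2) \<odot>\<^bsub>A\<^esub> (a \<otimes>\<^bsub>A\<^esub> a \<oplus>\<^bsub>A\<^esub> b \<otimes>\<^bsub>A\<^esub> b))"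
        using b(4) by simp
      then show "\<pi> b = (1/2) \<odot>\<^bsub>B\<^esub> (\<pi> a \<otimes>\<^bsub>B\<^esub> \<pi> a \<oplus>\<^bsub>B\<^esub> \<pi> b \<otimes>\<^bsub>B\<^esub> \<pi> b)"
        using a b(1) by (simp add: hom_simps A.cstar_closed)
    qed (use a b in \<open>auto simp: hom_simps\<close>)
  qed
  show ?thesis
  proof (cases "cnorm A x = 0")
    case True
    then show ?thesis
      using x by (simp add: A.cnorm_eq_0_iff hom_zero A.cnorm_zero B.cnorm_zero)
  next
    case False
    define r where "r = 2 * (cnorm A x)\<^sup>2"
    have r: "r > 0" using False by (simp add: r_def)
    let ?a = "complex_of_real (1 / r) \<odot>\<^bsub>A\<^esub> (adj A x \<otimes>\<^bsub>A\<^esub> x)"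
    have xx: "adj A x \<otimes>\<^bsub>A\<^esub> x \<in> carrier A" using x by (simp add: A.cstar_closed)
    have "cnorm B (\<pi> ?a) \<le> 1"
      using x r by (intro small)
        (auto simp: A.cstar_closed A.adj_smult A.adj_mult A.adj_adj A.cnorm_smult A.cnorm_adj_mult norm_divide norm_power r_def)
    moreover have "\<pi> ?a = complex_of_real (1 / r) \<odot>\<^bsub>B\<^esub> (adj B (\<pi> x) \<otimes>\<^bsub>B\<^esub> \<pi> x)"
      using x xx by (simp add: hom_simps A.cstar_closed)
    ultimately have "(cnorm B (\<pi> x))\<^sup>2 / r \<le> 1"
      using x r by (simp add: B.cnorm_smult B.cstar_closed hom_simps B.cnorm_adj_mult norm_divide)
    then have "(cnorm B (\<pi> x))\<^sup>2 \<le> 2 * (cnorm A x)\<^sup>2"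
      using r by (simp add: r_def)
    also have "\<dots> \<le> (2 * cnorm A x)\<^sup>2" by (simp add: power2_eq_square)
    finally show ?thesis
      by (rule power2_le_imp_le) (simp add: A.cnorm_nonneg x)
  qed
qed

lemma hom_converges:
  assumes "\<And>n. u n \<in> carrier A" "l \<in> carrier A" "A.converges u l"
  shows "B.converges (\<lambda>n. \<pi> (u n)) (\<pi> l)"
proof (rule B.converges_le)
  show "(\<lambda>n. 2 * cnorm A (u n \<ominus>\<^bsub>A\<^esub> l)) \<longlonglongrightarrow> 0"
    using tendsto_mult_left[OF assms(3)[unfolded A.converges_def], of 2] by simp
  show "cnorm B (\<pi> (u n) \<ominus>\<^bsub>B\<^esub> \<pi> l) \<le> 2 * cnorm A (u n \<ominus>\<^bsub>A\<^esub> l)" for n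
    using assms by (simp add: hom_bounded A.diff_closed flip: hom_diff)
qed (use assms in \<open>auto simp: hom_simps\<close>)

end

text \<open>The set where the two maps agree is closed under the algebraic operations, and by
  \<open>hom_converges\<close> under norm limits, so it is a C*-subalgebra containing the
  generators.\<close>

lemma star_hom_eqI:
  assumes "cstar_algebra A" "cstar_algebra B" "star_hom A B \<pi>" "star_hom A B \<rho>"
    and gen: "generates A X" and eq: "\<And>x. x \<in> X \<Longrightarrow> \<pi> x = \<rho> x" and x: "x \<in> carrier A"
  shows "\<pi> x = \<rho> x"
proof -
  interpret \<pi>: cstar_hom A B \<pi> using assms by (intro cstar_hom.intro cstar_hom_axioms.intro) auto
  interpret \<rho>: cstar_hom A B \<rho> using assms by (intro cstar_hom.intro cstar_hom_axioms.intro) auto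
  let ?C = "{x \<in> carrier A. \<pi> x = \<rho> x}"
  have lim: "\<pi> l = \<rho> l" if "\<And>n. u n \<in> ?C" "l \<in> carrier A" "\<pi>.A.converges u l" for u l
  proof -
    have "\<pi>.B.converges (\<lambda>n. \<pi> (u n)) (\<pi> l)" "\<pi>.B.converges (\<lambda>n. \<pi> (u n)) (\<rho> l)"
      using \<pi>.hom_converges[of u l] \<rho>.hom_converges[of u l] that by auto
    then show ?thesis
      using that by (intro \<pi>.B.converges_unique[of "\<lambda>n. \<pi> (u n)"]) (auto simp: \<pi>.hom_simps \<rho>.hom_simps)
  qed
  have "cstar_subalgebra A ?C"
    unfolding cstar_subalgebra_def \<pi>.A.converges_def[symmetric]
    by (intro conjI ballI allI impI)
      (auto intro: lim simp: \<pi>.A.cstar_closed \<pi>.hom_simps \<rho>.hom_simps \<pi>.hom_zero \<rho>.hom_zero)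
  then have "?C = carrier A"
    using gen eq by (auto simp: generates_def)
  with x show ?thesis by blast
qed


section \<open>Projections whose sum is a projection\<close>

context cstar_algebra
begin

text \<open>\<open>u\<close> plays the role of the unit, so that \<open>A\<close> need not have one.\<close>

definition poly_value :: "'a \<Rightarrow> 'a \<Rightarrow> complex poly \<Rightarrow> 'a" where
  "poly_value u w p = fold_coeffs (\<lambda>a r. a \<odot> u \<oplus> w \<otimes> r) p \<zero>"

context
  fixes u w :: 'a
  assumes u[simp]: "u \<in> carrier A" and w[simp]: "w \<in> carrier A"
begin

lemma poly_value_0[simp]: "poly_value u w 0 = \<zero>"
  by (simp add: poly_value_def)

lemma poly_value_pCons: "poly_value u w (pCons a p) = a \<odot> u \<oplus> w \<otimes> poly_value u w p"
  by (cases "p = 0"; cases "a = 0") (simp_all add: poly_value_def zero_smult mult_zero)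

lemma poly_value_closed[simp]: "poly_value u w p \<in> carrier A"
  by (induction p) (simp_all add: poly_value_pCons cstar_closed)

lemma poly_value_add: "poly_value u w (p + q) = poly_value u w p \<oplus> poly_value u w q"
  by (induction p q rule: poly_induct2)
    (simp_all add: poly_value_pCons cstar_closed smult_l_distr mult_r_distr a_ac)

lemma poly_value_smult: "poly_value u w (Polynomial.smult c p) = c \<odot> poly_value u w p"
  by (induction p)
    (simp_all add: poly_value_pCons cstar_closed smult_zero smult_r_distr smult_mult_r smult_assoc1)

text \<open>Every Horner value is a combination of \<open>u\<close> and of a multiple
  \<open>w \<otimes> r\<close>, and \<open>u\<close> fixes both from the left. Polynomial identities
  over the complex numbers can therefore be evaluated at \<open>w\<close> with \<open>u\<close> in
  place of 1.\<close>

lemma poly_value_mult: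
  assumes "u \<otimes> u = u" "u \<otimes> w = w"
  shows "poly_value u w (p * q) = poly_value u w p \<otimes> poly_value u w q"
proof (induction p)
  case (pCons a p)
  have "u \<otimes> poly_value u w q = poly_value u w q"
    by (induction q) (simp_all add: poly_value_pCons cstar_closed mult_zero mult_r_distr smult_mult_r assms
        flip: mult_assoc)
  then show ?case
    using pCons by (simp add: poly_value_add poly_value_smult poly_value_pCons cstar_closed zero_smult
        mult_l_distr smult_mult_l mult_assoc)
qed (simp add: zero_mult)

end

text \<open>A unit is an extreme point of the unit ball. If \<open>u \<plusminus> w\<close> are contractions, then so are \<open>u \<plusminus> w'\<close> with
  \<open>w' = (3 w - w\<^sup>3) / 2\<close>, as \<open>u + w' = (u + w)\<^sup>2 (u + (u - w)) / 2\<close>; but \<open>w'\<close> is larger than \<open>w\<close>.\<close>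

lemma unit_extreme:
  assumes u: "projection A u" and w: "w \<in> carrier A" "u \<otimes> w = w" "w \<otimes> u = w"
    and "cnorm A (u \<oplus> w) \<le> 1" "cnorm A (u \<ominus> w) \<le> 1"
  shows "w = \<zero>"
proof -
  have uu: "u \<in> carrier A" "u \<otimes> u = u" "cnorm A u \<le> 1"
    using u cnorm_projection_le by (auto simp: projection_def)
  \<comment> \<open>Collecting all elements that satisfy the hypotheses makes the passage from
    \<open>w\<close> to \<open>w'\<close> repeatable.\<close>
  define W where "W = {w \<in> carrier A. u \<otimes> w = w \<and> w \<otimes> u = w \<and> cnorm A (u \<oplus> w) \<le> 1 \<and> cnorm A (u \<ominus> w) \<le> 1}"
  have step: "cnorm A x \<le> 1/2 \<and> (\<exists>y\<in>W. cnorm A x \<le> 8/11 * cnorm A y)" if "x \<in> W" for x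
  proof -
    have x: "x \<in> carrier A" "u \<otimes> x = x" "x \<otimes> u = x" "cnorm A (u \<oplus> x) \<le> 1" "cnorm A (u \<ominus> x) \<le> 1"
      using that by (auto simp: W_def)
    let ?e = "poly_value u x"
    note e_simps = poly_value_add[OF uu(1) x(1)] poly_value_smult[OF uu(1) x(1)]
      poly_value_mult[OF uu(1) x(1) uu(2) x(2)]
    note e_pCons = poly_value_pCons[OF uu(1) x(1)]
    note e_closed = poly_value_closed[OF uu(1) x(1)]
    have e1: "?e 1 = u"
      using uu x by (simp add: one_pCons e_pCons poly_value_0 mult_zero smult_one)
    have ec: "?e [:a, b:] = a \<odot> u \<oplus> b \<odot> x" for a b
      using uu x by (simp add: e_pCons poly_value_0 mult_zero cstar_closed smult_mult_r)
    have eX: "?e [:0, 1:] = x" and eP: "?e [:1, 1:] = u \<oplus> x" and eM: "?e [:1, -1:] = u \<ominus> x"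
      using uu x by (simp_all add: ec zero_smult smult_one a_minus_def minus_smult)
    have nmult: "cnorm A (?e (p * q)) \<le> a * b" if "cnorm A (?e p) \<le> a" "cnorm A (?e q) \<le> b" for p q a b
    proof -
      have "0 \<le> a" using that cnorm_nonneg[OF e_closed, of p] by linarith
      then show ?thesis
        unfolding e_simps using that
        by (intro order_trans[OF cnorm_mult mult_mono]) (auto simp: cnorm_nonneg e_closed)
    qed
    have nadd: "cnorm A (?e (p + q)) \<le> a + b" if "cnorm A (?e p) \<le> a" "cnorm A (?e q) \<le> b" for p q a b
      unfolding e_simps using that by (intro order_trans[OF cnorm_triangle add_mono]) (auto simp: e_closed)
    have nsmult: "cnorm A (?e (Polynomial.smult c p)) \<le> cmod c * a" if "cnorm A (?e p) \<le> a" for p c a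
      unfolding e_simps using that by (simp add: cnorm_smult e_closed mult_left_mono)
    have nP: "cnorm A (?e [:1, 1:]) \<le> 1" and nM: "cnorm A (?e [:1, -1:]) \<le> 1" and n1: "cnorm A (?e 1) \<le> 1"
      using x uu by (simp_all add: eP eM e1)
    \<comment> \<open>Polarization, \<open>4 X = (1 + X)^2 - (1 - X)^2\<close>: each square
      evaluates to a contraction, hence the bound 1/2.\<close>
    have "[:0, 1:] = Polynomial.smult (1/4) ([:1, 1:] * [:1, 1:]) + Polynomial.smult (-1/4) ([:1, -1:] * [:1, -1::complex:])"
      by simp
    then have half: "cnorm A x \<le> 1/2"
      using nadd[OF nsmult[OF nmult[OF nP nP], of "1/4"] nsmult[OF nmult[OF nM nM], of "-1/4"]]
      by (simp add: eX)
    define q :: "complex poly" where "q = [:0, 3/2, 0, -1/2:]"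
    have q1: "1 + q = [:1, 1:] * [:1, 1:] * (Polynomial.smult (1/2) 1 + Polynomial.smult (1/2) [:1, -1:])"
      by (simp add: q_def one_pCons)
    have q2: "1 - q = [:1, -1:] * [:1, -1:] * (Polynomial.smult (1/2) 1 + Polynomial.smult (1/2) [:1, 1:])"
      by (simp add: q_def one_pCons)
    have "cnorm A (?e (1 + q)) \<le> 1"
      unfolding q1 using nmult[OF nmult[OF nP nP] nadd[OF nsmult[OF n1, of "1/2"] nsmult[OF nM, of "1/2"]]]
      by simp
    moreover have "cnorm A (?e (1 - q)) \<le> 1"
      unfolding q2 using nmult[OF nmult[OF nM nM] nadd[OF nsmult[OF n1, of "1/2"] nsmult[OF nP, of "1/2"]]]
      by simp
    moreover have "?e (1 - q) = u \<ominus> ?e q"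
      using e_simps(1)[of 1 "-q"] e_simps(2)[of "-1" q] e_closed by (simp add: e1 a_minus_def minus_smult)
    moreover have "u \<otimes> ?e q = ?e q" "?e q \<otimes> u = ?e q"
      using e_simps(3)[of 1 q] e_simps(3)[of q 1] by (simp_all add: e1)
    ultimately have "?e q \<in> W"
      by (simp add: W_def e_closed e_simps e1)
    \<comment> \<open>From \<open>X = (2/3) q + (1/3) X^3\<close>. As x has norm at most 1/2, the
      norm of x^3 is at most a quarter of that of x, so 11/12 of the norm of x is at most 2/3 of the
      norm of the new element; and \<open>(2/3) * (12/11) = 8/11\<close>.\<close>
    moreover have "cnorm A x \<le> 8/11 * cnorm A (?e q)"
    proof -
      have X: "[:0, 1:] = Polynomial.smult (2/3) q + Polynomial.smult (1/3) ([:0, 1:] * ([:0, 1:] * [:0, 1::complex:]))"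
        by (simp add: q_def)
      have n: "cnorm A (?e [:0, 1:]) \<le> cnorm A x" "cnorm A (?e [:0, 1:]) \<le> 1/2"
        using half by (simp_all add: eX)
      have "cnorm A (?e [:0, 1:]) \<le> 2/3 * cnorm A (?e q) + 1/3 * (cnorm A x * (1/2 * (1/2)))"
        using nadd[OF nsmult[OF order_refl, of "2/3" q] nsmult[OF nmult[OF n(1) nmult[OF n(2) n(2)]], of "1/3"]]
        unfolding X[symmetric] by (simp add: norm_divide)
      then show ?thesis by (simp add: eX)
    qed
    ultimately show ?thesis using half by blast
  qed
  \<comment> \<open>An element of \<open>W\<close> is dominated by 8/11 of another element of
    \<open>W\<close>, so a bound valid on all of \<open>W\<close> improves by this factor at each
    round.\<close>
  have "\<forall>x\<in>W. cnorm A x \<le> (8/11) ^ k" for k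
  proof (induction k)
    case 0
    then show ?case using step by fastforce
  next
    case (Suc k)
    show ?case
    proof
      fix x assume "x \<in> W"
      then obtain y where "y \<in> W" "cnorm A x \<le> 8/11 * cnorm A y" using step by blast
      with Suc show "cnorm A x \<le> (8/11) ^ Suc k" by fastforce
    qed
  qed
  moreover have "w \<in> W" using assms by (simp add: W_def)
  ultimately have "cnorm A w \<le> (8/11) ^ k" for k by blast
  moreover have "(\<lambda>k. (8/11::real) ^ k) \<longlonglongrightarrow> 0" by (intro LIMSEQ_realpow_zero) auto
  ultimately have "cnorm A w \<le> 0"
    by (intro LIMSEQ_le_const) auto
  then show ?thesis
    using w cnorm_nonneg[of w] cnorm_eq_0_iff by force
qed

text \<open>The reflection 1 - 2 p is unitary, so \<open>z \<ominus> y\<close>, the reflection of x,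
  has the norm of x; and x - p x is the average of the two. The equality of norms follows from
  \<open>y\<close> and \<open>z\<close> having orthogonal ranges.\<close>

lemma cnorm_complement_le:
  assumes p: "projection A p" and x: "x \<in> carrier A"
  shows "cnorm A (x \<ominus> p \<otimes> x) \<le> cnorm A x"
proof -
  have pp: "p \<in> carrier A" "adj A p = p" "p \<otimes> p = p" using p by (auto simp: projection_def)
  define y where "y = p \<otimes> x"
  define z where "z = x \<ominus> y"
  have y: "y \<in> carrier A" and z: "z \<in> carrier A" using pp x by (simp_all add: y_def z_def mult_closed)
  have "p \<otimes> (p \<otimes> x) = p \<otimes> x" using pp x by (metis mult_assoc)
  then have yz: "adj A y \<otimes> z = \<zero>" "adj A z \<otimes> y = \<zero>"
    using pp x by (simp_all add: y_def z_def cstar_closed adj_mult adj_diff mult_diff_l mult_diff_r mult_assoc diff_self)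
  have "adj A (z \<ominus> y) \<otimes> (z \<ominus> y) = adj A (z \<oplus> y) \<otimes> (z \<oplus> y)"
    using y z by (simp add: adj_diff adj_add mult_l_distr mult_r_distr mult_diff_l mult_diff_r cstar_closed yz
        diff_zero) (simp add: a_minus_def minus_add cstar_closed add.inv_one)
  then have "(cnorm A (z \<ominus> y))\<^sup>2 = (cnorm A (z \<oplus> y))\<^sup>2"
    using y z cnorm_adj_mult[of "z \<ominus> y"] cnorm_adj_mult[of "z \<oplus> y"] by simp
  then have eq: "cnorm A (z \<ominus> y) = cnorm A (z \<oplus> y)"
    using y z by (simp add: cnorm_nonneg)
  have zy: "z \<oplus> y = x" using x y by (simp add: z_def diff_add_cancel)
  have "2 \<odot> z = z \<oplus> z" using smult_l_distr[of z 1 1] z by (simp add: smult_one)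
  also have "\<dots> = (z \<ominus> y) \<oplus> (z \<oplus> y)"
  proof -
    have "(z \<ominus> y) \<oplus> (z \<oplus> y) = z \<oplus> ((z \<ominus> y) \<oplus> y)" using y z by (simp add: a_ac)
    then show ?thesis using y z by (simp add: diff_add_cancel)
  qed
  finally have "cnorm A (2 \<odot> z) \<le> cnorm A (z \<ominus> y) + cnorm A (z \<oplus> y)"
    using y z by (simp add: cnorm_triangle)
  then show ?thesis
    using z eq zy by (simp add: cnorm_smult z_def y_def)
qed

text \<open>Work in the corner with unit \<open>u = f j\<close>. The compressions \<open>z k\<close>
  of the \<open>f k\<close> are positive, and the usual argument would be that u plus a sum of
  positive elements is at most u. Positivity is replaced by the bound 1 on the norm of
  \<open>u \<ominus> z k\<close>: adding these elements for all k other than i and j removes the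
  unwanted terms, and a scaled \<open>z i\<close> can be both added to and subtracted from u inside
  the unit ball. Extremality of u makes it vanish.\<close>

lemma orthogonal_if_projection_finsum:
  assumes fin: "finite I" and proj: "\<And>i. i \<in> I \<Longrightarrow> projection A (f i)"
    and sum: "projection A (\<Oplus>i\<in>I. f i)" and ij: "i \<in> I" "j \<in> I" "i \<noteq> j"
  shows "f i \<otimes> f j = \<zero>"
proof -
  have f: "f k \<in> carrier A" "adj A (f k) = f k" "f k \<otimes> f k = f k" "cnorm A (f k) \<le> 1" if "k \<in> I" for k
    using proj[OF that] cnorm_projection_le by (auto simp: projection_def)
  define u where "u = f j"
  define z where "z k = u \<otimes> f k \<otimes> u" for k
  have u: "u \<in> carrier A" "adj A u = u" "u \<otimes> u = u" "cnorm A u \<le> 1" "projection A u"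
    using f ij proj by (auto simp: u_def)
  have z: "z k \<in> carrier A" if "k \<in> I" for k using f u that by (simp add: z_def cstar_closed)
  have cl: "finsum A z J \<in> carrier A" if "J \<subseteq> I" for J
    using that z by (auto intro!: finsum_closed)
  \<comment> \<open>\<open>u \<ominus> z k\<close> is the square of
    \<open>u \<ominus> f k \<otimes> u\<close>, a contraction by
    \<open>cnorm_complement_le\<close>.\<close>
  have uz: "cnorm A (u \<ominus> z k) \<le> 1" if k: "k \<in> I" for k
  proof -
    have "cnorm A (u \<ominus> f k \<otimes> u) \<le> 1"
      using cnorm_complement_le[OF proj[OF k] u(1)] u by simp
    moreover have "adj A (u \<ominus> f k \<otimes> u) \<otimes> (u \<ominus> f k \<otimes> u) = u \<ominus> z k"
    proof -
      have "f k \<otimes> (f k \<otimes> u) = f k \<otimes> u" using f[OF k] u by (metis mult_assoc)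
      then show ?thesis
        using f[OF k] u by (simp add: z_def adj_diff adj_mult mult_diff_l mult_diff_r cstar_closed mult_assoc diff_self diff_zero)
    qed
    ultimately show ?thesis
      using cnorm_adj_mult[of "u \<ominus> f k \<otimes> u"] f[OF k] u
      by (simp add: cstar_closed cnorm_nonneg power_le_one)
  qed
  \<comment> \<open>The compression by \<open>u\<close> of the whole sum, which is a projection and
    so a contraction; the term with index \<open>j\<close> compresses to \<open>u\<close>
    itself.\<close>
  have usum: "cnorm A (u \<oplus> finsum A z (I - {j})) \<le> 1"
  proof -
    let ?p = "\<Oplus>i\<in>I. f i"
    have p: "?p \<in> carrier A" "cnorm A ?p \<le> 1" using sum cnorm_projection_le by (auto simp: projection_def)
    have "u \<otimes> ?p \<otimes> u = finsum A z I"
      using fin f u by (simp add: finsum_mult_left finsum_mult_right mult_closed z_def[abs_def])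
    also have "\<dots> = finsum A z (insert j (I - {j}))" using ij by (simp add: insert_absorb)
    also have "\<dots> = z j \<oplus> finsum A z (I - {j})"
      using fin z ij by (intro finsum_insert) auto
    also have "z j = u" using u by (simp add: z_def u_def[symmetric])
    finally have "u \<oplus> finsum A z (I - {j}) = u \<otimes> ?p \<otimes> u" by simp
    moreover have "cnorm A (u \<otimes> ?p \<otimes> u) \<le> 1 * 1 * 1"
      by (intro order_trans[OF cnorm_mult] mult_mono order_trans[OF cnorm_mult] u p)
        (auto simp: u p mult_closed cnorm_nonneg)
    ultimately show ?thesis by simp
  qed
  \<comment> \<open>Moving an index \<open>k\<close> from \<open>K\<close> to \<open>J\<close>
    replaces \<open>z k\<close> by \<open>u\<close>, that is, adds \<open>u \<ominus> z k\<close>,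
    at the cost of at most 1 in norm.\<close>
  have bound: "cnorm A ((of_nat (card J) \<odot> u \<oplus> u) \<oplus> finsum A z K) \<le> real (card J) + 1"
    if "finite J" "J \<union> K = I - {j}" "J \<inter> K = {}" for J K
    using that
  proof (induction J arbitrary: K rule: finite_induct)
    case empty
    then show ?case using usum u by (simp add: zero_smult)
  next
    case (insert k J)
    have k: "k \<in> I" and K: "K \<subseteq> I" "finite K" "k \<notin> K" using insert fin by (auto intro: finite_subset)
    have "cnorm A ((of_nat (card J) \<odot> u \<oplus> u) \<oplus> finsum A z (insert k K)) \<le> real (card J) + 1"
      using insert by (intro insert.IH) auto
    moreover have "finsum A z (insert k K) = z k \<oplus> finsum A z K"
      using K k z by (intro finsum_insert) auto
    moreover have "(of_nat (card (insert k J)) \<odot> u \<oplus> u) \<oplus> finsum A z K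
        = ((of_nat (card J) \<odot> u \<oplus> u) \<oplus> (z k \<oplus> finsum A z K)) \<oplus> (u \<ominus> z k)"
    proof -
      have "((of_nat (card J) \<odot> u \<oplus> u) \<oplus> (z k \<oplus> finsum A z K)) \<oplus> (u \<ominus> z k)
          = ((of_nat (card J) \<odot> u \<oplus> u) \<oplus> finsum A z K) \<oplus> ((u \<ominus> z k) \<oplus> z k)"
        using u z[OF k] cl[OF K(1)] by (simp add: cstar_closed a_ac)
      also have "(u \<ominus> z k) \<oplus> z k = u" using u z[OF k] by (simp add: diff_add_cancel)
      finally show ?thesis
        using u cl[OF K(1)] insert(1,2) smult_l_distr[of u "of_nat (card J)" 1]
        by (simp add: cstar_closed a_ac smult_one add.commute)
    qed
    ultimately have "cnorm A ((of_nat (card (insert k J)) \<odot> u \<oplus> u) \<oplus> finsum A z K)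
        \<le> (real (card J) + 1) + 1"
      using uz[OF k] u z[OF k] cl[OF K(1)]
        cnorm_triangle[of "(of_nat (card J) \<odot> u \<oplus> u) \<oplus> (z k \<oplus> finsum A z K)" "u \<ominus> z k"]
      by (simp add: cstar_closed)
    then show ?case using insert(1,2) by simp
  qed
  \<comment> \<open>The number of copies of \<open>u\<close> once every compression except
    \<open>z i\<close> has been traded away: one for each traded index and the original one.\<close>
  define N where "N = card (I - {j} - {i}) + 1"
  define w where "w = complex_of_real (1 / N) \<odot> z i"
  have N: "real N \<ge> 1" by (simp add: N_def)
  have zi: "z i \<in> carrier A" using z ij by simp
  have w: "w \<in> carrier A" using zi by (simp add: w_def cstar_closed)
  have "w = \<zero>"
  proof (rule unit_extreme[OF u(5) w])
    have "u \<otimes> z i = z i" "z i \<otimes> u = z i"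
      using f[OF ij(1)] u by (metis z_def mult_assoc mult_closed)+
    then show "u \<otimes> w = w" "w \<otimes> u = w"
      using u zi by (simp_all add: w_def smult_mult_l smult_mult_r)
    have "cnorm A ((of_nat (card (I - {j} - {i})) \<odot> u \<oplus> u) \<oplus> finsum A z {i}) \<le> real (card (I - {j} - {i})) + 1"
      using fin ij by (intro bound) auto
    moreover have "of_nat (card (I - {j} - {i})) \<odot> u \<oplus> u = of_nat N \<odot> u"
      using u smult_l_distr[of u "of_nat (card (I - {j} - {i}))" 1] by (simp add: N_def smult_one add.commute)
    ultimately have "cnorm A (of_nat N \<odot> u \<oplus> z i) \<le> real N"
      using zi by (simp add: N_def)
    moreover have "u \<oplus> w = complex_of_real (1 / N) \<odot> (of_nat N \<odot> u \<oplus> z i)"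
      using u zi N by (simp add: w_def smult_r_distr cstar_closed smult_one flip: smult_assoc1)
    ultimately show "cnorm A (u \<oplus> w) \<le> 1"
      using u zi N by (simp add: cnorm_smult cstar_closed norm_divide)
    \<comment> \<open>A convex combination of the contractions \<open>u\<close> and
      \<open>u \<ominus> z i\<close>.\<close>
    have "u \<ominus> w = complex_of_real (1 - 1 / N) \<odot> u \<oplus> complex_of_real (1 / N) \<odot> (u \<ominus> z i)"
    proof -
      have "complex_of_real (1 - 1 / N) \<odot> u \<oplus> complex_of_real (1 / N) \<odot> (u \<ominus> z i)
          = (complex_of_real (1 - 1 / N) \<odot> u \<oplus> complex_of_real (1 / N) \<odot> u) \<ominus> w"
        using u zi w by (simp add: w_def smult_diff cstar_closed) (simp add: a_minus_def a_assoc cstar_closed)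
      also have "complex_of_real (1 - 1 / N) \<odot> u \<oplus> complex_of_real (1 / N) \<odot> u = u"
        using u by (simp add: smult_one flip: smult_l_distr)
      finally show ?thesis by simp
    qed
    also have "cnorm A \<dots> \<le> (1 - 1 / N) * 1 + 1 / N * 1"
    proof (rule order_trans[OF cnorm_triangle add_mono])
      have "cmod (complex_of_real (1 - 1 / N)) = 1 - 1 / N" "cmod (complex_of_real (1 / N)) = 1 / N"
        using N by (simp_all only: norm_of_real) simp_all
      then show "cnorm A (complex_of_real (1 - 1 / N) \<odot> u) \<le> (1 - 1 / N) * 1"
        "cnorm A (complex_of_real (1 / N) \<odot> (u \<ominus> z i)) \<le> 1 / N * 1"
        unfolding cnorm_smult[OF u(1)] cnorm_smult[OF diff_closed[OF u(1) zi]]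
        using u(4) uz[OF ij(1)] N by (simp_all only:) (intro mult_left_mono; simp)+
    qed (use u zi in \<open>auto simp: smult_closed\<close>)
    finally show "cnorm A (u \<ominus> w) \<le> 1" by simp
  qed
  then have "complex_of_real N \<odot> w = \<zero>" by (simp add: smult_zero)
  then have "z i = \<zero>"
    using N zi by (simp add: w_def smult_one flip: smult_assoc1)
  moreover have "adj A (f i \<otimes> u) \<otimes> (f i \<otimes> u) = z i"
  proof -
    have "f i \<otimes> (f i \<otimes> u) = f i \<otimes> u" using f[OF ij(1)] u by (metis mult_assoc)
    then show ?thesis
      using f[OF ij(1)] u by (simp add: z_def adj_mult mult_assoc cstar_closed)
  qed
  ultimately have "adj A (f i \<otimes> u) \<otimes> (f i \<otimes> u) = \<zero>" by simp
  then have "f i \<otimes> u = \<zero>"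
    by (rule eq_zero_if_adj_mult[rotated]) (simp add: f(1)[OF ij(1)] u(1) mult_closed)
  then show ?thesis by (simp add: u_def)
qed

end

section \<open>Cuntz-Krieger families and range projections of paths\<close>

context directed_graph
begin

lemma paths_from_0: "v \<in> verts G \<Longrightarrow> paths_from G v 0 = {[]}"
  by (auto simp: paths_from_def awalk_Nil_iff)

lemma Cons_in_paths_from:
  "e # p \<in> paths_from G v (Suc k) \<longleftrightarrow> e \<in> out_arcs G v \<and> p \<in> paths_from G (head G e) k"
  by (auto simp: paths_from_def awalk_Cons_iff)

lemma paths_from_Suc:
  "paths_from G v (Suc k) = (\<Union>e\<in>out_arcs G v. (#) e ` paths_from G (head G e) k)"
proof -
  have "p \<in> (\<Union>e\<in>out_arcs G v. (#) e ` paths_from G (head G e) k)" if "p \<in> paths_from G v (Suc k)" for p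
  proof (cases p)
    case Nil
    then show ?thesis using that by (simp add: paths_from_def)
  next
    case (Cons e q)
    then show ?thesis using that Cons_in_paths_from by blast
  qed
  then show ?thesis using Cons_in_paths_from by blast
qed

lemma paths_from_vertex: "p \<in> paths_from G v k \<Longrightarrow> v \<in> verts G"
  by (auto simp: paths_from_def)

lemma length_paths_from: "p \<in> paths_from G v k \<Longrightarrow> length p = k"
  by (simp add: paths_from_def)

lemma finite_paths_from:
  assumes "row_finite G" shows "finite (paths_from G v k)"
proof (induction k arbitrary: v)
  case 0
  show ?case by (rule finite_subset[of _ "{[]}"]) (auto simp: paths_from_def)
next
  case (Suc k)
  have "finite (out_arcs G v)"
    using assms by (cases "v \<in> verts G") (auto simp: row_finite_def out_arcs_def intro: finite_subset[of _ "{}"])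
  with Suc show ?case by (simp add: paths_from_Suc)
qed

lemma butlast_in_paths_from: "p \<in> paths_from G v (Suc k) \<Longrightarrow> butlast p \<in> paths_from G v k"
proof (induction k arbitrary: p v)
  case 0
  then show ?case
    by (auto simp: paths_from_Suc paths_from_0)
next
  case (Suc k)
  obtain e q where p: "p = e # q" "e \<in> out_arcs G v" "q \<in> paths_from G (head G e) (Suc k)"
    using Suc.prems unfolding paths_from_Suc[of v "Suc k"] by blast
  moreover have "q \<noteq> []" using length_paths_from[OF p(3)] by auto
  ultimately show ?case
    using Suc.IH[OF p(3)] by (simp add: Cons_in_paths_from)
qed

end

text \<open>For a path \<alpha> this is the range projection s_\<alpha> s_\<alpha>*, nested so that
  induction peels off the first edge. The vertex argument is there because an empty edge list does
  not determine its vertex.\<close>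

primrec path_projection ::
    "('v, 'e) pre_digraph \<Rightarrow> 'a cstar \<Rightarrow> ('e \<Rightarrow> 'a) \<Rightarrow> ('v \<Rightarrow> 'a) \<Rightarrow> 'v \<Rightarrow> 'e list \<Rightarrow> 'a" where
  "path_projection G A S P v [] = P v"
| "path_projection G A S P v (e # p) =
     S e \<otimes>\<^bsub>A\<^esub> path_projection G A S P (head G e) p \<otimes>\<^bsub>A\<^esub> adj A (S e)"

locale row_finite_graph = directed_graph G for G :: "('v, 'e) pre_digraph" +
  assumes row_finite: "row_finite G" and no_sinks: "\<forall>v\<in>verts G. \<not> sink G v"
begin

lemma finite_out_arcs[simp]: "v \<in> verts G \<Longrightarrow> finite (out_arcs G v)"
  using row_finite by (simp add: row_finite_def)

lemmas finite_paths[simp] = finite_paths_from[OF row_finite]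

end

section \<open>Consequences of the Cuntz-Krieger relations\<close>

locale ck_family = cstar_algebra A + row_finite_graph G
  for A :: "'a cstar" (structure) and G :: "('v, 'e) pre_digraph" +
  fixes S :: "'e \<Rightarrow> 'a" and P :: "'v \<Rightarrow> 'a"
  assumes CK: "CK_family G A S P"
begin

abbreviation "R \<equiv> path_projection G A S P"

lemma P_simps[simp]:
  "v \<in> verts G \<Longrightarrow> P v \<in> carrier A" "v \<in> verts G \<Longrightarrow> adj A (P v) = P v" "v \<in> verts G \<Longrightarrow> P v \<otimes> P v = P v"
  using CK by (auto simp: CK_family_def projection_def)

lemma P_orthogonal: "v \<in> verts G \<Longrightarrow> w \<in> verts G \<Longrightarrow> v \<noteq> w \<Longrightarrow> P v \<otimes> P w = \<zero>"
  using CK by (simp add: CK_family_def)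

lemma S_closed[simp]: "e \<in> arcs G \<Longrightarrow> S e \<in> carrier A"
  using CK by (auto simp: CK_family_def partial_isometry_def)

lemma adj_S_closed[simp]: "e \<in> arcs G \<Longrightarrow> adj A (S e) \<in> carrier A"
  by (simp add: adj_closed)

lemma adj_S_S: "e \<in> arcs G \<Longrightarrow> adj A (S e) \<otimes> S e = P (head G e)"
  using CK by (simp add: CK_family_def)

lemma S_P_head: "e \<in> arcs G \<Longrightarrow> S e \<otimes> P (head G e) = S e"
  using CK by (simp add: CK_family_def partial_isometry_def mult_assoc flip: adj_S_S)

lemma P_sum: "v \<in> verts G \<Longrightarrow> P v = (\<Oplus>e\<in>out_arcs G v. S e \<otimes> adj A (S e))"
  using CK no_sinks by (simp add: CK_family_def)

lemma projection_S_adj_S: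
  assumes "e \<in> arcs G" shows "projection A (S e \<otimes> adj A (S e))"
proof -
  have "S e \<otimes> adj A (S e) \<otimes> (S e \<otimes> adj A (S e)) = S e \<otimes> (adj A (S e) \<otimes> S e) \<otimes> adj A (S e)"
    using assms by (simp add: mult_assoc mult_closed)
  also have "\<dots> = S e \<otimes> adj A (S e)"
    using assms by (simp add: adj_S_S S_P_head)
  finally show ?thesis
    using assms by (simp add: projection_def mult_closed adj_mult adj_adj)
qed

text \<open>Implicit in CK2: range projections of edges leaving \<open>v\<close> add up to the
  projection \<open>P v\<close>.\<close>

lemma range_projections_orthogonal:
  assumes "v \<in> verts G" "e \<in> out_arcs G v" "f \<in> out_arcs G v" "e \<noteq> f"
  shows "S e \<otimes> adj A (S e) \<otimes> (S f \<otimes> adj A (S f)) = \<zero>"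
proof (rule orthogonal_if_projection_finsum[of "out_arcs G v" "\<lambda>e. S e \<otimes> adj A (S e)"])
  show "projection A (\<Oplus>e\<in>out_arcs G v. S e \<otimes> adj A (S e))"
    unfolding P_sum[OF assms(1), symmetric] using assms by (simp add: projection_def)
qed (use assms in \<open>auto intro: projection_S_adj_S\<close>)

lemma S_adj_S_S: "e \<in> arcs G \<Longrightarrow> S e \<otimes> adj A (S e) \<otimes> S e = S e"
  by (simp add: mult_assoc adj_S_S S_P_head)

lemma P_tail_S:
  assumes e: "e \<in> arcs G" shows "P (tail G e) \<otimes> S e = S e"
proof -
  have out: "e \<in> out_arcs G (tail G e)" "tail G e \<in> verts G" using e by auto
  have fS: "S f \<otimes> adj A (S f) \<otimes> S e = (if f = e then S e else \<zero>)" if f: "f \<in> out_arcs G (tail G e)" for f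
  proof (cases "f = e")
    case False
    have "S f \<otimes> adj A (S f) \<otimes> S e = S f \<otimes> adj A (S f) \<otimes> (S e \<otimes> adj A (S e) \<otimes> S e)"
      using e by (simp add: S_adj_S_S)
    also have "\<dots> = (S f \<otimes> adj A (S f) \<otimes> (S e \<otimes> adj A (S e))) \<otimes> S e"
      using e f by (simp add: mult_assoc mult_closed)
    also have "\<dots> = \<zero>"
      using range_projections_orthogonal[OF out(2) f out(1) False] e by (simp add: zero_mult)
    finally show ?thesis using False by simp
  qed (use e S_adj_S_S in auto)
  have "P (tail G e) \<otimes> S e = (\<Oplus>f\<in>out_arcs G (tail G e). S f \<otimes> adj A (S f) \<otimes> S e)"
    unfolding P_sum[OF out(2)] using e out by (intro finsum_mult_right) (auto simp: mult_closed)
  also have "\<dots> = S e \<otimes> adj A (S e) \<otimes> S e"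
    using e out fS by (intro finsum_single) (auto simp: mult_closed)
  finally show ?thesis using e by (simp add: S_adj_S_S)
qed

lemma adj_S_P_tail: "e \<in> arcs G \<Longrightarrow> adj A (S e) \<otimes> P (tail G e) = adj A (S e)"
  using arg_cong[OF P_tail_S[of e], of "adj A"] by (simp add: adj_mult)

lemma P_head_adj_S: "e \<in> arcs G \<Longrightarrow> P (head G e) \<otimes> adj A (S e) = adj A (S e)"
  using arg_cong[OF S_P_head[of e], of "adj A"] by (simp add: adj_mult)

lemma adj_S_S_orthogonal:
  assumes e: "e \<in> arcs G" and f: "f \<in> arcs G" and "e \<noteq> f"
  shows "adj A (S e) \<otimes> S f = \<zero>"
proof (cases "tail G e = tail G f")
  case True
  have "adj A (S e) \<otimes> S f = adj A (S e) \<otimes> (S e \<otimes> adj A (S e) \<otimes> (S f \<otimes> adj A (S f))) \<otimes> S f"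
  proof -
    have "adj A (S e) \<otimes> (S e \<otimes> adj A (S e)) = adj A (S e)"
      using e by (simp add: adj_S_S P_head_adj_S flip: mult_assoc)
    moreover have "adj A (S e) \<otimes> (S e \<otimes> adj A (S e) \<otimes> (S f \<otimes> adj A (S f))) \<otimes> S f
        = (adj A (S e) \<otimes> (S e \<otimes> adj A (S e))) \<otimes> (S f \<otimes> adj A (S f) \<otimes> S f)"
      using e f by (simp add: mult_assoc mult_closed)
    ultimately show ?thesis using f by (simp add: S_adj_S_S)
  qed
  also have "\<dots> = \<zero>"
    using range_projections_orthogonal[of "tail G e" e f] assms True by (simp add: zero_mult mult_zero)
  finally show ?thesis .
next
  case False
  have "adj A (S e) \<otimes> S f = (adj A (S e) \<otimes> P (tail G e)) \<otimes> (P (tail G f) \<otimes> S f)"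
    using e f by (simp add: adj_S_P_tail P_tail_S)
  also have "\<dots> = adj A (S e) \<otimes> (P (tail G e) \<otimes> P (tail G f)) \<otimes> S f"
    using e f by (simp add: mult_assoc mult_closed)
  also have "\<dots> = \<zero>"
    using e f False by (simp add: P_orthogonal zero_mult mult_zero)
  finally show ?thesis .
qed

lemma range_projection_products:
  assumes "e \<in> arcs G" "f \<in> arcs G" "e \<noteq> f"
  shows "S e \<otimes> adj A (S e) \<otimes> (S f \<otimes> adj A (S f)) = \<zero>"
proof -
  have "S e \<otimes> adj A (S e) \<otimes> (S f \<otimes> adj A (S f)) = S e \<otimes> (adj A (S e) \<otimes> S f) \<otimes> adj A (S f)"
    using assms by (simp add: mult_assoc mult_closed)
  then show ?thesis using assms by (simp add: adj_S_S_orthogonal zero_mult mult_zero)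
qed

lemma sandwich_mult:
  assumes "e \<in> arcs G" "x \<in> carrier A" "y \<in> carrier A" "P (head G e) \<otimes> y = y"
  shows "(S e \<otimes> x \<otimes> adj A (S e)) \<otimes> (S e \<otimes> y \<otimes> adj A (S e)) = S e \<otimes> (x \<otimes> y) \<otimes> adj A (S e)"
proof -
  have "(S e \<otimes> x \<otimes> adj A (S e)) \<otimes> (S e \<otimes> y \<otimes> adj A (S e))
      = S e \<otimes> (x \<otimes> ((adj A (S e) \<otimes> S e) \<otimes> y)) \<otimes> adj A (S e)"
    using assms by (simp add: mult_assoc mult_closed)
  then show ?thesis using assms by (simp add: adj_S_S)
qed

lemma sandwich_mult_orthogonal:
  assumes "e \<in> arcs G" "f \<in> arcs G" "e \<noteq> f" "x \<in> carrier A" "y \<in> carrier A"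
  shows "(S e \<otimes> x \<otimes> adj A (S e)) \<otimes> (S f \<otimes> y \<otimes> adj A (S f)) = \<zero>"
proof -
  have "(S e \<otimes> x \<otimes> adj A (S e)) \<otimes> (S f \<otimes> y \<otimes> adj A (S f))
      = S e \<otimes> x \<otimes> (adj A (S e) \<otimes> S f) \<otimes> y \<otimes> adj A (S f)"
    using assms by (simp add: mult_assoc mult_closed)
  then show ?thesis using assms by (simp add: adj_S_S_orthogonal zero_mult mult_zero mult_closed)
qed

text \<open>Absorption by \<open>P v\<close> has to be carried through the induction: multiplying
  two elements sandwiched by \<open>S e\<close> creates \<open>P (head G e)\<close> in the middle,
  which the inner projection must swallow.\<close>

lemma path_projection:
  "p \<in> paths_from G v k \<Longrightarrow> projection A (R v p) \<and> P v \<otimes> R v p = R v p"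
proof (induction k arbitrary: v p)
  case 0
  then have "v \<in> verts G" "p = []" by (auto dest: paths_from_vertex length_paths_from)
  then show ?case by (simp add: projection_def)
next
  case (Suc k)
  then obtain e q where p: "p = e # q" "e \<in> out_arcs G v" "q \<in> paths_from G (head G e) k"
    by (auto simp: paths_from_Suc)
  have e: "e \<in> arcs G" "tail G e = v" using p by auto
  have q: "R (head G e) q \<in> carrier A" "adj A (R (head G e) q) = R (head G e) q"
    "R (head G e) q \<otimes> R (head G e) q = R (head G e) q" "P (head G e) \<otimes> R (head G e) q = R (head G e) q"
    using Suc.IH[OF p(3)] by (auto simp: projection_def)
  have "P v \<otimes> R v p = (P v \<otimes> S e) \<otimes> R (head G e) q \<otimes> adj A (S e)"
    using p e q paths_from_vertex[OF Suc.prems] by (simp add: mult_assoc mult_closed)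
  then have "P v \<otimes> R v p = R v p"
    using P_tail_S[OF e(1)] e(2) p by simp
  moreover have "R v p \<otimes> R v p = R v p"
    using p(1) q e(1) by (simp add: sandwich_mult)
  then have "projection A (R v p)"
    unfolding projection_def using p(1) q(1,2) e by (simp add: adj_mult adj_adj mult_closed mult_assoc)
  ultimately show ?case by blast
qed

lemma path_projection_simps:
  assumes "p \<in> paths_from G v k"
  shows "R v p \<in> carrier A" "adj A (R v p) = R v p" "R v p \<otimes> R v p = R v p" "P v \<otimes> R v p = R v p"
  using path_projection[OF assms] by (auto simp: projection_def)

text \<open>The common length is essential, since the projection of a path dominates those of its
  extensions. For nonempty paths, different start vertices already mean different first
  edges.\<close>

lemma path_projections_orthogonal:
  "p \<in> paths_from G v k \<Longrightarrow> q \<in> paths_from G w k \<Longrightarrow> v \<noteq> w \<or> p \<noteq> q \<Longrightarrow> R v p \<otimes> R w q = \<zero>"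
proof (induction k arbitrary: v w p q)
  case 0
  then have "v \<in> verts G" "w \<in> verts G" "p = []" "q = []" by (auto dest: paths_from_vertex length_paths_from)
  with 0 show ?case by (simp add: P_orthogonal)
next
  case (Suc k)
  obtain e p' where p: "p = e # p'" "e \<in> out_arcs G v" "p' \<in> paths_from G (head G e) k"
    using Suc.prems by (auto simp: paths_from_Suc)
  obtain f q' where q: "q = f # q'" "f \<in> out_arcs G w" "q' \<in> paths_from G (head G f) k"
    using Suc.prems by (auto simp: paths_from_Suc)
  show ?case
  proof (cases "e = f")
    case True
    then have "p' \<noteq> q'" using p q Suc.prems(3) by auto
    then have "R (head G e) p' \<otimes> R (head G e) q' = \<zero>"
      using p q True by (intro Suc.IH) auto
    then show ?thesis
      using p q True path_projection_simps[OF p(3)] path_projection_simps[OF q(3)]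
      by (simp add: sandwich_mult zero_mult mult_zero)
  next
    case False
    then show ?thesis
      using p q path_projection_simps[OF p(3)] path_projection_simps[OF q(3)]
      by (simp add: sandwich_mult_orthogonal)
  qed
qed

lemma finsum_sandwich:
  assumes "e \<in> arcs G" "X \<subseteq> paths_from G (head G e) k"
  shows "(\<Oplus>p\<in>(#) e ` X. R v p) = S e \<otimes> (\<Oplus>p\<in>X. R (head G e) p) \<otimes> adj A (S e)"
proof -
  have fin: "finite X" using assms(2) finite_paths by (rule finite_subset)
  have cl: "R (head G e) p \<in> carrier A" if "p \<in> X" for p
    using assms(2) that path_projection_simps by blast
  have "(\<Oplus>p\<in>(#) e ` X. R v p) = (\<Oplus>p\<in>X. R v (e # p))"
    using assms(1) cl by (intro finsum_reindex) (auto simp: mult_closed)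
  also have "\<dots> = (\<Oplus>p\<in>X. S e \<otimes> R (head G e) p) \<otimes> adj A (S e)"
    using assms(1) cl fin by (simp add: finsum_mult_right mult_closed)
  also have "(\<Oplus>p\<in>X. S e \<otimes> R (head G e) p) = S e \<otimes> (\<Oplus>p\<in>X. R (head G e) p)"
    using assms(1) cl fin by (simp add: finsum_mult_left)
  finally show ?thesis .
qed

lemma finsum_path_projection:
  "v \<in> verts G \<Longrightarrow> (\<Oplus>p\<in>paths_from G v k. R v p) = P v"
proof (induction k arbitrary: v)
  case (Suc k)
  have cl: "R v (e # p) \<in> carrier A" if "e \<in> out_arcs G v" "p \<in> paths_from G (head G e) k" for e p
    using that path_projection_simps(1)[of "e # p" v "Suc k"] by (simp add: Cons_in_paths_from)
  have "(\<Oplus>p\<in>paths_from G v (Suc k). R v p)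
      = (\<Oplus>e\<in>out_arcs G v. \<Oplus>p\<in>(#) e ` paths_from G (head G e) k. R v p)"
    unfolding paths_from_Suc using Suc.prems cl by (intro finsum_UN_disjoint[symmetric]) auto
  also have "\<dots> = (\<Oplus>e\<in>out_arcs G v. S e \<otimes> adj A (S e))"
  proof (rule finsum_cong')
    show "(\<Oplus>p\<in>(#) e ` paths_from G (head G e) k. R v p) = S e \<otimes> adj A (S e)" if "e \<in> out_arcs G v" for e
      using that Suc.IH[of "head G e"] by (simp add: finsum_sandwich[OF _ order_refl] S_P_head)
  qed (auto simp: mult_closed)
  also have "\<dots> = P v" using Suc.prems by (rule P_sum[symmetric])
  finally show ?case .
qed (simp add: paths_from_0)

text \<open>CK2 applied at the end of the path: the paths through \<open>p\<close> split according
  to their next edge. The induction still works at the front, carrying the refinement inward through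
  the sandwiches.\<close>

lemma path_projection_extend:
  "p \<in> paths_from G v k \<Longrightarrow> R v p = (\<Oplus>q\<in>{q \<in> paths_from G v (Suc k). butlast q = p}. R v q)"
proof (induction k arbitrary: v p)
  case 0
  then have v: "v \<in> verts G" and p: "p = []" by (auto dest: paths_from_vertex length_paths_from)
  have "butlast q = p" if "q \<in> paths_from G v (Suc 0)" for q
    using length_paths_from[OF that] p by (auto simp: length_Suc_conv)
  then have "{q \<in> paths_from G v (Suc 0). butlast q = p} = paths_from G v (Suc 0)"
    by blast
  then show ?case using finsum_path_projection[OF v, of "Suc 0"] p by simp
next
  case (Suc k)
  obtain e p' where p: "p = e # p'" "e \<in> out_arcs G v" "p' \<in> paths_from G (head G e) k"
    using Suc.prems by (auto simp: paths_from_Suc)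
  let ?X = "{q \<in> paths_from G (head G e) (Suc k). butlast q = p'}"
  \<comment> \<open>\<open>butlast\<close> commutes with prefixing an edge only for nonempty
    lists.\<close>
  have nonempty: "q' \<noteq> []" if "q' \<in> paths_from G w (Suc k)" for q' w
    using length_paths_from[OF that] by auto
  have "{q \<in> paths_from G v (Suc (Suc k)). butlast q = p} = (#) e ` ?X" (is "?L = ?R")
  proof
    show "?L \<subseteq> ?R"
    proof
      fix q assume q: "q \<in> ?L"
      then obtain f q' where "q = f # q'" "q' \<in> paths_from G (head G f) (Suc k)"
        by (subst (asm) paths_from_Suc) blast
      then show "q \<in> ?R" using q p nonempty by auto
    qed
    show "?R \<subseteq> ?L"
      using p nonempty by (auto simp: Cons_in_paths_from)
  qed
  note eq = this
  have "R v p = S e \<otimes> R (head G e) p' \<otimes> adj A (S e)"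
    by (simp only: p(1) path_projection.simps)
  also have "R (head G e) p' = (\<Oplus>q\<in>?X. R (head G e) q)"
    by (rule Suc.IH[OF p(3)])
  also have "S e \<otimes> \<dots> \<otimes> adj A (S e) = (\<Oplus>q\<in>(#) e ` ?X. R v q)"
    by (rule finsum_sandwich[of _ _ "Suc k", symmetric]) (use p(2) in auto)
  finally show ?case
    unfolding eq .
qed

lemma finsum_path_projection_extend:
  assumes "X \<subseteq> paths_from G v k"
  shows "(\<Oplus>p\<in>X. R v p) = (\<Oplus>q\<in>{q \<in> paths_from G v (Suc k). butlast q \<in> X}. R v q)"
proof -
  have "(\<Oplus>p\<in>X. R v p) = (\<Oplus>p\<in>X. \<Oplus>q\<in>{q \<in> paths_from G v (Suc k). butlast q = p}. R v q)"
    using assms path_projection_simps(1)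
    by (intro finsum_cong' path_projection_extend) (auto intro!: finsum_closed)
  also have "\<dots> = (\<Oplus>q\<in>(\<Union>p\<in>X. {q \<in> paths_from G v (Suc k). butlast q = p}). R v q)"
    using assms path_projection_simps(1) finite_subset[OF assms finite_paths]
    by (intro finsum_UN_disjoint) auto
  also have "(\<Union>p\<in>X. {q \<in> paths_from G v (Suc k). butlast q = p}) = {q \<in> paths_from G v (Suc k). butlast q \<in> X}"
    by auto
  finally show ?thesis .
qed

end

section \<open>Infinite paths and edge shifts\<close>

text \<open>The record \<open>cstar\<close> shadows the truncation of sequences by its own \<open>truncate\<close>.\<close>

hide_const (open) cstar.truncate
hide_fact (open) cstar.truncate_def

lemma topspace_full_shift:
  "infinite \<A> \<Longrightarrow> topspace (full_shift \<A>) = truncate ` topspace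
     (product_topology (\<lambda>_::nat. Alexandroff_compactification (discrete_topology \<A>)) UNIV)"
  by (simp only: full_shift_def if_False quotient_imp_surjective_map[OF quotient_map_quotient_topology])

lemma inf_seq_in_full_shift:
  assumes "x \<in> infinite_paths G" shows "inf_seq x \<in> topspace (full_shift (arcs G))"
proof (cases "finite (arcs G)")
  case True
  then show ?thesis
    using assms by (auto simp: full_shift_def inf_seq_def infinite_paths_def)
next
  case False
  let ?X = "product_topology (\<lambda>_::nat. Alexandroff_compactification (discrete_topology (arcs G))) UNIV"
  note topspace_full_shift[OF False]
  moreover have "truncate (inf_seq x) = inf_seq x"
    by (simp add: truncate_def inf_seq_def fun_eq_iff)
  moreover have "inf_seq x \<in> topspace ?X"
    using assms by (auto simp: inf_seq_def infinite_paths_def)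
  ultimately show ?thesis by (metis imageI)
qed

lemma inf_seq_in_edge_shift: "x \<in> infinite_paths G \<Longrightarrow> inf_seq x \<in> edge_shift G"
  unfolding edge_shift_def in_closure_of using inf_seq_in_full_shift by blast

text \<open>For an infinite alphabet the preimage under \<open>truncate\<close> constrains finitely
  many coordinates: entry \<open>i\<close> is \<open>a\<close>, and no earlier entry is the point at
  infinity, since otherwise truncation would have removed entry \<open>i\<close>.\<close>

lemma openin_full_shift_cylinder:
  assumes a: "a \<in> \<A>"
  shows "openin (full_shift \<A>) {x \<in> topspace (full_shift \<A>). x i = Some a}"
proof (cases "finite \<A>")
  case True
  let ?X = "product_topology (\<lambda>_::nat. discrete_topology (Some ` \<A>)) UNIV"
  have "openin ?X {x \<in> topspace ?X. x i \<in> {Some a}}"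
    using a by (intro openin_continuous_map_preimage[OF continuous_map_product_projection]) auto
  then show ?thesis using True by (simp add: full_shift_def)
next
  case False
  let ?K = "Alexandroff_compactification (discrete_topology \<A>)"
  let ?X = "product_topology (\<lambda>_::nat. ?K) UNIV"
  \<comment> \<open>Only indices up to \<open>i\<close> matter: letters other than infinity before
    \<open>i\<close>, and the prescribed letter at \<open>i\<close>.\<close>
  define V where "V j = (if j < i then \<A> else {a})" for j
  have V: "openin ?X {x \<in> topspace ?X. x j \<in> Some ` V j}" for j
    using a by (intro openin_continuous_map_preimage[OF continuous_map_product_projection]) (auto simp: V_def)
  note top = topspace_full_shift[OF False]
  have "{x \<in> topspace ?X. truncate x i = Some a} = (\<Inter>j\<in>{..i}. {x \<in> topspace ?X. x j \<in> Some ` V j})"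
  proof (intro subset_antisym subsetI)
    fix x assume x: "x \<in> {x \<in> topspace ?X. truncate x i = Some a}"
    then have ne: "\<forall>j\<le>i. x j \<noteq> None" and xi: "x i = Some a"
      by (auto simp: truncate_def split: if_splits)
    have in_\<A>: "x j \<in> insert None (Some ` \<A>)" for j
      using x by (auto simp: PiE_iff)
    have "x j \<in> Some ` V j" if "j \<le> i" for j
      using in_\<A>[of j] ne xi that by (cases "j = i") (auto simp: V_def)
    then show "x \<in> (\<Inter>j\<in>{..i}. {x \<in> topspace ?X. x j \<in> Some ` V j})"
      using x by auto
  next
    fix x assume x: "x \<in> (\<Inter>j\<in>{..i}. {x \<in> topspace ?X. x j \<in> Some ` V j})"
    then have "x j \<noteq> None" if "j \<le> i" for j using that by auto
    moreover have "x i \<in> Some ` V i" using x by blast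
    then have "x i = Some a" by (simp add: V_def)
    ultimately show "x \<in> {x \<in> topspace ?X. truncate x i = Some a}"
      using x by (auto simp: truncate_def)
  qed
  moreover have "openin ?X (\<Inter>j\<in>{..i}. {x \<in> topspace ?X. x j \<in> Some ` V j})"
    using V by (intro openin_INT2) auto
  ultimately have "openin ?X {x \<in> topspace ?X. truncate x i = Some a}" by simp
  moreover have "{x \<in> topspace ?X. truncate x \<in> {x \<in> topspace (full_shift \<A>). x i = Some a}}
      = {x \<in> topspace ?X. truncate x i = Some a}"
    unfolding top by blast
  ultimately show ?thesis
    unfolding top using False by (simp add: full_shift_def openin_quotient_topology)
qed

text \<open>Being a path is a condition on pairs of consecutive entries. Fixing such a pair is an
  open condition, so a point of the closure shares each of its pairs with some genuine infinite
  path.\<close>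

lemma edge_shift_imp_infinite_path:
  assumes x: "inf_seq x \<in> edge_shift G" shows "x \<in> infinite_paths G"
  unfolding infinite_paths_def
proof (intro CollectI allI)
  fix i
  let ?T = "full_shift (arcs G)"
  have x_top: "inf_seq x \<in> topspace ?T"
    using x by (simp add: edge_shift_def in_closure_of)
  have arcs: "x j \<in> arcs G" for j
  proof -
    have "inf_seq x j \<in> insert None (Some ` arcs G)"
    proof (cases "finite (arcs G)")
      case True
      then show ?thesis using x_top by (auto simp: full_shift_def PiE_iff)
    next
      case False
      then obtain z where z: "inf_seq x = truncate z"
        "z \<in> topspace (product_topology (\<lambda>_::nat. Alexandroff_compactification (discrete_topology (arcs G))) UNIV)"
        using x_top unfolding topspace_full_shift[OF False] by blast
      then have "z j \<in> insert None (Some ` arcs G)" by (auto simp: PiE_iff)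
      then show ?thesis using z(1) by (auto simp: truncate_def)
    qed
    then show ?thesis by (auto simp: inf_seq_def)
  qed
  let ?U = "{y \<in> topspace ?T. y i = Some (x i)} \<inter> {y \<in> topspace ?T. y (Suc i) = Some (x (Suc i))}"
  have U: "openin ?T ?U" using arcs by (intro openin_Int openin_full_shift_cylinder)
  have xU: "inf_seq x \<in> ?U" using x_top by (simp add: inf_seq_def)
  have "\<forall>T. inf_seq x \<in> T \<and> openin ?T T \<longrightarrow> (\<exists>z\<in>inf_seq ` infinite_paths G. z \<in> T)"
    using x unfolding edge_shift_def in_closure_of by blast
  from this[THEN spec[of _ ?U], THEN mp, OF conjI[OF xU U]]
  obtain y where y: "y \<in> infinite_paths G" "inf_seq y \<in> ?U"
    by blast
  then have "y i = x i" "y (Suc i) = x (Suc i)" by (simp_all add: inf_seq_def)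
  moreover have "y i \<in> arcs G \<and> head G (y i) = tail G (y (Suc i))"
    using y(1) unfolding infinite_paths_def by blast
  ultimately show "x i \<in> arcs G \<and> head G (x i) = tail G (x (Suc i))"
    by simp
qed

lemma Cons_infinite_path:
  "e \<in> arcs G \<Longrightarrow> x \<in> infinite_paths G \<Longrightarrow> head G e = tail G (x 0) \<Longrightarrow> case_nat e x \<in> infinite_paths G"
  by (auto simp: infinite_paths_def split: nat.splits)

lemma map_case_nat_upt:
  "map (case_nat e x) [Suc i..<Suc j] = map x [i..<j]"
  by (simp only: map_Suc_upt[symmetric] map_map o_def nat.case)

lemma (in directed_graph) infinite_path_segment:
  "x \<in> infinite_paths G \<Longrightarrow> map x [i..<i + k] \<in> paths_from G (tail G (x i)) k"
proof (induction k arbitrary: i)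
  case 0
  then show ?case by (simp add: paths_from_0 infinite_paths_def)
next
  case (Suc k)
  then have "map x [Suc i..<Suc i + k] \<in> paths_from G (head G (x i)) k" "x i \<in> out_arcs G (tail G (x i))"
    using Suc.IH[of "Suc i"] by (auto simp: infinite_paths_def simp del: upt_Suc)
  moreover have "[i..<i + Suc k] = i # [Suc i..<Suc i + k]"
    by (simp add: upt_conv_Cons del: upt_Suc)
  ultimately show ?case
    by (simp only: list.map Cons_in_paths_from)
qed

section \<open>Finite paths as prefixes of infinite ones\<close>

context row_finite_graph
begin

lemma infinite_path_from:
  assumes v: "v \<in> verts G" shows "\<exists>x\<in>infinite_paths G. tail G (x 0) = v"
proof -
  have "\<exists>e. e \<in> out_arcs G v" if "v \<in> verts G" for v
    using no_sinks that unfolding sink_def by blast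
  then obtain nxt where nxt: "\<And>v. v \<in> verts G \<Longrightarrow> nxt v \<in> out_arcs G v" by metis
  define x where "x = rec_nat (nxt v) (\<lambda>_ e. nxt (head G e))"
  have x: "x 0 = nxt v" "x (Suc i) = nxt (head G (x i))" for i by (simp_all add: x_def)
  have arc: "x i \<in> arcs G" for i
    by (induction i) (use nxt v in \<open>auto simp: x\<close>)
  moreover have "tail G (x (Suc i)) = head G (x i)" for i
    using nxt[of "head G (x i)"] arc[of i] by (simp add: x)
  moreover have "tail G (x 0) = v" using nxt[OF v] by (simp add: x)
  ultimately show ?thesis unfolding infinite_paths_def by (intro bexI[of _ x]) auto
qed

text \<open>Block codes are specified along infinite paths. In the absence of sinks this lemma
  carries their properties down to finite blocks.\<close>

lemma extend_to_infinite_path: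
  "p \<in> paths_from G v k \<Longrightarrow> \<exists>x\<in>infinite_paths G. map x [0..<k] = p \<and> tail G (x 0) = v"
proof (induction k arbitrary: p v)
  case 0
  then show ?case
    using infinite_path_from[of v] length_paths_from[of p v 0] paths_from_vertex[of p v 0] by auto
next
  case (Suc k)
  then obtain e q where p: "p = e # q" "e \<in> out_arcs G v" "q \<in> paths_from G (head G e) k"
    unfolding paths_from_Suc by blast
  obtain x where x: "x \<in> infinite_paths G" "map x [0..<k] = q" "tail G (x 0) = head G e"
    using Suc.IH[OF p(3)] by blast
  have "map (case_nat e x) [0..<Suc k] = p"
    using p(1) x(2) by (simp add: map_upt_Suc del: upt_Suc)
  then show ?case
    using Cons_infinite_path[of e G x] p x by (intro bexI[of _ "case_nat e x"]) auto
qed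

end

section \<open>Combinatorics of a 1-block conjugacy with bounded inverse\<close>

text \<open>The combinatorial content of the conjugacy: everything is said on infinite paths, and
  \<open>\<Psi>\<close> acts on single edges instead of lists of length 1.\<close>

locale block_conjugacy = E: row_finite_graph E + F: row_finite_graph F
  for E :: "('v, 'e) pre_digraph" and F :: "('w, 'f) pre_digraph" +
  fixes \<Psi> :: "'f \<Rightarrow> 'e" and \<Phi> :: "'e list \<Rightarrow> 'f" and n :: nat
  assumes n_pos: "n \<ge> 1"
    and \<Psi>_path: "y \<in> infinite_paths F \<Longrightarrow> (\<lambda>i. \<Psi> (y i)) \<in> infinite_paths E"
    and \<Phi>_path: "x \<in> infinite_paths E \<Longrightarrow> (\<lambda>i. \<Phi> (map x [i..<i + n])) \<in> infinite_paths F"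
    and \<Psi>_\<Phi>: "x \<in> infinite_paths E \<Longrightarrow> \<Psi> (\<Phi> (map x [i..<i + n])) = x i"
    and \<Phi>_\<Psi>: "y \<in> infinite_paths F \<Longrightarrow> \<Phi> (map (\<lambda>i. \<Psi> (y i)) [i..<i + n]) = y i"
begin

lemma \<Psi>_arc:
  assumes g: "g \<in> arcs F" shows "\<Psi> g \<in> arcs E"
proof -
  have path: "[g] \<in> paths_from F (tail F g) (Suc 0)"
    using g by (simp add: F.Cons_in_paths_from F.paths_from_0)
  then obtain y where y: "y \<in> infinite_paths F" "map y [0..<Suc 0] = [g]"
    using F.extend_to_infinite_path[OF path] by (elim bexE conjE) (rule that)
  have "\<Psi> (y 0) \<in> arcs E" using \<Psi>_path[OF y(1)] unfolding infinite_paths_def by blast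
  with y(2) show ?thesis by simp
qed

lemma \<Phi>_arc:
  assumes "\<beta> \<in> paths_from E v n"
  shows "\<Phi> \<beta> \<in> arcs F" "\<Psi> (\<Phi> \<beta>) = hd \<beta>" "tail E (hd \<beta>) = v" "hd \<beta> \<in> arcs E"
proof -
  obtain x where x: "x \<in> infinite_paths E" "map x [0..<n] = \<beta>" "tail E (x 0) = v"
    using E.extend_to_infinite_path[OF assms] by blast
  have hd: "hd \<beta> = x 0" using x(2)[symmetric] n_pos by (simp add: hd_map)
  have "\<Phi> (map x [0..<0 + n]) \<in> arcs F" using \<Phi>_path[OF x(1)] unfolding infinite_paths_def by blast
  then show "\<Phi> \<beta> \<in> arcs F" using x(2) by simp
  show "\<Psi> (\<Phi> \<beta>) = hd \<beta>" using \<Psi>_\<Phi>[OF x(1), of 0] x(2) hd by simp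
  show "tail E (hd \<beta>) = v" using x hd by simp
  show "hd \<beta> \<in> arcs E" using x(1) hd by (simp add: infinite_paths_def)
qed

lemma \<Phi>_map_\<Psi>:
  assumes "\<gamma> \<in> paths_from F w n" shows "\<Phi> (map \<Psi> \<gamma>) = hd \<gamma>"
proof -
  obtain y where y: "y \<in> infinite_paths F" "map y [0..<n] = \<gamma>"
    using F.extend_to_infinite_path[OF assms] by blast
  have "map \<Psi> \<gamma> = map (\<lambda>i. \<Psi> (y i)) [0..<0 + n]" using y(2)[symmetric] by simp
  moreover have "hd \<gamma> = y 0" using y(2)[symmetric] n_pos by (simp add: hd_map)
  ultimately show ?thesis using \<Phi>_\<Psi>[OF y(1), of 0] by simp
qed

lemma head_\<Psi>:
  assumes "g \<in> arcs F" "h \<in> arcs F" "head F g = tail F h"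
  shows "head E (\<Psi> g) = tail E (\<Psi> h)"
proof -
  have path: "[g, h] \<in> paths_from F (tail F g) (Suc (Suc 0))"
    using assms by (simp add: F.Cons_in_paths_from F.paths_from_0)
  then obtain y where "y \<in> infinite_paths F" "map y [0..<Suc (Suc 0)] = [g, h]"
    using F.extend_to_infinite_path[OF path] by (elim bexE conjE) (rule that)
  then show ?thesis using \<Psi>_path[of y] by (auto simp: infinite_paths_def)
qed

text \<open>Uniqueness of backward lifts. Prefix both edges to one infinite path: the two images
  under \<Psi> coincide, and \<Phi> reads the first edge off the image.\<close>

lemma \<Psi>_right_resolving:
  assumes "g \<in> arcs F" "h \<in> arcs F" "head F g = head F h" "\<Psi> g = \<Psi> h"
  shows "g = h"
proof -
  obtain y where y: "y \<in> infinite_paths F" "tail F (y 0) = head F g"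
    using F.infinite_path_from[of "head F g"] assms by auto
  have "\<Phi> (map (\<lambda>i. \<Psi> (case_nat k y i)) [0..<0 + n]) = k" if "k \<in> {g, h}" for k
    using \<Phi>_\<Psi>[OF Cons_infinite_path[of k F y], of 0] y that assms by auto
  moreover have "(\<lambda>i. \<Psi> (case_nat g y i)) = (\<lambda>i. \<Psi> (case_nat h y i))"
    using assms(4) by (auto split: nat.splits)
  ultimately show ?thesis by (metis insertCI)
qed

lemma code_case_nat:
  "\<Phi> (map (case_nat e x) [Suc i..<Suc i + n]) = \<Phi> (map x [i..<i + n])"
  using map_case_nat_upt[of e x i "i + n"] by simp

text \<open>The source of \<open>butlast\<close>: prefixing an edge pushes the last edge out of the
  window of length \<open>n\<close>.\<close>

lemma map_case_nat_prefix:
  "map (case_nat e x) [0..<n] = e # butlast (map x [0..<n])"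
proof -
  obtain m where n: "n = Suc m" using n_pos by (cases n) auto
  have "map (case_nat e x) [0..<Suc m] = e # map x [0..<m]"
    by (simp add: map_upt_Suc del: upt_Suc)
  moreover have "butlast (map x [0..<Suc m]) = map x [0..<m]" by simp
  ultimately show ?thesis by (simp only: n)
qed

text \<open>Existence of backward lifts. Prefix \<open>e\<close> to the image of an infinite path
  that starts with \<open>h\<close> and decode with \<Phi>: the first window yields the lift of
  \<open>e\<close>, and the second, which no longer sees \<open>e\<close>, yields
  \<open>h\<close>.\<close>

lemma ex_predecessor:
  assumes h: "h \<in> arcs F" and e: "e \<in> arcs E" and "head E e = tail E (\<Psi> h)"
  shows "\<exists>g\<in>arcs F. \<Psi> g = e \<and> head F g = tail F h"
proof -
  have path: "[h] \<in> paths_from F (tail F h) (Suc 0)"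
    using h by (simp add: F.Cons_in_paths_from F.paths_from_0)
  then obtain y where y: "y \<in> infinite_paths F" "map y [0..<Suc 0] = [h]"
    using F.extend_to_infinite_path[OF path] by (elim bexE conjE) (rule that)
  then have y0: "y 0 = h" by simp
  let ?z = "case_nat e (\<lambda>i. \<Psi> (y i))"
  have z: "?z \<in> infinite_paths E"
    using assms y(1) y0 by (intro Cons_infinite_path \<Psi>_path) auto
  let ?g = "\<Phi> (map ?z [0..<0 + n])"
  have "\<Psi> ?g = e" using \<Psi>_\<Phi>[OF z, of 0] by simp
  moreover have "?g \<in> arcs F" "head F ?g = tail F (\<Phi> (map ?z [Suc 0..<Suc 0 + n]))"
    using \<Phi>_path[OF z] unfolding infinite_paths_def by blast+
  moreover have "\<Phi> (map ?z [Suc 0..<Suc 0 + n]) = h"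
    unfolding code_case_nat using \<Phi>_\<Psi>[OF y(1), of 0] y0 by simp
  ultimately show ?thesis by metis
qed

text \<open>This will become CK1 for the inverse family. From left to right, decode \<Psi>(g)
  followed by an extension of \<beta>: the first two edges are \<open>g\<close> and \<Phi>(\<beta>),
  hence adjacent. Conversely, if they are adjacent, \<open>g\<close> followed by the decoded
  extension is a path of F, its image is \<Psi>(g) followed by that extension, and decoding this
  image returns \<open>g\<close>.\<close>

lemma successor_blocks:
  assumes g: "g \<in> arcs F"
  shows "{\<beta> \<in> paths_from E (head E (\<Psi> g)) n. \<Phi> (\<Psi> g # butlast \<beta>) = g}
    = {\<beta>. (\<exists>v. \<beta> \<in> paths_from E v n) \<and> tail F (\<Phi> \<beta>) = head F g}"
proof (intro subset_antisym subsetI)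
  fix \<beta> assume \<beta>: "\<beta> \<in> {\<beta> \<in> paths_from E (head E (\<Psi> g)) n. \<Phi> (\<Psi> g # butlast \<beta>) = g}"
  then obtain x where x: "x \<in> infinite_paths E" "map x [0..<n] = \<beta>" "tail E (x 0) = head E (\<Psi> g)"
    using E.extend_to_infinite_path by blast
  have z: "case_nat (\<Psi> g) x \<in> infinite_paths E"
    using x \<Psi>_arc[OF g] by (intro Cons_infinite_path) auto
  have "head F (\<Phi> (map (case_nat (\<Psi> g) x) [0..<0 + n]))
      = tail F (\<Phi> (map (case_nat (\<Psi> g) x) [Suc 0..<Suc 0 + n]))"
    using \<Phi>_path[OF z] unfolding infinite_paths_def by blast
  moreover have "\<Phi> (map (case_nat (\<Psi> g) x) [0..<0 + n]) = g"
    using \<beta> x(2) by (simp add: map_case_nat_prefix)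
  ultimately have "tail F (\<Phi> \<beta>) = head F g"
    unfolding code_case_nat using x(2) by simp
  with \<beta> show "\<beta> \<in> {\<beta>. (\<exists>v. \<beta> \<in> paths_from E v n) \<and> tail F (\<Phi> \<beta>) = head F g}" by blast
next
  fix \<beta> assume "\<beta> \<in> {\<beta>. (\<exists>v. \<beta> \<in> paths_from E v n) \<and> tail F (\<Phi> \<beta>) = head F g}"
  then obtain v where \<beta>: "\<beta> \<in> paths_from E v n" "tail F (\<Phi> \<beta>) = head F g" by blast
  then obtain x where x: "x \<in> infinite_paths E" "map x [0..<n] = \<beta>" "tail E (x 0) = v"
    using E.extend_to_infinite_path by blast
  let ?y = "\<lambda>i. \<Phi> (map x [i..<i + n])"
  have y: "case_nat g ?y \<in> infinite_paths F"
    using x \<beta> g by (intro Cons_infinite_path \<Phi>_path) auto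
  have eq: "(\<lambda>i. \<Psi> (case_nat g ?y i)) = case_nat (\<Psi> g) x"
    using \<Psi>_\<Phi>[OF x(1)] by (auto split: nat.splits)
  have "\<Phi> (\<Psi> g # butlast \<beta>) = g"
    using \<Phi>_\<Psi>[OF y, of 0] unfolding eq using x(2) by (simp add: map_case_nat_prefix)
  moreover have "head E (\<Psi> g) = v"
    using \<Psi>_path[OF y] x(3) unfolding eq infinite_paths_def by (auto dest: spec[of _ 0])
  ultimately show "\<beta> \<in> {\<beta> \<in> paths_from E (head E (\<Psi> g)) n. \<Phi> (\<Psi> g # butlast \<beta>) = g}"
    using \<beta> by simp
qed

text \<open>The index sets of the theorem, expressed through \<Psi> instead of through the existence
  of a block; \<open>edge_fiber_eq\<close> and \<open>vertex_fiber_eq\<close> translate.\<close>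

definition edge_fiber :: "'e \<Rightarrow> 'f set" where
  "edge_fiber e = {g \<in> arcs F. \<Psi> g = e}"

definition vertex_fiber :: "'v \<Rightarrow> 'f set" where
  "vertex_fiber v = {g \<in> arcs F. tail E (\<Psi> g) = v}"

definition block_fiber :: "'f \<Rightarrow> 'e list set" where
  "block_fiber g = {\<beta> \<in> paths_from E (tail E (\<Psi> g)) n. \<Phi> \<beta> = g}"

text \<open>The start vertex is quantified because it need not be determined by \<open>w\<close>: if
  no edge enters \<open>w\<close>, the edges leaving \<open>w\<close> may have images with different
  tails.\<close>

definition blocks_at :: "'w \<Rightarrow> 'e list set" where
  "blocks_at w = {\<beta>. (\<exists>v. \<beta> \<in> paths_from E v n) \<and> tail F (\<Phi> \<beta>) = w}"

lemma Suc_n: "Suc (n - 1) = n"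
  using n_pos by simp

text \<open>Code an infinite path through \<open>g\<close> by \<Psi>; its first block decodes to
  \<open>g\<close>.\<close>

lemma ex_block:
  assumes g: "g \<in> arcs F" shows "\<exists>\<beta>\<in>paths_from E (tail E (\<Psi> g)) n. \<Phi> \<beta> = g"
proof -
  have path: "[g] \<in> paths_from F (tail F g) (Suc 0)"
    using g by (simp add: F.Cons_in_paths_from F.paths_from_0)
  then obtain y where y: "y \<in> infinite_paths F" "map y [0..<Suc 0] = [g]"
    using F.extend_to_infinite_path[OF path] by (elim bexE conjE) (rule that)
  have "map (\<lambda>i. \<Psi> (y i)) [0..<0 + n] \<in> paths_from E (tail E (\<Psi> (y 0))) n"
    by (rule E.infinite_path_segment[OF \<Psi>_path[OF y(1)]])
  moreover have "\<Phi> (map (\<lambda>i. \<Psi> (y i)) [0..<0 + n]) = y 0" by (rule \<Phi>_\<Psi>[OF y(1)])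
  moreover have "y 0 = g" using y(2) by simp
  ultimately show ?thesis by (intro bexI) simp_all
qed

lemma vertex_fiber_eq: "vertex_fiber v = {g \<in> arcs F. \<exists>\<beta>\<in>paths_from E v n. \<Phi> \<beta> = g}"
  unfolding vertex_fiber_def using ex_block \<Phi>_arc(2,3) by fastforce

lemma edge_fiber_eq:
  assumes "e \<in> arcs E"
  shows "edge_fiber e = {g \<in> arcs F. \<exists>\<alpha>\<in>paths_from E (head E e) (n - 1). \<Phi> (e # \<alpha>) = g}"
proof (intro subset_antisym subsetI)
  fix g assume "g \<in> edge_fiber e"
  then have g: "g \<in> arcs F" "\<Psi> g = e" by (auto simp: edge_fiber_def)
  then obtain \<beta> where \<beta>: "\<beta> \<in> paths_from E (tail E e) (Suc (n - 1))" "\<Phi> \<beta> = g"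
    using ex_block[of g] Suc_n by auto
  then obtain f \<alpha> where f: "\<beta> = f # \<alpha>" "\<alpha> \<in> paths_from E (head E f) (n - 1)"
    unfolding E.paths_from_Suc by blast
  have "f = e" using \<Phi>_arc(2)[of \<beta> "tail E e"] \<beta> f(1) g(2) Suc_n by simp
  then show "g \<in> {g \<in> arcs F. \<exists>\<alpha>\<in>paths_from E (head E e) (n - 1). \<Phi> (e # \<alpha>) = g}"
    using f \<beta>(2) g(1) by blast
next
  fix g assume "g \<in> {g \<in> arcs F. \<exists>\<alpha>\<in>paths_from E (head E e) (n - 1). \<Phi> (e # \<alpha>) = g}"
  then obtain \<alpha> where \<alpha>: "g \<in> arcs F" "\<alpha> \<in> paths_from E (head E e) (n - 1)" "\<Phi> (e # \<alpha>) = g" by blast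
  then have "e # \<alpha> \<in> paths_from E (tail E e) n"
    using assms E.Cons_in_paths_from[of e \<alpha> "tail E e" "n - 1"] Suc_n by simp
  then show "g \<in> edge_fiber e"
    using \<Phi>_arc(2) \<alpha> by (force simp: edge_fiber_def)
qed

lemma finite_vertex_fiber[simp]: "finite (vertex_fiber v)"
  by (rule finite_subset[of _ "\<Phi> ` paths_from E v n"]) (auto simp: vertex_fiber_eq)

lemma edge_fiber_subset: "edge_fiber e \<subseteq> vertex_fiber (tail E e)"
  by (auto simp: edge_fiber_def vertex_fiber_def)

lemma finite_edge_fiber[simp]: "finite (edge_fiber e)"
  using edge_fiber_subset finite_vertex_fiber by (rule finite_subset)

lemma head_inj_on_edge_fiber:
  "g \<in> edge_fiber e \<Longrightarrow> h \<in> edge_fiber e \<Longrightarrow> g \<noteq> h \<Longrightarrow> head F g \<noteq> head F h"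
  using \<Psi>_right_resolving by (auto simp: edge_fiber_def)

text \<open>By \<open>head_inj_on_edge_fiber\<close> the union is disjoint. Together they express
  that backward lifts exist and are unique, in the form that CK1 for the sums over fibers
  needs.\<close>

lemma out_arcs_edge_fiber:
  assumes "e \<in> arcs E"
  shows "(\<Union>g\<in>edge_fiber e. out_arcs F (head F g)) = vertex_fiber (head E e)"
proof (intro subset_antisym subsetI)
  fix h assume "h \<in> (\<Union>g\<in>edge_fiber e. out_arcs F (head F g))"
  then show "h \<in> vertex_fiber (head E e)"
    using head_\<Psi> by (fastforce simp: edge_fiber_def vertex_fiber_def)
next
  fix h assume "h \<in> vertex_fiber (head E e)"
  then have h: "h \<in> arcs F" "head E e = tail E (\<Psi> h)" by (auto simp: vertex_fiber_def)
  then obtain g where "g \<in> arcs F" "\<Psi> g = e" "head F g = tail F h"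
    using ex_predecessor[OF h(1) assms h(2)] by blast
  with h(1) show "h \<in> (\<Union>g\<in>edge_fiber e. out_arcs F (head F g))"
    by (auto simp: edge_fiber_def)
qed

lemma UN_edge_fiber: "(\<Union>e\<in>out_arcs E v. edge_fiber e) = vertex_fiber v"
  using \<Psi>_arc by (auto simp: edge_fiber_def vertex_fiber_def)

lemma finite_block_fiber[simp]: "finite (block_fiber g)"
  by (rule finite_subset[of _ "paths_from E (tail E (\<Psi> g)) n"]) (auto simp: block_fiber_def)

lemma UN_block_fiber: "(\<Union>g\<in>out_arcs F w. block_fiber g) = blocks_at w"
proof (intro subset_antisym subsetI)
  fix \<beta> assume "\<beta> \<in> blocks_at w"
  then obtain v where \<beta>: "\<beta> \<in> paths_from E v n" "tail F (\<Phi> \<beta>) = w"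
    by (auto simp: blocks_at_def)
  then have "\<Phi> \<beta> \<in> out_arcs F w" "tail E (\<Psi> (\<Phi> \<beta>)) = v" using \<Phi>_arc[OF \<beta>(1)] by auto
  then show "\<beta> \<in> (\<Union>g\<in>out_arcs F w. block_fiber g)"
    using \<beta>(1) unfolding block_fiber_def by blast
qed (auto simp: block_fiber_def blocks_at_def)

lemma finite_blocks_at[simp]: "w \<in> verts F \<Longrightarrow> finite (blocks_at w)"
  unfolding UN_block_fiber[symmetric] by simp

lemma block_fiber_Cons:
  assumes "g \<in> arcs F"
  shows "block_fiber g = (#) (\<Psi> g) ` {\<alpha> \<in> paths_from E (head E (\<Psi> g)) (n - 1). \<Phi> (\<Psi> g # \<alpha>) = g}"
proof (intro subset_antisym subsetI)
  fix \<beta> assume "\<beta> \<in> block_fiber g"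
  then have \<beta>: "\<beta> \<in> paths_from E (tail E (\<Psi> g)) (Suc (n - 1))" "\<Phi> \<beta> = g"
    unfolding Suc_n block_fiber_def by auto
  then obtain f \<alpha> where f: "\<beta> = f # \<alpha>" "\<alpha> \<in> paths_from E (head E f) (n - 1)"
    unfolding E.paths_from_Suc by blast
  have "f = \<Psi> g" using \<Phi>_arc(2)[of \<beta> "tail E (\<Psi> g)"] \<beta> f(1) Suc_n by simp
  then show "\<beta> \<in> (#) (\<Psi> g) ` {\<alpha> \<in> paths_from E (head E (\<Psi> g)) (n - 1). \<Phi> (\<Psi> g # \<alpha>) = g}"
    using f \<beta>(2) by blast
next
  fix \<beta> assume "\<beta> \<in> (#) (\<Psi> g) ` {\<alpha> \<in> paths_from E (head E (\<Psi> g)) (n - 1). \<Phi> (\<Psi> g # \<alpha>) = g}"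
  then obtain \<alpha> where \<alpha>: "\<beta> = \<Psi> g # \<alpha>" "\<alpha> \<in> paths_from E (head E (\<Psi> g)) (n - 1)" "\<Phi> (\<Psi> g # \<alpha>) = g"
    by blast
  then have "\<beta> \<in> paths_from E (tail E (\<Psi> g)) n"
    using \<Psi>_arc[OF assms] E.Cons_in_paths_from[of "\<Psi> g" \<alpha> "tail E (\<Psi> g)" "n - 1"] Suc_n by simp
  with \<alpha> show "\<beta> \<in> block_fiber g" by (simp add: block_fiber_def)
qed

end

section \<open>The Cuntz-Krieger family of the image graph\<close>

locale conjugacy_domain_family = block_conjugacy E F \<Psi> \<Phi> n + ck_family D F t q
  for E :: "('v, 'e) pre_digraph" and F :: "('w, 'f) pre_digraph"
    and \<Psi> :: "'f \<Rightarrow> 'e" and \<Phi> :: "'e list \<Rightarrow> 'f" and n :: nat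
    and D :: "'b cstar" (structure) and t :: "'f \<Rightarrow> 'b" and q :: "'w \<Rightarrow> 'b"
begin

definition S' :: "'e \<Rightarrow> 'b" where
  "S' e = (\<Oplus>g\<in>edge_fiber e. t g)"

definition P' :: "'v \<Rightarrow> 'b" where
  "P' v = (\<Oplus>g\<in>vertex_fiber v. t g \<otimes> adj D (t g))"

lemma fiber_arcs: "g \<in> edge_fiber e \<Longrightarrow> g \<in> arcs F" "g \<in> vertex_fiber v \<Longrightarrow> g \<in> arcs F"
  by (auto simp: edge_fiber_def vertex_fiber_def)

lemma S'_closed[simp]: "S' e \<in> carrier D"
  unfolding S'_def by (intro finsum_closed) (auto simp: fiber_arcs)

lemma range_closed[simp]: "g \<in> arcs F \<Longrightarrow> t g \<otimes> adj D (t g) \<in> carrier D"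
  by (simp add: mult_closed)

lemma P'_projection: "projection D (P' v)"
  unfolding P'_def
  by (rule projection_finsum) (auto intro: projection_S_adj_S range_projection_products fiber_arcs)

lemma P'_orthogonal:
  assumes "v \<noteq> w" shows "P' v \<otimes> P' w = \<zero>"
proof -
  have disj: "vertex_fiber v \<inter> vertex_fiber w = {}"
    using assms by (auto simp: vertex_fiber_def)
  have "P' v \<otimes> P' w = (\<Oplus>g\<in>vertex_fiber v \<inter> vertex_fiber w. t g \<otimes> adj D (t g) \<otimes> (t g \<otimes> adj D (t g)))"
    unfolding P'_def
    by (rule finsum_mult_finsum) (auto intro: range_projection_products range_closed fiber_arcs)
  then show ?thesis by (simp add: disj)
qed

lemma adj_S': "adj D (S' e) = (\<Oplus>g\<in>edge_fiber e. adj D (t g))"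
  unfolding S'_def by (rule adj_finsum) (auto simp: fiber_arcs)

text \<open>Off-diagonal terms vanish since distinct edges have orthogonal ranges. CK1 turns each
  diagonal term into a vertex projection of F, CK2 expands it, and
  \<open>out_arcs_edge_fiber\<close> collects the result.\<close>

lemma adj_S'_S':
  assumes e: "e \<in> arcs E" shows "adj D (S' e) \<otimes> S' e = P' (head E e)"
proof -
  have "adj D (S' e) \<otimes> S' e = (\<Oplus>g\<in>edge_fiber e \<inter> edge_fiber e. adj D (t g) \<otimes> t g)"
    unfolding adj_S' unfolding S'_def
    by (rule finsum_mult_finsum) (auto intro: adj_S_S_orthogonal simp: fiber_arcs)
  also have "\<dots> = (\<Oplus>g\<in>edge_fiber e. \<Oplus>h\<in>out_arcs F (head F g). t h \<otimes> adj D (t h))"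
  proof (rule finsum_cong')
    show "adj D (t g) \<otimes> t g = (\<Oplus>h\<in>out_arcs F (head F g). t h \<otimes> adj D (t h))" if "g \<in> edge_fiber e" for g
      using that by (simp add: adj_S_S P_sum fiber_arcs)
  qed (auto intro!: finsum_closed)
  also have "\<dots> = (\<Oplus>h\<in>(\<Union>g\<in>edge_fiber e. out_arcs F (head F g)). t h \<otimes> adj D (t h))"
    using head_inj_on_edge_fiber by (intro finsum_UN_disjoint) (auto simp: fiber_arcs)
  finally show ?thesis
    unfolding out_arcs_edge_fiber[OF e] P'_def .
qed

text \<open>Here the cross terms vanish for another reason: edges in one fiber have different heads,
  so their source projections are orthogonal.\<close>

lemma S'_adj_S': "S' e \<otimes> adj D (S' e) = (\<Oplus>g\<in>edge_fiber e. t g \<otimes> adj D (t g))"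
proof -
  have "t g \<otimes> adj D (t h) = \<zero>" if gh: "g \<in> edge_fiber e" "h \<in> edge_fiber e" "g \<noteq> h" for g h
  proof -
    have arcs: "g \<in> arcs F" "h \<in> arcs F" using gh by (auto simp: fiber_arcs)
    have "t g \<otimes> adj D (t h) = (t g \<otimes> q (head F g)) \<otimes> (q (head F h) \<otimes> adj D (t h))"
      using arcs by (simp add: S_P_head P_head_adj_S)
    also have "\<dots> = t g \<otimes> (q (head F g) \<otimes> q (head F h)) \<otimes> adj D (t h)"
      using arcs by (simp add: mult_assoc mult_closed)
    also have "q (head F g) \<otimes> q (head F h) = \<zero>"
      using arcs head_inj_on_edge_fiber[OF gh] by (intro P_orthogonal) auto
    finally show ?thesis using arcs by (simp add: mult_zero zero_mult)
  qed
  then have "S' e \<otimes> adj D (S' e) = (\<Oplus>g\<in>edge_fiber e \<inter> edge_fiber e. t g \<otimes> adj D (t g))"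
    unfolding adj_S' unfolding S'_def by (intro finsum_mult_finsum) (auto simp: fiber_arcs)
  then show ?thesis by simp
qed

lemma P'_sum:
  assumes "v \<in> verts E" shows "P' v = (\<Oplus>e\<in>out_arcs E v. S' e \<otimes> adj D (S' e))"
proof -
  have disj: "edge_fiber e \<inter> edge_fiber f = {}" if "e \<noteq> f" for e f
    using that by (auto simp: edge_fiber_def)
  have "(\<Oplus>e\<in>out_arcs E v. S' e \<otimes> adj D (S' e))
      = (\<Oplus>g\<in>(\<Union>e\<in>out_arcs E v. edge_fiber e). t g \<otimes> adj D (t g))"
    unfolding S'_adj_S' using assms disj by (intro finsum_UN_disjoint) (auto simp: fiber_arcs)
  then show ?thesis unfolding UN_edge_fiber P'_def by simp
qed

lemma induced_CK_family: "CK_family E D S' P'"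
  unfolding CK_family_def
proof (intro conjI ballI impI)
  show "partial_isometry D (S' e)" if "e \<in> arcs E" for e
    using that by (intro partial_isometryI) (simp_all add: adj_S'_S' P'_projection)
  show "P' v = (\<Oplus>e\<in>out_arcs E v. S' e \<otimes> adj D (S' e))" if "v \<in> verts E" for v
    using that by (rule P'_sum)
qed (auto simp: P'_projection P'_orthogonal adj_S'_S')

sublocale induced: ck_family D E S' P'
  by unfold_locales (rule induced_CK_family)

lemma adj_t_S':
  assumes h: "h \<in> arcs F"
  shows "adj D (t h) \<otimes> S' e = (if \<Psi> h = e then q (head F h) else \<zero>)"
proof -
  have "adj D (t h) \<otimes> S' e = (\<Oplus>g\<in>edge_fiber e. adj D (t h) \<otimes> t g)"
    unfolding S'_def using h by (intro finsum_mult_left) (auto simp: fiber_arcs)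
  also have "\<dots> = (if \<Psi> h = e then q (head F h) else \<zero>)"
  proof (cases "\<Psi> h = e")
    case True
    then have "h \<in> edge_fiber e" using h by (simp add: edge_fiber_def)
    then have "(\<Oplus>g\<in>edge_fiber e. adj D (t h) \<otimes> t g) = adj D (t h) \<otimes> t h"
      using h by (intro finsum_single) (auto intro: adj_S_S_orthogonal simp: mult_closed fiber_arcs)
    then show ?thesis using True h by (simp add: adj_S_S)
  next
    case False
    then show ?thesis
      using h by (auto intro!: add.finprod_one_eqI adj_S_S_orthogonal simp: edge_fiber_def)
  qed
  finally show ?thesis .
qed

text \<open>One step of lifting: \<open>adj D (t h)\<close> kills \<open>S' e\<close> unless
  \<open>h\<close> lies over \<open>e\<close>, and otherwise leaves the vertex projection at the
  head of \<open>h\<close>.\<close>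

lemma range_mult_path_projection:
  assumes h: "h \<in> arcs F" and e: "e \<in> arcs E" and \<beta>: "\<beta> \<in> paths_from E (head E e) k"
    and nz: "t h \<otimes> adj D (t h) \<otimes> path_projection E D S' P' v (e # \<beta>) \<noteq> \<zero>"
  shows "\<Psi> h = e" "q (head F h) \<otimes> path_projection E D S' P' (head E e) \<beta> \<noteq> \<zero>"
proof -
  let ?R = "path_projection E D S' P' (head E e) \<beta>"
  have R: "?R \<in> carrier D" using \<beta> by (rule induced.path_projection_simps)
  have "t h \<otimes> adj D (t h) \<otimes> path_projection E D S' P' v (e # \<beta>)
      = t h \<otimes> (adj D (t h) \<otimes> S' e \<otimes> ?R) \<otimes> adj D (S' e)"
    using h R by (simp add: mult_assoc mult_closed adj_closed)
  then have "adj D (t h) \<otimes> S' e \<otimes> ?R \<noteq> \<zero>"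
    using nz h by (auto simp: mult_zero zero_mult adj_closed)
  then show "\<Psi> h = e" "q (head F h) \<otimes> ?R \<noteq> \<zero>"
    using R h by (auto simp: adj_t_S' zero_mult split: if_splits)
qed

text \<open>By CK2, \<open>q w\<close> splits into range projections of edges; a nonzero product has
  a nonzero summand, whose edge is the first edge of the lift. Stating it with products that do not
  vanish lets the lift be found edge by edge.\<close>

lemma lift_path:
  "w \<in> verts F \<Longrightarrow> \<beta> \<in> paths_from E v k \<Longrightarrow> q w \<otimes> path_projection E D S' P' v \<beta> \<noteq> \<zero> \<Longrightarrow>
    \<exists>\<gamma>\<in>paths_from F w k. map \<Psi> \<gamma> = \<beta>"
proof (induction k arbitrary: w v \<beta>)
  case 0
  then show ?case using E.length_paths_from[of \<beta> v 0] by (auto simp: F.paths_from_0)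
next
  case (Suc k)
  let ?R = "path_projection E D S' P'"
  obtain e \<beta>' where \<beta>: "\<beta> = e # \<beta>'" "e \<in> out_arcs E v" "\<beta>' \<in> paths_from E (head E e) k"
    using Suc.prems(2) unfolding E.paths_from_Suc by blast
  have cl: "?R v \<beta> \<in> carrier D" using Suc.prems(2) by (rule induced.path_projection_simps)
  have "q w \<otimes> ?R v \<beta> = (\<Oplus>h\<in>out_arcs F w. t h \<otimes> adj D (t h) \<otimes> ?R v \<beta>)"
    unfolding P_sum[OF Suc.prems(1)] using Suc.prems(1) cl by (intro finsum_mult_right) auto
  moreover have "\<dots> = \<zero>" if "\<And>h. h \<in> out_arcs F w \<Longrightarrow> t h \<otimes> adj D (t h) \<otimes> ?R v \<beta> = \<zero>"
    using that by (rule add.finprod_one_eqI)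
  ultimately obtain h where h: "h \<in> out_arcs F w" "t h \<otimes> adj D (t h) \<otimes> ?R v \<beta> \<noteq> \<zero>"
    using Suc.prems(3) by auto
  have "\<Psi> h = e" "q (head F h) \<otimes> ?R (head E e) \<beta>' \<noteq> \<zero>"
    using range_mult_path_projection[of h e \<beta>' k v] h \<beta> by auto
  moreover obtain \<gamma> where "\<gamma> \<in> paths_from F (head F h) k" "map \<Psi> \<gamma> = \<beta>'"
    using Suc.IH[OF _ \<beta>(3) calculation(2)] h(1) by auto
  ultimately show ?case
    using h(1) \<beta>(1) by (intro bexI[of _ "h # \<gamma>"]) (auto simp: F.Cons_in_paths_from)
qed

text \<open>A nonzero product would lift \<beta> to a path of F beginning with \<open>h\<close>, and
  \<Phi> recovers the first edge of a lifted block.\<close>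

lemma range_mult_block:
  assumes h: "h \<in> arcs F" and \<beta>: "\<beta> \<in> paths_from E v n" and "\<Phi> \<beta> \<noteq> h"
  shows "t h \<otimes> adj D (t h) \<otimes> path_projection E D S' P' v \<beta> = \<zero>"
proof (rule ccontr)
  assume nz: "t h \<otimes> adj D (t h) \<otimes> path_projection E D S' P' v \<beta> \<noteq> \<zero>"
  obtain e \<beta>' where e: "\<beta> = e # \<beta>'" "e \<in> out_arcs E v" "\<beta>' \<in> paths_from E (head E e) (n - 1)"
    using \<beta> E.paths_from_Suc[of v "n - 1"] unfolding Suc_n by blast
  have he: "\<Psi> h = e" "q (head F h) \<otimes> path_projection E D S' P' (head E e) \<beta>' \<noteq> \<zero>"
    using range_mult_path_projection[OF h _ e(3), of v] e(1,2) nz by auto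
  obtain \<gamma> where \<gamma>: "\<gamma> \<in> paths_from F (head F h) (n - 1)" "map \<Psi> \<gamma> = \<beta>'"
    using lift_path[OF _ e(3) he(2)] h by auto
  have "h # \<gamma> \<in> paths_from F (tail F h) n"
    using F.Cons_in_paths_from[of h \<gamma> "tail F h" "n - 1"] \<gamma> h Suc_n by simp
  then have "\<Phi> \<beta> = h"
    using \<Phi>_map_\<Psi>[of "h # \<gamma>"] \<gamma>(2) e(1) he(1) by simp
  with assms(3) show False ..
qed

text \<open>For \<open>h\<close> in the fiber of a vertex, both families of projections sum to \<open>P'\<close>, and members with
  different indices are orthogonal; hence the families coincide.\<close>

lemma finsum_block_fiber:
  assumes h: "h \<in> arcs F"
  shows "(\<Oplus>\<beta>\<in>block_fiber h. path_projection E D S' P' (tail E (\<Psi> h)) \<beta>) = t h \<otimes> adj D (t h)"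
proof -
  define v where "v = tail E (\<Psi> h)"
  define a where "a g = t g \<otimes> adj D (t g)" for g
  let ?R = "path_projection E D S' P' v"
  define b where "b = (\<Oplus>\<beta>\<in>block_fiber h. ?R \<beta>)"
  have v: "v \<in> verts E" using \<Psi>_arc[OF h] by (simp add: v_def)
  have hv: "h \<in> vertex_fiber v" using h by (simp add: vertex_fiber_def v_def)
  have a: "a g \<in> carrier D" if "g \<in> arcs F" for g using that by (simp add: a_def)
  have R: "?R \<beta> \<in> carrier D" if "\<beta> \<in> paths_from E v n" for \<beta>
    using that by (rule induced.path_projection_simps)
  have sub: "block_fiber h \<subseteq> paths_from E v n" by (auto simp: block_fiber_def v_def)
  have b: "b \<in> carrier D" using R sub by (auto simp: b_def intro!: finsum_closed)
  have P': "P' v = (\<Oplus>g\<in>vertex_fiber v. a g)" by (simp add: P'_def a_def)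
  have ab: "a g \<otimes> b = (\<Oplus>\<beta>\<in>block_fiber h. a g \<otimes> ?R \<beta>)" if "g \<in> arcs F" for g
    unfolding b_def using that a R sub by (intro finsum_mult_left) auto
  \<comment> \<open>Both \<open>a h\<close> and \<open>b\<close> are shown to equal
    \<open>a h \<otimes> b\<close>: this chain expands \<open>P' v\<close> over blocks, the next one
    expands it over edges.\<close>
  have "a h = a h \<otimes> P' v"
  proof -
    have "a h \<otimes> P' v = (\<Oplus>g\<in>vertex_fiber v. a h \<otimes> a g)"
      unfolding P' using a h by (intro finsum_mult_left) (auto simp: fiber_arcs)
    also have "\<dots> = a h \<otimes> a h"
      using hv h a range_projection_products[OF h]
      by (intro finsum_single) (auto simp: a_def fiber_arcs mult_closed)
    also have "\<dots> = a h" using projection_S_adj_S[OF h] by (simp add: a_def projection_def)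
    finally show ?thesis by simp
  qed
  also have "\<dots> = a h \<otimes> (\<Oplus>\<beta>\<in>paths_from E v n. ?R \<beta>)"
    by (simp only: induced.finsum_path_projection[OF v])
  also have "\<dots> = (\<Oplus>\<beta>\<in>paths_from E v n. a h \<otimes> ?R \<beta>)"
    using a[OF h] R by (intro finsum_mult_left) auto
  also have "\<dots> = (\<Oplus>\<beta>\<in>block_fiber h. a h \<otimes> ?R \<beta>)"
  proof (rule finsum_filter)
    show "a h \<otimes> ?R \<beta> = \<zero>" if "\<beta> \<in> paths_from E v n - block_fiber h" for \<beta>
      unfolding a_def using that h by (intro range_mult_block) (auto simp: block_fiber_def v_def)
  qed (use sub R a[OF h] in \<open>auto simp: mult_closed\<close>)
  also have "\<dots> = a h \<otimes> b" using ab[OF h] by simp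
  finally have 1: "a h = a h \<otimes> b" .
  have "b = P' v \<otimes> b"
  proof -
    have "P' v \<otimes> b = (\<Oplus>\<beta>\<in>block_fiber h. P' v \<otimes> ?R \<beta>)"
      unfolding b_def using R sub v by (intro finsum_mult_left) auto
    also have "\<dots> = b"
      unfolding b_def using R sub induced.path_projection_simps(4) by (intro finsum_cong') auto
    finally show ?thesis by simp
  qed
  also have "\<dots> = (\<Oplus>g\<in>vertex_fiber v. a g \<otimes> b)"
    unfolding P' using a b by (intro finsum_mult_right) (auto simp: fiber_arcs)
  also have "\<dots> = a h \<otimes> b"
  proof (rule finsum_single)
    show "a g \<otimes> b = \<zero>" if "g \<in> vertex_fiber v" "g \<noteq> h" for g
      unfolding ab[OF fiber_arcs(2)[OF that(1)]]
    proof (rule add.finprod_one_eqI)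
      show "a g \<otimes> ?R \<beta> = \<zero>" if \<beta>: "\<beta> \<in> block_fiber h" for \<beta>
        unfolding a_def using \<beta> \<open>g \<noteq> h\<close> sub fiber_arcs(2)[OF \<open>g \<in> vertex_fiber v\<close>]
        by (intro range_mult_block) (auto simp: block_fiber_def)
    qed
  qed (use hv a[OF h] b in \<open>auto simp: mult_closed\<close>)
  finally show ?thesis using 1 by (simp add: a_def b_def v_def)
qed

lemma t_from_S': "h \<in> arcs F \<Longrightarrow> t h \<otimes> adj D (t h) \<otimes> S' (\<Psi> h) = t h"
  by (simp add: mult_assoc adj_t_S' S_P_head)

end

section \<open>The inverse Cuntz-Krieger family\<close>

locale conjugacy_range_family = block_conjugacy E F \<Psi> \<Phi> n + ck_family A E s p
  for E :: "('v, 'e) pre_digraph" and F :: "('w, 'f) pre_digraph"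
    and \<Psi> :: "'f \<Rightarrow> 'e" and \<Phi> :: "'e list \<Rightarrow> 'f" and n :: nat
    and A :: "'a cstar" (structure) and s :: "'e \<Rightarrow> 'a" and p :: "'v \<Rightarrow> 'a"
begin

abbreviation tails :: "'f \<Rightarrow> 'e list set" where
  "tails g \<equiv> {\<alpha> \<in> paths_from E (head E (\<Psi> g)) (n - 1). \<Phi> (\<Psi> g # \<alpha>) = g}"

text \<open>The projection onto those continuations of \<Psi>(g) along which the block map returns
  \<open>g\<close>.\<close>

definition N :: "'f \<Rightarrow> 'a" where
  "N g = (\<Oplus>\<alpha>\<in>tails g. R (head E (\<Psi> g)) \<alpha>)"

definition T :: "'f \<Rightarrow> 'a" where
  "T g = s (\<Psi> g) \<otimes> N g"

text \<open>The start vertex is read off the block, as the blocks summed in \<open>Q w\<close> may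
  start at different vertices; blocks are nonempty since \<open>n \<ge> 1\<close>.\<close>

abbreviation block_proj :: "'e list \<Rightarrow> 'a" where
  "block_proj \<beta> \<equiv> R (tail E (hd \<beta>)) \<beta>"

definition Q :: "'w \<Rightarrow> 'a" where
  "Q w = (\<Oplus>\<beta>\<in>blocks_at w. block_proj \<beta>)"

lemma block_projection:
  assumes "\<beta> \<in> blocks_at w"
  shows "projection A (block_proj \<beta>)"
proof -
  obtain v where v: "\<beta> \<in> paths_from E v n" using assms by (auto simp: blocks_at_def)
  then show ?thesis using path_projection[OF v] \<Phi>_arc(3)[OF v] by simp
qed

lemma block_projections_orthogonal:
  assumes "\<beta> \<in> blocks_at w" "\<beta>' \<in> blocks_at w'" "\<beta> \<noteq> \<beta>'"
  shows "block_proj \<beta> \<otimes> block_proj \<beta>' = \<zero>"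
proof -
  obtain v v' where v: "\<beta> \<in> paths_from E v n" "\<beta>' \<in> paths_from E v' n"
    using assms by (auto simp: blocks_at_def)
  then show ?thesis
    using path_projections_orthogonal[OF v] \<Phi>_arc(3)[OF v(1)] \<Phi>_arc(3)[OF v(2)] assms(3) by simp
qed

lemma block_proj_closed: "\<beta> \<in> blocks_at w \<Longrightarrow> block_proj \<beta> \<in> carrier A"
  using block_projection by (auto simp: projection_def)

lemma Q_projection: "w \<in> verts F \<Longrightarrow> projection A (Q w)"
  unfolding Q_def
  by (rule projection_finsum) (auto intro: block_projection block_projections_orthogonal)

lemma Q_orthogonal:
  assumes "w \<in> verts F" "w' \<in> verts F" "w \<noteq> w'" shows "Q w \<otimes> Q w' = \<zero>"
proof -
  have disj: "blocks_at w \<inter> blocks_at w' = {}"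
    using assms(3) by (auto simp: blocks_at_def)
  have "Q w \<otimes> Q w' = (\<Oplus>\<beta>\<in>blocks_at w \<inter> blocks_at w'. block_proj \<beta> \<otimes> block_proj \<beta>)"
    unfolding Q_def
    using assms by (intro finsum_mult_finsum) (auto intro: block_projections_orthogonal block_proj_closed)
  then show ?thesis by (simp add: disj)
qed

text \<open>Extending the tails of length \<open>n - 1\<close> by one edge turns them into the
  n-blocks of \<open>successor_blocks\<close>. So \<open>N g\<close> depends only on the head of
  \<open>g\<close>, as CK1 demands.\<close>

lemma N_eq_Q:
  assumes g: "g \<in> arcs F" shows "N g = Q (head F g)"
proof -
  have "N g = (\<Oplus>\<beta>\<in>{\<beta> \<in> paths_from E (head E (\<Psi> g)) (Suc (n - 1)). butlast \<beta> \<in> tails g}. R (head E (\<Psi> g)) \<beta>)"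
    unfolding N_def by (rule finsum_path_projection_extend) auto
  also have "{\<beta> \<in> paths_from E (head E (\<Psi> g)) (Suc (n - 1)). butlast \<beta> \<in> tails g}
      = {\<beta> \<in> paths_from E (head E (\<Psi> g)) n. \<Phi> (\<Psi> g # butlast \<beta>) = g}"
    using E.butlast_in_paths_from[of _ "head E (\<Psi> g)" "n - 1"] unfolding Suc_n by blast
  also have "\<dots> = blocks_at (head F g)"
    unfolding successor_blocks[OF g] blocks_at_def ..
  also have "(\<Oplus>\<beta>\<in>blocks_at (head F g). R (head E (\<Psi> g)) \<beta>) = Q (head F g)"
    unfolding Q_def
  proof (rule finsum_cong')
    show "R (head E (\<Psi> g)) \<beta> = block_proj \<beta>" if "\<beta> \<in> blocks_at (head F g)" for \<beta>
    proof -
      have "\<beta> \<in> paths_from E (head E (\<Psi> g)) n"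
        using that unfolding blocks_at_def successor_blocks[OF g, symmetric] by blast
      then show ?thesis using \<Phi>_arc(3) by simp
    qed
  qed (auto simp: block_proj_closed)
  finally show ?thesis .
qed

lemma N_simps:
  assumes g: "g \<in> arcs F"
  shows "N g \<in> carrier A" "adj A (N g) = N g" "N g \<otimes> N g = N g"
    "p (head E (\<Psi> g)) \<otimes> N g = N g" "N g \<otimes> p (head E (\<Psi> g)) = N g"
proof -
  show N: "N g \<in> carrier A" "adj A (N g) = N g" "N g \<otimes> N g = N g"
    using Q_projection[of "head F g"] g by (auto simp: N_eq_Q projection_def)
  have v: "head E (\<Psi> g) \<in> verts E" using \<Psi>_arc[OF g] by simp
  have cl: "R (head E (\<Psi> g)) \<alpha> \<in> carrier A" if "\<alpha> \<in> tails g" for \<alpha>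
    using that path_projection_simps(1) by blast
  have fin: "finite (tails g)" by (rule finite_subset[of _ "paths_from E (head E (\<Psi> g)) (n - 1)"]) auto
  have "p (head E (\<Psi> g)) \<otimes> N g = (\<Oplus>\<alpha>\<in>tails g. p (head E (\<Psi> g)) \<otimes> R (head E (\<Psi> g)) \<alpha>)"
    unfolding N_def using cl v fin by (intro finsum_mult_left) auto
  also have "\<dots> = N g"
    unfolding N_def using cl path_projection_simps(4) by (intro finsum_cong') auto
  finally show 1: "p (head E (\<Psi> g)) \<otimes> N g = N g" .
  show "N g \<otimes> p (head E (\<Psi> g)) = N g"
    using arg_cong[OF 1, of "adj A"] N v by (simp add: adj_mult)
qed

lemma T_closed[simp]: "g \<in> arcs F \<Longrightarrow> T g \<in> carrier A"
  by (simp add: T_def N_simps \<Psi>_arc mult_closed)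

lemma adj_T_T:
  assumes g: "g \<in> arcs F" shows "adj A (T g) \<otimes> T g = Q (head F g)"
proof -
  have "adj A (T g) \<otimes> T g = N g \<otimes> ((adj A (s (\<Psi> g)) \<otimes> s (\<Psi> g)) \<otimes> N g)"
    using g \<Psi>_arc[OF g] by (simp add: T_def adj_mult N_simps mult_assoc mult_closed)
  also have "\<dots> = N g" using g \<Psi>_arc[OF g] by (simp add: adj_S_S N_simps)
  finally show ?thesis using g by (simp add: N_eq_Q)
qed

lemma T_adj_T:
  assumes g: "g \<in> arcs F"
  shows "T g \<otimes> adj A (T g) = (\<Oplus>\<beta>\<in>block_fiber g. R (tail E (\<Psi> g)) \<beta>)"
proof -
  have "T g \<otimes> adj A (T g) = s (\<Psi> g) \<otimes> (N g \<otimes> N g) \<otimes> adj A (s (\<Psi> g))"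
    using g \<Psi>_arc[OF g] by (simp add: T_def adj_mult N_simps(1,2) mult_assoc mult_closed)
  also have "\<dots> = s (\<Psi> g) \<otimes> N g \<otimes> adj A (s (\<Psi> g))"
    using g by (simp add: N_simps)
  also have "\<dots> = (\<Oplus>\<beta>\<in>block_fiber g. R (tail E (\<Psi> g)) \<beta>)"
    unfolding block_fiber_Cons[OF g] N_def
    by (rule finsum_sandwich[of _ _ "n - 1", symmetric]) (use \<Psi>_arc[OF g] in auto)
  finally show ?thesis .
qed

lemma Q_sum:
  assumes w: "w \<in> verts F" shows "Q w = (\<Oplus>g\<in>out_arcs F w. T g \<otimes> adj A (T g))"
proof -
  have "(\<Oplus>g\<in>out_arcs F w. T g \<otimes> adj A (T g)) = (\<Oplus>g\<in>out_arcs F w. \<Oplus>\<beta>\<in>block_fiber g. block_proj \<beta>)"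
  proof (rule finsum_cong')
    fix g assume "g \<in> out_arcs F w"
    then have g: "g \<in> arcs F" by simp
    have eq: "R (tail E (\<Psi> g)) \<beta> = block_proj \<beta>" if "\<beta> \<in> block_fiber g" for \<beta>
      using that \<Phi>_arc(3) unfolding block_fiber_def by force
    have "R (tail E (\<Psi> g)) \<beta> \<in> carrier A" if "\<beta> \<in> block_fiber g" for \<beta>
      using that path_projection_simps(1) unfolding block_fiber_def by blast
    then show "T g \<otimes> adj A (T g) = (\<Oplus>\<beta>\<in>block_fiber g. block_proj \<beta>)"
      unfolding T_adj_T[OF g] using eq by (intro finsum_cong') auto
  next
    show "(\<lambda>g. \<Oplus>\<beta>\<in>block_fiber g. block_proj \<beta>) \<in> out_arcs F w \<rightarrow> carrier A"
      using UN_block_fiber[of w] block_proj_closed by (auto intro!: finsum_closed)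
  qed simp
  also have "\<dots> = (\<Oplus>\<beta>\<in>(\<Union>g\<in>out_arcs F w. block_fiber g). block_proj \<beta>)"
  proof (rule finsum_UN_disjoint)
    show "block_proj \<beta> \<in> carrier A" if "g \<in> out_arcs F w" "\<beta> \<in> block_fiber g" for g \<beta>
      using that UN_block_fiber[of w] by (intro block_proj_closed[of _ w]) blast
    show "block_fiber g \<inter> block_fiber h = {}" if "g \<noteq> h" for g h
      using that by (auto simp: block_fiber_def)
  qed (use w in auto)
  finally show ?thesis
    unfolding UN_block_fiber Q_def by simp
qed

lemma inverse_CK_family: "CK_family F A T Q"
  unfolding CK_family_def
proof (intro conjI ballI impI)
  show "partial_isometry A (T g)" if "g \<in> arcs F" for g
    using that by (intro partial_isometryI) (simp_all add: adj_T_T Q_projection)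
  show "Q w = (\<Oplus>g\<in>out_arcs F w. T g \<otimes> adj A (T g))" if "w \<in> verts F" for w
    using that by (rule Q_sum)
qed (auto simp: Q_projection Q_orthogonal adj_T_T)

text \<open>Each path of length \<open>n - 1\<close> from the head of \<open>e\<close> is a tail for
  exactly one \<open>g\<close> over \<open>e\<close>, namely its value under \<Phi> after prefixing
  \<open>e\<close>; so the \<open>N g\<close> add up to the vertex projection there.\<close>

lemma finsum_T:
  assumes e: "e \<in> arcs E" shows "(\<Oplus>g\<in>edge_fiber e. T g) = s e"
proof -
  have g: "g \<in> arcs F" "\<Psi> g = e" if "g \<in> edge_fiber e" for g
    using that by (auto simp: edge_fiber_def)
  have "(\<Oplus>g\<in>edge_fiber e. T g) = (\<Oplus>g\<in>edge_fiber e. s e \<otimes> N g)"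
    using e g by (intro finsum_cong') (auto simp: T_def N_simps mult_closed)
  also have "\<dots> = s e \<otimes> (\<Oplus>g\<in>edge_fiber e. N g)"
    using e g by (intro finsum_mult_left[symmetric]) (auto simp: N_simps)
  also have "(\<Oplus>g\<in>edge_fiber e. N g)
      = (\<Oplus>g\<in>edge_fiber e. \<Oplus>\<alpha>\<in>{\<alpha> \<in> paths_from E (head E e) (n - 1). \<Phi> (e # \<alpha>) = g}. R (head E e) \<alpha>)"
    using g path_projection_simps(1) by (intro finsum_cong') (auto simp: N_def intro!: finsum_closed)
  also have "\<dots> = (\<Oplus>\<alpha>\<in>(\<Union>g\<in>edge_fiber e. {\<alpha> \<in> paths_from E (head E e) (n - 1). \<Phi> (e # \<alpha>) = g}). R (head E e) \<alpha>)"
    using path_projection_simps(1) by (intro finsum_UN_disjoint) auto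
  also have "(\<Union>g\<in>edge_fiber e. {\<alpha> \<in> paths_from E (head E e) (n - 1). \<Phi> (e # \<alpha>) = g})
      = paths_from E (head E e) (n - 1)"
  proof (intro subset_antisym subsetI)
    fix \<alpha> assume \<alpha>: "\<alpha> \<in> paths_from E (head E e) (n - 1)"
    then have "e # \<alpha> \<in> paths_from E (tail E e) n"
      using e E.Cons_in_paths_from[of e \<alpha> "tail E e" "n - 1"] Suc_n by simp
    then have "\<Phi> (e # \<alpha>) \<in> edge_fiber e"
      using \<Phi>_arc by (force simp: edge_fiber_def)
    with \<alpha> show "\<alpha> \<in> (\<Union>g\<in>edge_fiber e. {\<alpha> \<in> paths_from E (head E e) (n - 1). \<Phi> (e # \<alpha>) = g})"
      by blast
  qed blast
  also have "(\<Oplus>\<alpha>\<in>paths_from E (head E e) (n - 1). R (head E e) \<alpha>) = p (head E e)"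
    using e by (intro finsum_path_projection) simp
  also have "s e \<otimes> p (head E e) = s e" using e by (rule S_P_head)
  finally show ?thesis .
qed

text \<open>Counterpart of \<open>t_from_S'\<close>: a range projection and an edge of E determine
  \<open>T g\<close>, which reduces the check on generators of the second algebra to range
  projections.\<close>

lemma T_adj_T_s:
  assumes g: "g \<in> arcs F" shows "T g \<otimes> adj A (T g) \<otimes> s (\<Psi> g) = T g"
proof -
  have "T g \<otimes> adj A (T g) \<otimes> s (\<Psi> g) = s (\<Psi> g) \<otimes> (N g \<otimes> (N g \<otimes> (adj A (s (\<Psi> g)) \<otimes> s (\<Psi> g))))"
    using g \<Psi>_arc[OF g] by (simp add: T_def adj_mult N_simps(1,2) mult_assoc mult_closed)
  then show ?thesis
    using g \<Psi>_arc[OF g] by (simp add: adj_S_S N_simps T_def)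
qed

end

section \<open>The isomorphism\<close>

lemma (in cstar_hom) hom_path_projection:
  assumes "ck_family A G S P" and "\<And>e. e \<in> arcs G \<Longrightarrow> \<pi> (S e) = S' e" "\<And>v. v \<in> verts G \<Longrightarrow> \<pi> (P v) = P' v"
  shows "\<beta> \<in> paths_from G v k \<Longrightarrow> \<pi> (path_projection G A S P v \<beta>) = path_projection G B S' P' v \<beta>"
proof (induction k arbitrary: v \<beta>)
  case 0
  interpret ck_family A G S P by fact
  show ?case using 0 assms(3) length_paths_from[of \<beta> v 0] paths_from_vertex[of \<beta> v 0] by simp
next
  case (Suc k)
  interpret ck_family A G S P by fact
  obtain e \<gamma> where \<beta>: "\<beta> = e # \<gamma>" "e \<in> out_arcs G v" "\<gamma> \<in> paths_from G (head G e) k"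
    using Suc.prems unfolding paths_from_Suc by blast
  then show ?case
    using Suc.IH[OF \<beta>(3)] assms(2) path_projection_simps(1)[OF \<beta>(3)]
    by (simp add: hom_simps A.mult_closed)
qed

text \<open>Since there are no sinks, the vertex projections are determined by the edges.\<close>

lemma star_hom_id_on_graph_algebra:
  assumes ck: "ck_family A G S P" and gen: "generates A (S ` arcs G \<union> P ` verts G)"
    and \<sigma>: "star_hom A A \<sigma>" and S: "\<And>e. e \<in> arcs G \<Longrightarrow> \<sigma> (S e) = S e" and x: "x \<in> carrier A"
  shows "\<sigma> x = x"
proof -
  interpret ck_family A G S P by fact
  interpret hom: cstar_hom A A \<sigma> by unfold_locales (rule \<sigma>)
  have "\<sigma> (P v) = P v" if "v \<in> verts G" for v
  proof -
    have "\<sigma> (P v) = (\<Oplus>\<^bsub>A\<^esub>e\<in>out_arcs G v. \<sigma> (S e \<otimes>\<^bsub>A\<^esub> adj A (S e)))"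
      unfolding P_sum[OF that] by (rule hom.hom_finsum) (auto simp: mult_closed)
    also have "\<dots> = (\<Oplus>\<^bsub>A\<^esub>e\<in>out_arcs G v. S e \<otimes>\<^bsub>A\<^esub> adj A (S e))"
      using S by (intro finsum_cong') (auto simp: hom.hom_simps mult_closed)
    finally show ?thesis using P_sum[OF that] by simp
  qed
  moreover have "star_hom A A (\<lambda>x. x)" by (auto simp: star_hom_def)
  ultimately show ?thesis
    using star_hom_eqI[OF cstar_algebra_axioms cstar_algebra_axioms \<sigma> _ gen _ x, of "\<lambda>x. x"] S by blast
qed

text \<open>A block code has a letter at every place of the image, so the image is an infinite
  sequence in the closure and \<open>edge_shift_imp_infinite_path\<close> applies.\<close>

lemma infinite_path_of_edge_shift_value:
  assumes "\<theta> (inf_seq x) \<in> edge_shift G" and "\<And>i. \<theta> (inf_seq x) i = Some (y i)"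
  shows "\<theta> (inf_seq x) = inf_seq y" "y \<in> infinite_paths G"
proof -
  show "\<theta> (inf_seq x) = inf_seq y" using assms(2) by (simp add: inf_seq_def fun_eq_iff)
  then show "y \<in> infinite_paths G" using assms(1) edge_shift_imp_infinite_path by metis
qed

lemma block_conjugacy_of_block_codes:
  assumes E: "row_finite_graph E" and F: "row_finite_graph F" and n: "n \<ge> 1"
    and \<psi>: "block_code F E 1 \<Psi> \<psi>" and \<phi>: "block_code E F n \<Phi> \<phi>"
    and \<psi>\<phi>: "\<forall>x\<in>edge_shift E. \<psi> (\<phi> x) = x" and \<phi>\<psi>: "\<forall>y\<in>edge_shift F. \<phi> (\<psi> y) = y"
  shows "block_conjugacy E F (\<lambda>g. \<Psi> [g]) \<Phi> n"
proof -
  have \<psi>_val: "\<psi> (inf_seq y) = inf_seq (\<lambda>i. \<Psi> [y i])" "(\<lambda>i. \<Psi> [y i]) \<in> infinite_paths E"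
    if y: "y \<in> infinite_paths F" for y
  proof -
    have "\<psi> (inf_seq y) \<in> edge_shift E" "\<psi> (inf_seq y) i = Some (\<Psi> [y i])" for i
      using \<psi> y inf_seq_in_edge_shift[OF y] by (auto simp: block_code_def Pi_iff)
    then show "\<psi> (inf_seq y) = inf_seq (\<lambda>i. \<Psi> [y i])" "(\<lambda>i. \<Psi> [y i]) \<in> infinite_paths E"
      by (rule infinite_path_of_edge_shift_value[of \<psi> y])+
  qed
  have \<phi>_val: "\<phi> (inf_seq x) = inf_seq (\<lambda>i. \<Phi> (map x [i..<i + n]))"
    "(\<lambda>i. \<Phi> (map x [i..<i + n])) \<in> infinite_paths F" if x: "x \<in> infinite_paths E" for x
  proof -
    have "\<phi> (inf_seq x) \<in> edge_shift F" "\<phi> (inf_seq x) i = Some (\<Phi> (map x [i..<i + n]))" for i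
      using \<phi> x inf_seq_in_edge_shift[OF x] by (auto simp: block_code_def Pi_iff)
    then show "\<phi> (inf_seq x) = inf_seq (\<lambda>i. \<Phi> (map x [i..<i + n]))"
      "(\<lambda>i. \<Phi> (map x [i..<i + n])) \<in> infinite_paths F"
      by (rule infinite_path_of_edge_shift_value[of \<phi> x])+
  qed
  show ?thesis
  proof (intro block_conjugacy.intro E F block_conjugacy_axioms.intro n \<psi>_val \<phi>_val)
    fix x i assume x: "x \<in> infinite_paths E"
    have "inf_seq (\<lambda>i. \<Psi> [\<Phi> (map x [i..<i + n])]) = \<psi> (\<phi> (inf_seq x))"
      using \<phi>_val[OF x] \<psi>_val(1)[OF \<phi>_val(2)[OF x]] by simp
    also have "\<dots> = inf_seq x" using \<psi>\<phi> inf_seq_in_edge_shift[OF x] by blast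
    finally show "\<Psi> [\<Phi> (map x [i..<i + n])] = x i" by (simp add: inf_seq_def fun_eq_iff)
  next
    fix y i assume y: "y \<in> infinite_paths F"
    have "inf_seq (\<lambda>i. \<Phi> (map (\<lambda>i. \<Psi> [y i]) [i..<i + n])) = \<phi> (\<psi> (inf_seq y))"
      using \<psi>_val[OF y] \<phi>_val(1)[OF \<psi>_val(2)[OF y]] by simp
    also have "\<dots> = inf_seq y" using \<phi>\<psi> inf_seq_in_edge_shift[OF y] by blast
    finally show "\<Phi> (map (\<lambda>i. \<Psi> [y i]) [i..<i + n]) = y i" by (simp add: inf_seq_def fun_eq_iff)
  qed
qed

theorem theorem8p13:
  fixes E :: "('v, 'e) pre_digraph" and F :: "('w, 'f) pre_digraph"
    and A :: "'a cstar" and s :: "'e \<Rightarrow> 'a" and p :: "'v \<Rightarrow> 'a"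
    and D :: "'b cstar" and t :: "'f \<Rightarrow> 'b" and q :: "'w \<Rightarrow> 'b"
    and \<psi> :: "(nat \<Rightarrow> 'f option) \<Rightarrow> (nat \<Rightarrow> 'e option)"
    and \<phi> :: "(nat \<Rightarrow> 'e option) \<Rightarrow> (nat \<Rightarrow> 'f option)"
    and n :: nat and \<Phi> :: "'e list \<Rightarrow> 'f"
  assumes "directed_graph E" and "row_finite E" and "\<forall>v\<in>verts E. \<not> sink E v"
    and "directed_graph F" and "row_finite F" and "\<forall>w\<in>verts F. \<not> sink F w"
    and "graph_cstar_algebra E A s p"
    and "graph_cstar_algebra F D t q"
    and "conjugacy F E \<psi>" and "\<exists>\<Psi>. block_code F E 1 \<Psi> \<psi>"
    and "\<forall>x\<in>edge_shift E. \<psi> (\<phi> x) = x" and "\<forall>y\<in>edge_shift F. \<phi> (\<psi> y) = y"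
    and "n \<ge> 1" and "block_code E F n \<Phi> \<phi>"
  shows "\<exists>\<pi>. star_iso A D \<pi> \<and>
    (\<forall>e\<in>arcs E. \<pi> (s e) =
      (\<Oplus>\<^bsub>D\<^esub>g\<in>{g \<in> arcs F. \<exists>\<alpha>\<in>paths_from E (head E e) (n - 1). \<Phi> (e # \<alpha>) = g}. t g)) \<and>
    (\<forall>v\<in>verts E. \<pi> (p v) =
      (\<Oplus>\<^bsub>D\<^esub>g\<in>{g \<in> arcs F. \<exists>\<beta>\<in>paths_from E v n. \<Phi> \<beta> = g}. t g \<otimes>\<^bsub>D\<^esub> adj D (t g)))"
proof -
  obtain \<Psi> where \<psi>: "block_code F E 1 \<Psi> \<psi>" using assms(10) by blast
  have E: "row_finite_graph E" and F: "row_finite_graph F"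
    using assms(1-6) by (auto intro: row_finite_graph.intro row_finite_graph_axioms.intro)
  have A: "cstar_algebra A" "CK_family E A s p" "generates A (s ` arcs E \<union> p ` verts E)"
    and D: "cstar_algebra D" "CK_family F D t q" "generates D (t ` arcs F \<union> q ` verts F)"
    using assms(7,8) by (auto simp: graph_cstar_algebra_def)
  have ckA: "ck_family A E s p" and ckD: "ck_family D F t q"
    using A D E F by (auto intro!: ck_family.intro ck_family_axioms.intro)
  interpret block_conjugacy E F "\<lambda>g. \<Psi> [g]" \<Phi> n
    by (rule block_conjugacy_of_block_codes[OF E F assms(13) \<psi> assms(14,11,12)])
  interpret A: conjugacy_range_family E F "\<lambda>g. \<Psi> [g]" \<Phi> n A s p
    using ckA by (intro conjugacy_range_family.intro block_conjugacy_axioms)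
  interpret D: conjugacy_domain_family E F "\<lambda>g. \<Psi> [g]" \<Phi> n D t q
    using ckD by (intro conjugacy_domain_family.intro block_conjugacy_axioms)
  obtain \<pi> where \<pi>: "star_hom A D \<pi>" "\<And>e. e \<in> arcs E \<Longrightarrow> \<pi> (s e) = D.S' e"
    "\<And>v. v \<in> verts E \<Longrightarrow> \<pi> (p v) = D.P' v"
    using graph_cstar_algebra_universal[OF assms(1,7) D(1) D.induced_CK_family] by blast
  obtain \<rho> where \<rho>: "star_hom D A \<rho>" "\<And>g. g \<in> arcs F \<Longrightarrow> \<rho> (t g) = A.T g"
    using graph_cstar_algebra_universal[OF assms(4,8) A(1) A.inverse_CK_family] by blast
  interpret \<pi>: cstar_hom A D \<pi> by (intro cstar_hom.intro cstar_hom_axioms.intro A(1) D(1) \<pi>(1))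
  interpret \<rho>: cstar_hom D A \<rho> by (intro cstar_hom.intro cstar_hom_axioms.intro A(1) D(1) \<rho>(1))
  \<comment> \<open>The easy composite: the images of the t_g over a fiber add up to s_e
    again.\<close>
  have \<rho>\<pi>: "\<rho> (\<pi> x) = x" if "x \<in> carrier A" for x
  proof -
    have "(\<rho> \<circ> \<pi>) (s e) = s e" if e: "e \<in> arcs E" for e
    proof -
      have "\<rho> (\<pi> (s e)) = (\<Oplus>\<^bsub>A\<^esub>g\<in>edge_fiber e. \<rho> (t g))"
        unfolding \<pi>(2)[OF e] D.S'_def by (rule \<rho>.hom_finsum) (auto simp: D.fiber_arcs)
      also have "\<dots> = (\<Oplus>\<^bsub>A\<^esub>g\<in>edge_fiber e. A.T g)"
        by (intro A.finsum_cong') (auto simp: D.fiber_arcs \<rho>(2))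
      finally show ?thesis using A.finsum_T[OF e] by simp
    qed
    then show ?thesis
      using star_hom_id_on_graph_algebra[OF ckA A(3) star_hom_comp[OF \<pi>(1) \<rho>(1)] _ that] by simp
  qed
  have \<pi>\<rho>: "\<pi> (\<rho> y) = y" if "y \<in> carrier D" for y
  proof -
    have "(\<pi> \<circ> \<rho>) (t g) = t g" if g: "g \<in> arcs F" for g
    proof -
      let ?v = "tail E (\<Psi> [g])"
      \<comment> \<open>The range projection of \<open>A.T g\<close> is a sum of path projections,
        and \<pi> carries these to the path projections of the induced family, which
        \<open>finsum_block_fiber\<close> sums to the range projection of
        \<open>t g\<close>.\<close>
      have "\<pi> (A.T g \<otimes>\<^bsub>A\<^esub> adj A (A.T g)) = (\<Oplus>\<^bsub>D\<^esub>\<beta>\<in>block_fiber g. \<pi> (path_projection E A s p ?v \<beta>))"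
        unfolding A.T_adj_T[OF g]
        by (rule \<pi>.hom_finsum) (auto simp: block_fiber_def intro: A.path_projection_simps(1))
      also have "\<dots> = (\<Oplus>\<^bsub>D\<^esub>\<beta>\<in>block_fiber g. path_projection E D D.S' D.P' ?v \<beta>)"
      proof (rule D.finsum_cong')
        show "\<pi> (path_projection E A s p ?v \<beta>) = path_projection E D D.S' D.P' ?v \<beta>" if "\<beta> \<in> block_fiber g" for \<beta>
          using that \<pi>.hom_path_projection[OF ckA \<pi>(2,3)] by (auto simp: block_fiber_def)
      qed (auto simp: block_fiber_def intro: D.induced.path_projection_simps(1))
      also have "\<dots> = t g \<otimes>\<^bsub>D\<^esub> adj D (t g)" by (rule D.finsum_block_fiber[OF g])
      finally have range: "\<pi> (A.T g \<otimes>\<^bsub>A\<^esub> adj A (A.T g)) = t g \<otimes>\<^bsub>D\<^esub> adj D (t g)" .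
      have "\<pi> (\<rho> (t g)) = \<pi> (A.T g \<otimes>\<^bsub>A\<^esub> adj A (A.T g) \<otimes>\<^bsub>A\<^esub> s (\<Psi> [g]))"
        using A.T_adj_T_s[OF g] \<rho>(2)[OF g] by simp
      also have "\<dots> = \<pi> (A.T g \<otimes>\<^bsub>A\<^esub> adj A (A.T g)) \<otimes>\<^bsub>D\<^esub> \<pi> (s (\<Psi> [g]))"
        using g \<Psi>_arc[OF g] by (intro \<pi>.hom_simps(3)) (auto simp: A.mult_closed A.adj_closed)
      also have "\<dots> = t g"
        unfolding range \<pi>(2)[OF \<Psi>_arc[OF g]] by (rule D.t_from_S'[OF g])
      finally show ?thesis by simp
    qed
    then show ?thesis
      using star_hom_id_on_graph_algebra[OF ckD D(3) star_hom_comp[OF \<rho>(1) \<pi>(1)] _ that] by simp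
  qed
  have "bij_betw \<pi> (carrier A) (carrier D)"
    by (rule bij_betw_byWitness[of _ \<rho>]) (use \<rho>\<pi> \<pi>\<rho> in \<open>auto simp: \<pi>.hom_simps \<rho>.hom_simps\<close>)
  then have "star_iso A D \<pi>" using \<pi>(1) by (simp add: star_iso_def)
  then show ?thesis
    using \<pi>(2,3) edge_fiber_eq vertex_fiber_eq by (intro exI[of _ \<pi>]) (simp add: D.S'_def D.P'_def)
qed

end
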